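(* Let $k\ge1$ be an integer, let $N$ be a positive integer, and let $\frac pq$ (in lowest terms, $q>0$) be a rational number which is $\Gamma_0(4N)$-equivalent to $i\infty$ and such that $p^2\equiv 1\pmod q$. Let $f(z)=\sum_{n=1}^{\infty}a_f(n)e^{2\pi i nz}\in S_{k+\frac12}(\Gamma_0(4N))$ be nonzero, with the $a_f(n)$ either all real or all purely imaginary. Let $N_{0,p/q}(T)$ denote the number of zeros of $L_{p/q}(s,f)$ of the form $s=\frac k2+\frac14+it$ with $0\le t\le T$. Then $N_{0,p/q}(T)\gg T$; equivalently, there exists $d>0$ such that $$\liminf_{T\to\infty}\frac{N_{0,p/q}(T)}{T}>d.$$
   Context: $\mathbb{H}=\{w\in\mathbb{C}:\mathrm{Im}(w)>0\}$. The square root $z^{1/2}$ is chosen with $-\frac{\pi}{2}<\arg(z^{1/2})\le\frac{\pi}{2}$, and half-integral powers are $z^{k+1/2}=(z^{1/2})^{2k+1}$. $S_{k+\frac12}(\Gamma_0(4N))$ is the space of cusp forms of weight $k+\frac12$ on $\Gamma_0(4N)$: holomorphic functions $f$ on $\mathbb{H}$, vanishing at all cusps, satisfying $$f\left(\frac{az+b}{cz+d}\right)=\left(\frac{c}{d}\right)^{2k+1}\epsilon_d^{-2k-1}(cz+d)^{k+\frac12}f(z)\quad\text{for all }\begin{pmatrix}a&b\\c&d\end{pmatrix}\in\Gamma_0(4N),$$ where $\left(\frac{c}{d}\right)$ is Shimura's extension of the Jacobi symbol (for odd $d$: the Jacobi symbol $\left(\frac{c}{d}\right)$ if $d>0$;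 for $d<0$ and $c\neq0$, it is $\left(\frac{c}{|d|}\right)$ if $c>0$ and $-\left(\frac{c}{|d|}\right)$ if $c<0$; and $\left(\frac{0}{\pm1}\right)=1$), and $\epsilon_d=1$ if $d\equiv1\bmod 4$, $\epsilon_d=i$ if $d\equiv 3\bmod 4$. Such $f$ has a Fourier expansion $f(z)=\sum_{n\ge1}a_f(n)e^{2\pi i n z}$. A rational number $p/q$ is $\Gamma_0(4N)$-equivalent to $i\infty$ if $\gamma(i\infty)=p/q$ for some $\gamma\in\Gamma_0(4N)$. The additively twisted $L$-function is $L_{p/q}(s,f)=\sum_{n\ge1}a_f(n)e^{2\pi i pn/q}n^{-s}$ for $\mathrm{Re}(s)$ large, and $L_{p/q}(s,f)$ also denotes its continuation to an entire function of $s$. *)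

theory Defs
  imports
    "HOL-Complex_Analysis.Complex_Analysis"
    "HOL-Number_Theory.Number_Theory"
begin

definition upper_half_plane :: "complex set" where
  "upper_half_plane = {w. Im w > 0}"

text \<open>The tuple \<open>(a, b, c, d)\<close> stands for the matrix with rows \<open>(a, b)\<close> and \<open>(c, d)\<close>.\<close>

definition SL2Z :: "(int \<times> int \<times> int \<times> int) set" where
  "SL2Z = {(a, b, c, d). a * d - b * c = 1}"

definition Gamma0 :: "nat \<Rightarrow> (int \<times> int \<times> int \<times> int) set" where
  "Gamma0 M = {(a, b, c, d). (a, b, c, d) \<in> SL2Z \<and> int M dvd c}"

definition Gamma0_equiv_infinity :: "nat \<Rightarrow> rat \<Rightarrow> bool" where
  "Gamma0_equiv_infinity M r \<longleftrightarrow>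
     (\<exists>(a, b, c, d) \<in> Gamma0 M. c \<noteq> 0 \<and> r = of_int a / of_int c)"

text \<open>Only meaningful for odd \<open>n > 0\<close>.\<close>

definition Jacobi :: "int \<Rightarrow> int \<Rightarrow> int" where
  "Jacobi c n = (\<Prod>p\<in>#prime_factorization n. Legendre c p)"

text \<open>Shimura's extension of the Jacobi symbol; only meaningful for odd \<open>d\<close>.\<close>

definition Shimura_symbol :: "int \<Rightarrow> int \<Rightarrow> int" where
  "Shimura_symbol c d =
     (if c = 0 then (if \<bar>d\<bar> = 1 then 1 else 0)
      else if d > 0 then Jacobi c d
      else if c > 0 then Jacobi c \<bar>d\<bar>
      else - Jacobi c \<bar>d\<bar>)"

text \<open>Only meaningful for odd \<open>d\<close>.\<close>

definition eps_factor :: "int \<Rightarrow> complex" where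
  "eps_factor d = (if [d = 1] (mod 4) then 1 else \<i>)"

text \<open>
  The branch of \<^const>\<open>csqrt\<close> is the one with argument in \<open>(-pi/2, pi/2]\<close>.
\<close>

definition half_power :: "complex \<Rightarrow> nat \<Rightarrow> complex" where
  "half_power z k = csqrt z ^ (2 * k + 1)"

text \<open>
  Every cusp is the image of \<open>i\<infinity>\<close> under some matrix of \<^const>\<open>SL2Z\<close>, so vanishing at all cusps
  says that each translate of \<open>f\<close> by such a matrix, under the weight \<open>k + 1/2\<close> action,
  tends to 0 as the imaginary part tends to infinity (uniformly in the real part). The choice of
  the branch of the automorphy factor does not matter for this condition.
\<close>

definition vanishes_at_cusps :: "nat \<Rightarrow> (complex \<Rightarrow> complex) \<Rightarrow> bool" where
  "vanishes_at_cusps k f \<longleftrightarrow>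
     (\<forall>(a, b, c, d) \<in> SL2Z.
        ((\<lambda>z. f ((of_int a * z + of_int b) / (of_int c * z + of_int d)) /
               half_power (of_int c * z + of_int d) k) \<longlongrightarrow> 0) (filtercomap Im at_top))"

text \<open>The space of cusp forms of weight \<open>k + 1/2\<close> on \<open>\<Gamma>\<^sub>0(4N)\<close>.\<close>

definition half_weight_cusp_forms :: "nat \<Rightarrow> nat \<Rightarrow> (complex \<Rightarrow> complex) set" where
  "half_weight_cusp_forms k N = {f.
     f holomorphic_on upper_half_plane \<and>
     (\<forall>(a, b, c, d) \<in> Gamma0 (4 * N). \<forall>z \<in> upper_half_plane.
        f ((of_int a * z + of_int b) / (of_int c * z + of_int d)) =
          of_int (Shimura_symbol c d) ^ (2 * k + 1) *
          eps_factor d powi (- 2 * int k - 1) *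
          half_power (of_int c * z + of_int d) k * f z) \<and>
     vanishes_at_cusps k f}"

definition is_fourier_expansion :: "(complex \<Rightarrow> complex) \<Rightarrow> (nat \<Rightarrow> complex) \<Rightarrow> bool" where
  "is_fourier_expansion f a \<longleftrightarrow>
     (\<forall>z \<in> upper_half_plane.
        ((\<lambda>n. a n * exp (2 * of_real pi * \<i> * of_nat n * z)) has_sum f z) {1..})"

text \<open>
  The entire continuation of the additively twisted Dirichlet series; it is unique by the
  identity theorem whenever it exists.
\<close>

definition twisted_L :: "(nat \<Rightarrow> complex) \<Rightarrow> int \<Rightarrow> int \<Rightarrow> complex \<Rightarrow> complex" where
  "twisted_L a p q = (THE L. L holomorphic_on UNIV \<and>
     (\<exists>\<sigma>::real. \<forall>s. Re s > \<sigma> \<longrightarrow>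
        ((\<lambda>n. a n * exp (2 * of_real pi * \<i> * of_int p * of_nat n / of_int q) *
              of_nat n powr (- s)) has_sum L s) {1..}))"

text \<open>Zeros on the critical line are counted without multiplicity.\<close>

definition critical_zero_count ::
  "nat \<Rightarrow> (nat \<Rightarrow> complex) \<Rightarrow> int \<Rightarrow> int \<Rightarrow> real \<Rightarrow> nat" where
  "critical_zero_count k a p q T =
     card {s. \<exists>t::real. 0 \<le> t \<and> t \<le> T \<and> s = of_nat k / 2 + 1 / 4 + \<i> * of_real t \<and>
              twisted_L a p q s = 0}"

end

theory Submission
  imports Defs "HOL-Probability.Probability" "HOL-Real_Asymp.Real_Asymp"
begin

text \<open>
  The method is that of Hardy and Littlewood. Put \<open>F w = f (p/q + i w/q)\<close> for \<open>Re w > 0\<close>. Since a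
  matrix of \<open>\<Gamma>\<^sub>0(4N)\<close> sends \<open>i\<infinity>\<close> to \<open>p/q\<close> and \<open>p\<^sup>2 \<equiv> 1 (mod q)\<close>, and since conjugation acts on \<open>f\<close> by a
  sign, \<open>F (1/x)\<close> equals \<open>x powr (k + 1/2) * cnj (F x)\<close> up to a constant phase for real \<open>x > 0\<close>. Hence
  the completed \<open>L\<close>-function, which is the Fourier transform of \<open>F (exp v) * exp (s v)\<close>, is real on the
  critical line up to a constant phase.

  Moving the line of integration to \<open>F (exp (v + i \<theta>))\<close> with \<open>\<theta> = pi/2 - 1/T\<close> compensates the decay of the
  Gamma factor at heights \<open>t\<close> of order \<open>T\<close>. The bound \<open>\<bar>f z\<bar> \<le> B * Im z powr (- (k + 1/2) / 2)\<close> and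
  Bessel's inequality then give two estimates. First, the integral of the rotated Fourier transform over an
  interval of fixed length \<open>H\<close> is, in quadratic mean over \<open>T \<le> t \<le> 2T\<close>, of relative size \<open>sqrt H\<close>.
  Second, the mean value of \<open>\<bar>L\<bar>\<close> on the line \<open>Re s = \<sigma>\<close> is \<open>O((\<sigma> - k/2 - 1/4) powr (-1/2))\<close>, which is
  integrable in \<open>\<sigma>\<close>; shifting the path to a line on which the first Dirichlet coefficient dominates shows
  that the integral of \<open>\<bar>L\<bar>\<close> over a critical segment of length \<open>H\<close> is on average at least a constant times
  \<open>H\<close>. On a segment without zeros a real function has constant sign, so both integrals agree in absolute
  value; for large \<open>H\<close> this can happen only for a small proportion of the segments.
\<close>

section \<open>A Bessel inequality for the Fourier transform\<close>

text \<open>The obstacle is a logarithm. On the critical line the bound on \<open>f\<close> makes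
  the rotated integrand bounded uniformly in \<open>v\<close>, but a mean square of \<open>L\<close>
  derived from this alone would carry a factor \<open>ln T\<close>, which ruins a positive
  proportion. Two devices avoid it. Averaging over a segment of length \<open>H\<close> multiplies
  the integrand by the Fourier transform of an interval: the supremum of the integrand then
  suffices, and square integrability comes from the interval, at the price \<open>H\<close> instead
  of \<open>H\<close> squared. The size of \<open>L\<close> itself is only measured strictly to the
  right of the critical line, where the loss is a power of the distance to it. The tilt
  \<open>1 / T\<close> is a compromise: a larger one would leave an exponentially large factor at
  height \<open>T\<close>, a smaller one would enlarge the negative powers of
  \<open>cos \<theta>\<close>, which here cost exactly the power of \<open>T\<close> that the Gamma
  factor returns.\<close>

lemma integrable_lborel_pair_times:
  fixes f g :: "real \<Rightarrow> real"
  assumes "integrable lborel f" "integrable lborel g"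
  shows "integrable (lborel \<Otimes>\<^sub>M lborel) (\<lambda>(x, y). f x * g y)"
proof -
  have [measurable]: "f \<in> borel_measurable borel" "g \<in> borel_measurable borel"
    using assms by auto
  show ?thesis
    by (rule lborel_pair.Fubini_integrable) (use assms in \<open>auto simp: abs_mult\<close>)
qed

lemma gaussian_integrable:
  fixes T :: real
  assumes "T > 0"
  shows "integrable lborel (\<lambda>t. exp (- (t / T)\<^sup>2 / 2))"
    and "(LBINT t. exp (- (t / T)\<^sup>2 / 2)) = T * sqrt (2 * pi)"
proof -
  have eq: "exp (- (t / T)\<^sup>2 / 2) = T * sqrt (2 * pi) * normal_density 0 T t" for t
    using assms by (simp add: normal_density_def real_sqrt_mult power_divide field_simps)
  show "integrable lborel (\<lambda>t. exp (- (t / T)\<^sup>2 / 2))"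
    unfolding eq using integrable_normal_density[OF assms] by (rule integrable_mult_right)
  show "(LBINT t. exp (- (t / T)\<^sup>2 / 2)) = T * sqrt (2 * pi)"
    unfolding eq using integral_normal_density[OF assms, of 0] by simp
qed

text \<open>The characteristic function of the standard normal law, rescaled by
  \<open>T\<close>.\<close>

lemma gaussian_fourier:
  fixes T x :: real
  assumes "T > 0"
  shows "(LBINT t. of_real (exp (- (t / T)\<^sup>2 / 2)) * iexp (t * x)) =
           complex_of_real (T * sqrt (2 * pi) * exp (- (x * T)\<^sup>2 / 2))"
proof -
  have "complex_of_real (exp (- ((x * T)^2) / 2)) = char std_normal_distribution (x * T)"
    by (simp add: char_std_normal_distribution)
  also have "\<dots> = (LBINT t. std_normal_density t *\<^sub>R iexp (x * T * t))"
    unfolding char_def by (rule integral_density) (auto simp: normal_density_nonneg)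
  also have "\<dots> = (LBINT t. of_real (exp (- t\<^sup>2 / 2)) * iexp (x * T * t) / of_real (sqrt (2 * pi)))"
    by (intro Bochner_Integration.integral_cong) (auto simp: normal_density_def scaleR_conv_of_real)
  finally have 1: "(LBINT t. of_real (exp (- t\<^sup>2 / 2)) * iexp (x * T * t)) =
      complex_of_real (sqrt (2 * pi)) * complex_of_real (exp (- ((x * T)^2) / 2))"
    by simp
  have "(LBINT t. of_real (exp (- (t / T)\<^sup>2 / 2)) * iexp (t * x)) =
    \<bar>T\<bar> *\<^sub>R (LBINT t. of_real (exp (- ((0 + T * t) / T)\<^sup>2 / 2)) * iexp ((0 + T * t) * x))"
    using assms by (intro lborel_integral_real_affine) auto
  also have "\<dots> = T *\<^sub>R (LBINT t. of_real (exp (- t\<^sup>2 / 2)) * iexp (x * T * t))"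
    using assms by (simp add: algebra_simps)
  finally show ?thesis
    unfolding 1 by (simp add: scaleR_conv_of_real)
qed

lemma fourier_norm_le:
  fixes g :: "real \<Rightarrow> complex"
  assumes "integrable lborel g"
  shows "norm (LBINT v. g v * iexp (t * v)) \<le> (LBINT v. norm (g v))"
  using integral_norm_bound[of lborel "\<lambda>v. g v * iexp (t * v)"] by (simp add: norm_mult)

lemma fourier_continuous:
  fixes g :: "real \<Rightarrow> complex"
  assumes "integrable lborel g"
  shows "continuous_on A (\<lambda>t. LBINT v. g v * iexp (t * v))"
proof (intro continuous_at_imp_continuous_on ballI)
  fix t :: real
  have [measurable]: "g \<in> borel_measurable borel" using assms by auto
  show "isCont (\<lambda>t. LBINT v. g v * iexp (t * v)) t"
    unfolding continuous_at_sequentially comp_def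
  proof safe
    fix X :: "nat \<Rightarrow> real" assume X: "X \<longlonglongrightarrow> t"
    show "(\<lambda>n. LBINT v. g v * iexp (X n * v)) \<longlonglongrightarrow> (LBINT v. g v * iexp (t * v))"
    proof (rule integral_dominated_convergence[where w = "\<lambda>v. norm (g v)"])
      show "AE v in lborel. (\<lambda>n. g v * iexp (X n * v)) \<longlonglongrightarrow> g v * iexp (t * v)"
        by (intro AE_I2 tendsto_intros X)
    qed (use assms in \<open>auto simp: norm_mult\<close>)
  qed
qed

text \<open>The Gaussian weight has a nonnegative Fourier transform of total mass \<open>2 pi\<close>, so Schur's test
  applies after expanding the square.\<close>

lemma fourier_bessel:
  fixes g :: "real \<Rightarrow> complex"
  assumes g: "integrable lborel g" and g2: "integrable lborel (\<lambda>v. (norm (g v))\<^sup>2)"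
    and T: "T > 0" and ab: "-3 * T \<le> a" "b \<le> 3 * T"
  shows "integral {a..b} (\<lambda>t. (norm (LBINT v. g v * iexp (t * v)))\<^sup>2)
           \<le> 2 * pi * exp (9 / 2) * (LBINT v. (norm (g v))\<^sup>2)"
proof -
  have gm[measurable]: "g \<in> borel_measurable borel" using g by auto
  define G where "G t = (LBINT v. g v * iexp (t * v))" for t
  define W where "W t = exp (- (t / T)\<^sup>2 / 2)" for t :: real
  \<comment> \<open>\<open>K\<close> is the Fourier transform of the weight \<open>W\<close>. Its
    total mass is \<open>2 * pi\<close> for every \<open>T\<close>, so the final constant does not
    depend on \<open>T\<close>.\<close>
  define K where "K x = T * sqrt (2 * pi) * exp (- (x * T)\<^sup>2 / 2)" for x :: real
  define B where "B = (LBINT v. norm (g v))"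
  have GB: "norm (G t) \<le> B" for t
    unfolding G_def B_def by (rule fourier_norm_le[OF g])
  have Gc: "continuous_on A G" for A
    unfolding G_def by (rule fourier_continuous[OF g])
  have [measurable]: "G \<in> borel_measurable borel"
    by (rule borel_measurable_continuous_onI[OF Gc])
  have cnjm: "cnj \<in> borel_measurable borel"
    by (intro borel_measurable_continuous_onI continuous_intros)
  have [measurable]: "(\<lambda>t. cnj (G t)) \<in> borel_measurable borel" "(\<lambda>t. cnj (g t)) \<in> borel_measurable borel"
    by (rule measurable_compose[OF _ cnjm], measurable)+
  have Wm[measurable]: "W \<in> borel_measurable borel" and Km[measurable]: "K \<in> borel_measurable borel"
    unfolding W_def K_def by measurable
  have Wi: "integrable lborel W" unfolding W_def using gaussian_integrable(1)[OF T] .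
  have Kpos: "K x \<ge> 0" for x using T by (auto simp: K_def)
  have Ki: "integrable lborel K" and Kint: "(LBINT x. K x) = 2 * pi"
  proof -
    have eq: "K x = T * sqrt (2 * pi) * exp (- (x / (1 / T))\<^sup>2 / 2)" for x by (simp add: K_def)
    have T': "1 / T > 0" using T by simp
    show "integrable lborel K" unfolding eq using gaussian_integrable(1)[OF T'] by (rule integrable_mult_right)
    have "(LBINT x. K x) = T * sqrt (2 * pi) * (1 / T * sqrt (2 * pi))"
      unfolding eq using gaussian_integrable(2)[OF T'] by (simp only: integral_mult_right_zero)
    also have "\<dots> = (sqrt (2 * pi))\<^sup>2" using T by (simp add: power2_eq_square)
    finally show "(LBINT x. K x) = 2 * pi" by simp
  qed
  have Wpos: "W t \<ge> 0" for t by (simp add: W_def)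
  have Bpos: "B \<ge> 0" unfolding B_def by (intro integral_nonneg_AE) auto
  have WGg: "W t * norm (G t) * (norm (g u)) \<le> W t * B * norm (g u)" for t u
    by (intro mult_right_mono mult_left_mono GB Wpos) auto
  have WG: "integrable lborel (\<lambda>t. W t * (norm (G t))\<^sup>2)"
  proof (rule Bochner_Integration.integrable_bound[of lborel "\<lambda>t. W t * B\<^sup>2"])
    show "AE t in lborel. norm (W t * (norm (G t))\<^sup>2) \<le> norm (W t * B\<^sup>2)"
      using GB by (auto simp: abs_mult intro!: mult_left_mono power_mono)
  qed (use Wi in auto)
  have "complex_of_real (LBINT t. W t * (norm (G t))\<^sup>2) = (LBINT t. of_real (W t) * (G t * cnj (G t)))"
    by (simp flip: complex_norm_square integral_complex_of_real)
  \<comment> \<open>Only one factor of \<open>G t * cnj (G t)\<close> is opened here. The other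
    stays bounded by \<open>B\<close>, which gives Fubini the majorant
    \<open>W t * B * norm (g u)\<close>; it is opened later, for fixed \<open>u\<close>.\<close>
  also have "\<dots> = (LBINT t. LBINT u. of_real (W t) * cnj (G t) * (g u * iexp (t * u)))"
    unfolding integral_mult_right_zero G_def[symmetric] by (simp add: mult_ac)
  also have "\<dots> = (LBINT u. LBINT t. of_real (W t) * cnj (G t) * (g u * iexp (t * u)))"
  proof (rule lborel_pair.Fubini_integral[symmetric])
    show "integrable (lborel \<Otimes>\<^sub>M lborel) (\<lambda>(t, u). of_real (W t) * cnj (G t) * (g u * iexp (t * u)))"
    proof (rule Bochner_Integration.integrable_bound[OF integrable_lborel_pair_times[of "\<lambda>t. W t * B" "\<lambda>u. norm (g u)"]])
      show "AE x in lborel \<Otimes>\<^sub>M lborel. norm (case x of (t, u) \<Rightarrow> of_real (W t) * cnj (G t) * (g u * iexp (t * u)))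
              \<le> norm (case x of (t, u) \<Rightarrow> W t * B * norm (g u))"
        using WGg Bpos Wpos by (auto simp: abs_mult norm_mult intro!: AE_I2)
      show "(\<lambda>(t, u). of_real (W t) * cnj (G t) * (g u * iexp (t * u))) \<in> borel_measurable (lborel \<Otimes>\<^sub>M lborel)"
        by measurable
    qed (use Wi g in auto)
  qed
  also have "\<dots> = (LBINT u. g u * (LBINT v. cnj (g v) * of_real (K (u - v))))"
  proof (intro Bochner_Integration.integral_cong refl)
    fix u :: real
    have "(LBINT t. of_real (W t) * cnj (G t) * (g u * iexp (t * u))) =
          (LBINT t. g u * (of_real (W t) * cnj (G t) * iexp (t * u)))"
      by (simp add: mult_ac)
    also have "\<dots> = g u * (LBINT t. of_real (W t) * cnj (G t) * iexp (t * u))"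
      by (rule integral_mult_right_zero)
    also have "(LBINT t. of_real (W t) * cnj (G t) * iexp (t * u)) =
          (LBINT t. LBINT v. of_real (W t) * iexp (t * u) * (cnj (g v) * exp (- \<i> * of_real (t * v))))"
    proof (intro Bochner_Integration.integral_cong refl)
      fix t :: real
      have "cnj (G t) = (LBINT v. cnj (g v) * exp (- \<i> * of_real (t * v)))"
        unfolding G_def by (subst Bochner_Integration.integral_cnj[symmetric]) (simp add: exp_cnj)
      then show "of_real (W t) * cnj (G t) * iexp (t * u) =
          (LBINT v. of_real (W t) * iexp (t * u) * (cnj (g v) * exp (- \<i> * of_real (t * v))))"
        unfolding integral_mult_right_zero by (simp add: mult_ac)
    qed
    also have "\<dots> = (LBINT v. LBINT t. of_real (W t) * iexp (t * u) * (cnj (g v) * exp (- \<i> * of_real (t * v))))"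
    proof (rule lborel_pair.Fubini_integral[symmetric])
      show "integrable (lborel \<Otimes>\<^sub>M lborel) (\<lambda>(t, v). of_real (W t) * iexp (t * u) * (cnj (g v) * exp (- \<i> * of_real (t * v))))"
        by (rule Bochner_Integration.integrable_bound[OF integrable_lborel_pair_times[of "\<lambda>t. W t" "\<lambda>u. norm (g u)"]])
           (use Wi g in \<open>auto simp: norm_mult abs_mult\<close>)
    qed
    also have "\<dots> = (LBINT v. cnj (g v) * of_real (K (u - v)))"
    proof (intro Bochner_Integration.integral_cong refl)
      fix v :: real
      have "(LBINT t. of_real (W t) * iexp (t * u) * (cnj (g v) * exp (- \<i> * of_real (t * v)))) =
            (LBINT t. cnj (g v) * (of_real (W t) * iexp (t * (u - v))))"
        by (intro Bochner_Integration.integral_cong refl) (simp add: algebra_simps exp_diff exp_minus field_simps)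
      also have "\<dots> = cnj (g v) * of_real (K (u - v))"
        using gaussian_fourier[OF T, of "u - v"] unfolding W_def K_def by simp
      finally show "(LBINT t. of_real (W t) * iexp (t * u) * (cnj (g v) * exp (- \<i> * of_real (t * v)))) = cnj (g v) * of_real (K (u - v))" .
    qed
    finally show "(LBINT t. of_real (W t) * cnj (G t) * (g u * iexp (t * u))) =
       g u * (LBINT v. cnj (g v) * of_real (K (u - v)))" .
  qed
  finally have main: "complex_of_real (LBINT t. W t * (norm (G t))\<^sup>2) =
      (LBINT u. g u * (LBINT v. cnj (g v) * of_real (K (u - v))))" .
  have Kshift: "integrable lborel (\<lambda>v. K (u - v))" "(LBINT v. K (u - v)) = 2 * pi"
       "integrable lborel (\<lambda>v. K (v - u))" "(LBINT v. K (v - u)) = 2 * pi" for u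
  proof -
    show 1: "integrable lborel (\<lambda>v. K (u - v))"
      using lborel_integrable_real_affine[OF Ki, of "-1" u] by simp
    show 2: "(LBINT v. K (u - v)) = 2 * pi"
      using lborel_integral_real_affine[of "-1" K u] Kint by simp
    have "K (u - v) = K (v - u)" for v unfolding K_def by (simp add: power2_eq_square algebra_simps)
    then show "integrable lborel (\<lambda>v. K (v - u))" "(LBINT v. K (v - u)) = 2 * pi"
      using 1 2 by auto
  qed
  define S where "S = (LBINT v. (norm (g v))\<^sup>2)"
  have KB: "K x \<le> T * sqrt (2 * pi)" for x using T by (simp add: K_def mult_le_cancel_left1)
  have P1: "integrable (lborel \<Otimes>\<^sub>M lborel) (\<lambda>(u, v). (norm (g u))\<^sup>2 * K (u - v))"
    by (rule lborel_pair.Fubini_integrable)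
       (use g2 Kshift Kpos in \<open>auto simp: abs_mult\<close>)
  have P2: "integrable (lborel \<Otimes>\<^sub>M lborel) (\<lambda>(u, v). (norm (g v))\<^sup>2 * K (u - v))"
  proof -
    have "integrable (lborel \<Otimes>\<^sub>M lborel) (\<lambda>(v, u). (norm (g v))\<^sup>2 * K (u - v))"
    by (rule lborel_pair.Fubini_integrable)
       (use g2 Kshift Kpos in \<open>auto simp: abs_mult\<close>)
    from lborel_pair.integrable_product_swap[OF this] show ?thesis by (simp add: case_prod_unfold)
  qed
  have P: "integrable (lborel \<Otimes>\<^sub>M lborel) (\<lambda>(u, v). norm (g u) * (norm (g v) * K (u - v)))"
  proof (rule Bochner_Integration.integrable_bound[OF integrable_lborel_pair_times[of "\<lambda>u. norm (g u)" "\<lambda>u. norm (g u) * (T * sqrt (2 * pi))"]])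
    show "AE x in lborel \<Otimes>\<^sub>M lborel. norm (case x of (u, v) \<Rightarrow> norm (g u) * (norm (g v) * K (u - v)))
              \<le> norm (case x of (u, v) \<Rightarrow> norm (g u) * (norm (g v) * (T * sqrt (2 * pi))))"
      using KB Kpos T by (auto simp: abs_mult intro!: AE_I2 mult_left_mono)
  qed (use g in auto)
  have "(LBINT t. W t * (norm (G t))\<^sup>2) \<le> norm (complex_of_real (LBINT t. W t * (norm (G t))\<^sup>2))"
    by simp
  also have "\<dots> \<le> (LBINT u. norm (g u) * (LBINT v. norm (g v) * K (u - v)))"
    unfolding main
  proof (rule Bochner_Integration.integral_norm_bound_integral)
    show int: "integrable lborel (\<lambda>u. norm (g u) * (LBINT v. norm (g v) * K (u - v)))"
      using lborel_pair.integrable_fst[OF P] by simp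
    show bnd: "norm (g u * (LBINT v. cnj (g v) * of_real (K (u - v)))) \<le> norm (g u) * (LBINT v. norm (g v) * K (u - v))" for u
    proof -
      have "norm (LBINT v. cnj (g v) * of_real (K (u - v))) \<le> (LBINT v. norm (cnj (g v) * of_real (K (u - v))))"
        by (rule integral_norm_bound)
      then show "norm (g u * (LBINT v. cnj (g v) * of_real (K (u - v)))) \<le> norm (g u) * (LBINT v. norm (g v) * K (u - v))"
        using Kpos by (simp add: norm_mult mult_left_mono)
    qed
    show "integrable lborel (\<lambda>u. g u * (LBINT v. cnj (g v) * of_real (K (u - v))))"
      by (rule Bochner_Integration.integrable_bound[OF int], measurable)
         (use bnd in \<open>auto intro!: AE_I2 order.trans[OF _ abs_ge_self]\<close>)
  qed
  also have "\<dots> = (LBINT u. LBINT v. norm (g u) * (norm (g v) * K (u - v)))" by simp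
  also have "\<dots> = integral\<^sup>L (lborel \<Otimes>\<^sub>M lborel) (\<lambda>(u, v). norm (g u) * (norm (g v) * K (u - v)))"
    by (rule lborel_pair.integral_fst[OF P])
  \<comment> \<open>The arithmetic-geometric mean separates \<open>g u\<close> from
    \<open>g v\<close>; in each half the kernel then integrates to \<open>2 * pi\<close> in the free
    variable.\<close>
  also have "\<dots> \<le> integral\<^sup>L (lborel \<Otimes>\<^sub>M lborel) (\<lambda>x. ((case x of (u, v) \<Rightarrow> (norm (g u))\<^sup>2 * K (u - v)) + (case x of (u, v) \<Rightarrow> (norm (g v))\<^sup>2 * K (u - v))) / 2)"
  proof (rule integral_mono[OF P])
    show "integrable (lborel \<Otimes>\<^sub>M lborel) (\<lambda>x. ((case x of (u, v) \<Rightarrow> (norm (g u))\<^sup>2 * K (u - v)) + (case x of (u, v) \<Rightarrow> (norm (g v))\<^sup>2 * K (u - v))) / 2)"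
      by (intro integrable_divide_zero Bochner_Integration.integrable_add P1 P2)
    fix x :: "real \<times> real"
    obtain u v where x: "x = (u, v)" by (cases x)
    have "norm (g u) * norm (g v) \<le> ((norm (g u))\<^sup>2 + (norm (g v))\<^sup>2) / 2"
      using sum_squares_bound[of "norm (g u)" "norm (g v)"] by simp
    from mult_right_mono[OF this Kpos[of "u - v"]]
    show "(case x of (u, v) \<Rightarrow> norm (g u) * (norm (g v) * K (u - v))) \<le> ((case x of (u, v) \<Rightarrow> (norm (g u))\<^sup>2 * K (u - v)) + (case x of (u, v) \<Rightarrow> (norm (g v))\<^sup>2 * K (u - v))) / 2"
      unfolding x by (simp add: algebra_simps)
  qed
  also have "\<dots> = ((LBINT u. LBINT v. (norm (g u))\<^sup>2 * K (u - v)) + (LBINT v. LBINT u. (norm (g v))\<^sup>2 * K (u - v))) / 2"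
    using P1 P2 lborel_pair.integral_fst[OF P1] lborel_pair.integral_snd[OF P2]
    by (simp add: Bochner_Integration.integral_add)
  also have "\<dots> = 2 * pi * S"
    using Kshift by (simp add: S_def)
  finally have upper: "(LBINT t. W t * (norm (G t))\<^sup>2) \<le> 2 * pi * S" .
  have cont: "continuous_on {a..b} (\<lambda>t. (norm (G t))\<^sup>2)"
    by (intro continuous_intros Gc)
  have "integral {a..b} (\<lambda>t. (norm (G t))\<^sup>2) = (LBINT t:{a..b}. (norm (G t))\<^sup>2)"
    using set_borel_integral_eq_integral(2)[OF borel_integrable_atLeastAtMost'[OF cont]] by simp
  also have "\<dots> \<le> (LBINT t. exp (9 / 2) * (W t * (norm (G t))\<^sup>2))"
    unfolding set_lebesgue_integral_def
  proof (rule integral_mono)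
    show "integrable lborel (\<lambda>t. indicator {a..b} t *\<^sub>R (norm (G t))\<^sup>2)"
      using borel_integrable_atLeastAtMost'[OF cont] unfolding set_integrable_def .
    show "integrable lborel (\<lambda>t. exp (9 / 2) * (W t * (norm (G t))\<^sup>2))"
      using WG by (rule integrable_mult_right)
    fix t
    show "indicator {a..b} t *\<^sub>R (norm (G t))\<^sup>2 \<le> exp (9 / 2) * (W t * (norm (G t))\<^sup>2)"
    proof (cases "t \<in> {a..b}")
      case True
      \<comment> \<open>On this range the weight is at least \<open>exp (- 9 / 2)\<close>, which is
        the source of the factor \<open>exp (9 / 2)\<close>.\<close>
      then have "\<bar>t / T\<bar> \<le> 3" using ab T by (auto simp: abs_le_iff field_simps)
      then have "(t / T)\<^sup>2 \<le> 3\<^sup>2" by (metis abs_le_square_iff abs_numeral)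
      then have "1 \<le> exp (9 / 2) * W t"
        unfolding W_def by (simp flip: exp_add)
      then have "1 * (norm (G t))\<^sup>2 \<le> exp (9 / 2) * W t * (norm (G t))\<^sup>2"
        by (rule mult_right_mono) auto
      then show ?thesis using True by (simp add: mult_ac)
    qed (auto simp: W_def)
  qed
  also have "\<dots> = exp (9 / 2) * (LBINT t. W t * (norm (G t))\<^sup>2)" by simp
  also have "\<dots> \<le> exp (9 / 2) * (2 * pi * S)" using upper by simp
  finally show ?thesis unfolding G_def S_def by (simp add: mult_ac)
qed

section \<open>A lower bound for the Gamma function on vertical lines\<close>

text \<open>In the Gauss product for Gamma, \<open>norm (Gamma (Complex \<sigma> t)) / Gamma \<sigma>\<close> is log-concave in \<open>\<sigma>\<close>. This
  reduces a lower bound for all \<open>\<sigma>\<close> to half-integers, where the reflection formula is explicit.\<close>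

lemma pochhammer_shift_interp:
  fixes \<sigma> w t :: real and j m :: nat
  assumes w: "0 \<le> w" "w \<le> 1" and \<sigma>: "\<sigma> = 1 / 2 + w * real m"
  shows "((1/2 + real j) / norm (Complex (1/2) t + of_nat j)) powr (1 - w) * 
         ((1/2 + real m + real j) / norm (Complex (1/2 + real m) t + of_nat j)) powr w
         \<le> (\<sigma> + real j) / norm (Complex \<sigma> t + of_nat j)"
proof -
  \<comment> \<open>\<open>exp (h x)\<close> is \<open>x / norm (Complex x t)\<close>, one factor of
    the quotient of Gauss products, so the claim is concavity of \<open>h\<close>. The sign of
    \<open>h2\<close> comes down to
    \<open>3 * (x * t)\<^sup>2 + (t\<^sup>2)\<^sup>2 \<ge> 0\<close>.\<close>
  define h where "h x = ln x - ln (x\<^sup>2 + t\<^sup>2) / 2" for x :: real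
  define h1 where "h1 x = 1 / x - x / (x\<^sup>2 + t\<^sup>2)" for x :: real
  define h2 where "h2 x = - (1 / x\<^sup>2) - (x\<^sup>2 + t\<^sup>2 - x * (2 * x)) / (x\<^sup>2 + t\<^sup>2)\<^sup>2" for x :: real
  have pos: "x\<^sup>2 + t\<^sup>2 > 0" if "x > 0" for x using that by (simp add: add_pos_nonneg)
  have d1: "(h has_real_derivative h1 x) (at x)" if "x > 0" for x
    unfolding h_def h1_def using that pos[OF that]
    by (auto intro!: derivative_eq_intros simp: divide_simps)
  have d2: "(h1 has_real_derivative h2 x) (at x)" if "x > 0" for x
  proof -
    have "((\<lambda>x. 1 / x) has_real_derivative - (1 / x\<^sup>2)) (at x)"
      using that by (auto intro!: derivative_eq_intros simp: power2_eq_square)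
    moreover have "((\<lambda>x. x / (x\<^sup>2 + t\<^sup>2)) has_real_derivative (x\<^sup>2 + t\<^sup>2 - x * (2 * x)) / (x\<^sup>2 + t\<^sup>2)\<^sup>2) (at x)"
      using that pos[OF that] by (auto intro!: derivative_eq_intros simp: power2_eq_square)
    ultimately show ?thesis unfolding h1_def h2_def by (rule DERIV_diff)
  qed
  have "h2 x \<le> 0" if "x > 0" for x
  proof -
    have "(x\<^sup>2 + t\<^sup>2)\<^sup>2 - (x\<^sup>2 - t\<^sup>2) * x\<^sup>2 = 3 * (x * t)\<^sup>2 + (t\<^sup>2)\<^sup>2"
      by (simp add: power2_eq_square algebra_simps)
    then have "(x\<^sup>2 - t\<^sup>2) * x\<^sup>2 \<le> (x\<^sup>2 + t\<^sup>2)\<^sup>2"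
      using zero_le_power2[of "x * t"] zero_le_power2[of "t\<^sup>2"] by linarith
    then have "(x\<^sup>2 - t\<^sup>2) / (x\<^sup>2 + t\<^sup>2)\<^sup>2 \<le> 1 / x\<^sup>2"
      using that pos[OF that] by (simp add: divide_simps)
    moreover have "x\<^sup>2 + t\<^sup>2 - x * (2 * x) = - (x\<^sup>2 - t\<^sup>2)"
      by (simp add: power2_eq_square)
    ultimately show ?thesis unfolding h2_def by (simp only: divide_minus_left)
  qed
  then have conc: "concave_on {0<..} h"
    by (intro f''_le0_imp_concave[where f' = h1 and f'' = h2] d1 d2) (auto simp: concave_on_def)
  have val: "exp (h x) = x / norm (Complex x t)" if "x > 0" for x
  proof -
    have "exp (h x) = x / exp (ln (sqrt (x\<^sup>2 + t\<^sup>2)))"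
      using that pos[OF that] by (simp add: h_def exp_diff ln_sqrt)
    then show ?thesis using pos[OF that] by (simp add: complex_norm)
  qed
  have *: "Complex x t + of_nat j = Complex (x + real j) t" for x by (simp add: complex_eq_iff)
  define x0 where "x0 = 1 / 2 + real j"
  define x1 where "x1 = 1 / 2 + real m + real j"
  have x01: "x0 > 0" "x1 > 0" unfolding x0_def x1_def by auto
  have eq: "(1 - w) * x0 + w * x1 = \<sigma> + real j" unfolding \<sigma> x0_def x1_def by (simp add: field_simps)
  have spos: "\<sigma> + real j > 0" unfolding \<sigma> using w by (simp add: add_pos_nonneg)
  have "(1 - w) * h x0 + w * h x1 \<le> h (\<sigma> + real j)"
    using concave_onD[OF conc, of w x0 x1] w x01 eq by simp
  then have "exp ((1 - w) * h x0 + w * h x1) \<le> exp (h (\<sigma> + real j))" by simp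
  moreover have "exp ((1 - w) * h x0 + w * h x1) = exp (h x0) powr (1 - w) * exp (h x1) powr w"
    by (simp add: powr_def exp_add)
  ultimately show ?thesis
    unfolding * val[OF spos] val[OF x01(1)] val[OF x01(2)] by (simp add: x0_def x1_def)
qed

text \<open>The factorial and the power of \<open>n\<close> have the same modulus at
  \<open>Complex \<sigma> t\<close> and at \<open>\<sigma>\<close>, so they cancel and only the
  linear factors remain, which can be interpolated one by one.\<close>

lemma norm_Gamma_series_quotient:
  fixes \<sigma> t :: real
  assumes "\<sigma> > 0" "n > 0"
  shows "norm (Gamma_series (Complex \<sigma> t) n) / Gamma_series \<sigma> n =
           (\<Prod>j\<le>n. (\<sigma> + real j) / norm (Complex \<sigma> t + of_nat j))"
proof -
  have "Re (Complex \<sigma> t * of_real (ln (real n))) = \<sigma> * ln (real n)" by simp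
  then have "norm (exp (Complex \<sigma> t * of_real (ln (real n)))) = exp (\<sigma> * ln (real n))"
    by (simp only: norm_exp_eq_Re)
  moreover have "pochhammer \<sigma> (n + 1) > 0" using assms by (intro pochhammer_pos)
  ultimately show ?thesis
    unfolding Gamma_series_def prod_dividef
    by (simp add: norm_divide norm_mult norm_power field_simps pochhammer_prod atLeast0AtMost
        atLeast0LessThan lessThan_Suc_atMost del: pochhammer_Suc prod.lessThan_Suc prod.atMost_Suc flip: prod_norm)
qed

text \<open>The inequality holds factor by factor, hence for the finite products, and passes to the
  limit; \<open>powr\<close> is continuous at the limits because neither quotient vanishes.\<close>

lemma norm_Gamma_interp:
  fixes \<sigma> w t :: real and m :: nat
  assumes w: "0 \<le> w" "w \<le> 1" and \<sigma>: "\<sigma> = 1 / 2 + w * real m"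
  shows "(norm (Gamma (Complex (1/2) t)) / Gamma (1/2)) powr (1 - w) * 
         (norm (Gamma (Complex (1/2 + real m) t)) / Gamma (1/2 + real m)) powr w
         \<le> norm (Gamma (Complex \<sigma> t)) / Gamma \<sigma>"
proof -
  have spos: "\<sigma> > 0" unfolding \<sigma> using w by (simp add: add_pos_nonneg)
  have nz: "Complex x t \<notin> \<int>\<^sub>\<le>\<^sub>0" if "x > 0" for x
    using that by (auto elim!: nonpos_Ints_cases simp: complex_eq_iff)
  have lim: "(\<lambda>n. norm (Gamma_series (Complex x t) n) / Gamma_series x n) \<longlonglongrightarrow> norm (Gamma (Complex x t)) / Gamma x"
    if "x > 0" for x
    using that by (intro tendsto_intros Gamma_series_LIMSEQ) (auto simp: Gamma_eq_zero_iff dest: nonpos_Ints_nonpos)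
  have gpos: "Gamma x > 0" "norm (Gamma (Complex x t)) > 0" if "x > 0" for x
    using that nz[OF that] by (auto simp: Gamma_eq_zero_iff)
  then have ne: "norm (Gamma (Complex x t)) / Gamma x \<noteq> 0" if "x > 0" for x using gpos[OF that] by simp
  show ?thesis
  proof (rule tendsto_le[OF sequentially_bot lim[OF spos]])
    show "(\<lambda>n. (norm (Gamma_series (Complex (1/2) t) n) / Gamma_series (1/2) n) powr (1 - w) *
               (norm (Gamma_series (Complex (1/2 + real m) t) n) / Gamma_series (1/2 + real m) n) powr w)
          \<longlonglongrightarrow> (norm (Gamma (Complex (1/2) t)) / Gamma (1/2)) powr (1 - w) * 
         (norm (Gamma (Complex (1/2 + real m) t)) / Gamma (1/2 + real m)) powr w"
      by (intro tendsto_mult tendsto_powr tendsto_const lim ne) auto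
    show "\<forall>\<^sub>F n in sequentially. (norm (Gamma_series (Complex (1/2) t) n) / Gamma_series (1/2) n) powr (1 - w) *
               (norm (Gamma_series (Complex (1/2 + real m) t) n) / Gamma_series (1/2 + real m) n) powr w
          \<le> norm (Gamma_series (Complex \<sigma> t) n) / Gamma_series \<sigma> n"
      using eventually_gt_at_top[of 0]
    proof eventually_elim
      case (elim n)
      have "(\<Prod>j\<le>n. (1/2 + real j) / norm (Complex (1/2) t + of_nat j)) powr (1 - w) *
            (\<Prod>j\<le>n. (1/2 + real m + real j) / norm (Complex (1/2 + real m) t + of_nat j)) powr w
          = (\<Prod>j\<le>n. ((1/2 + real j) / norm (Complex (1/2) t + of_nat j)) powr (1 - w) *
            ((1/2 + real m + real j) / norm (Complex (1/2 + real m) t + of_nat j)) powr w)"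
        by (simp add: prod_powr_distrib prod.distrib)
      also have "\<dots> \<le> (\<Prod>j\<le>n. (\<sigma> + real j) / norm (Complex \<sigma> t + of_nat j))"
        by (intro prod_mono conjI pochhammer_shift_interp w \<sigma>) simp
      finally show ?case
        using elim spos by (subst (1 2 3) norm_Gamma_series_quotient) auto
    qed
  qed
qed

text \<open>On the line \<open>Re s = 1 / 2\<close> one has \<open>1 - s = cnj s\<close>, so the
  reflection formula evaluates the squared modulus as
  \<open>pi / norm (sin (pi * s))\<close>.\<close>

lemma norm_Gamma_half_ge:
  fixes t :: real
  assumes "t \<ge> 0"
  shows "norm (Gamma (Complex (1/2) t)) \<ge> exp (- pi * t / 2)"
proof -
  define s where "s = Complex (1/2) t"
  have "1 - s = cnj s" by (simp add: s_def complex_eq_iff)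
  then have "Gamma s * cnj (Gamma s) = of_real pi / sin (of_real pi * s)"
    using Gamma_reflection_complex[of s] by (simp add: cnj_Gamma)
  then have "complex_of_real ((norm (Gamma s))\<^sup>2) = of_real pi / sin (of_real pi * s)"
    by (simp flip: complex_norm_square)
  then have eq: "(norm (Gamma s))\<^sup>2 = pi / norm (sin (of_real pi * s))"
    by (metis abs_of_nonneg norm_divide norm_of_real pi_ge_zero zero_le_power2)
  have "norm (sin (of_real pi * s)) \<le> exp (pi * t)"
  proof -
    have "norm (sin (of_real pi * s)) = norm (exp (\<i> * (of_real pi * s)) - exp (- \<i> * (of_real pi * s))) / 2"
      by (simp add: sin_exp_eq norm_divide norm_mult)
    also have "\<dots> \<le> (norm (exp (\<i> * (of_real pi * s))) + norm (exp (- \<i> * (of_real pi * s)))) / 2"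
      by (intro divide_right_mono norm_triangle_ineq4) auto
    also have "\<dots> = (exp (- pi * t) + exp (pi * t)) / 2"
      by (simp add: norm_exp_eq_Re s_def)
    also have "\<dots> \<le> exp (pi * t)" using assms by (simp add: mult_nonneg_nonneg)
    finally show ?thesis .
  qed
  moreover have "norm (sin (of_real pi * s)) > 0"
  proof -
    have "s \<notin> \<int>\<^sub>\<le>\<^sub>0" by (auto simp: s_def complex_eq_iff elim!: nonpos_Ints_cases)
    then have "(norm (Gamma s))\<^sup>2 \<noteq> 0" by (simp add: Gamma_eq_zero_iff)
    then show ?thesis unfolding eq by auto
  qed
  ultimately have "pi / exp (pi * t) \<le> (norm (Gamma s))\<^sup>2"
    unfolding eq by (intro divide_left_mono) auto
  moreover have "(exp (- pi * t / 2))\<^sup>2 = 1 / exp (pi * t)"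
    by (simp add: exp_minus field_simps flip: exp_double)
  moreover have "1 / exp (pi * t) \<le> pi / exp (pi * t)"
    using pi_gt3 by (intro divide_right_mono) auto
  ultimately have "(exp (- pi * t / 2))\<^sup>2 \<le> (norm (Gamma s))\<^sup>2" by linarith
  then show ?thesis unfolding s_def by (rule power2_le_imp_le) simp
qed

text \<open>Each step of the recursion \<open>Gamma (s + 1) = s * Gamma s\<close> gains a factor
  \<open>norm s \<ge> t\<close>.\<close>

lemma norm_Gamma_half_shift_ge:
  fixes t :: real
  assumes "t \<ge> 0"
  shows "norm (Gamma (Complex (1/2 + real m) t)) \<ge> t ^ m * exp (- pi * t / 2)"
proof (induction m)
  case 0
  show ?case using norm_Gamma_half_ge[OF assms] by simp
next
  case (Suc m)
  have "Complex (1/2 + real (Suc m)) t = Complex (1/2 + real m) t + 1"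
    by (simp add: complex_eq_iff)
  moreover have "Complex (1/2 + real m) t \<notin> \<int>\<^sub>\<le>\<^sub>0"
    by (auto elim!: nonpos_Ints_cases simp: complex_eq_iff)
  ultimately have "Gamma (Complex (1/2 + real (Suc m)) t) = Complex (1/2 + real m) t * Gamma (Complex (1/2 + real m) t)"
    by (simp add: Gamma_plus1)
  then have "norm (Gamma (Complex (1/2 + real (Suc m)) t)) = norm (Complex (1/2 + real m) t) * norm (Gamma (Complex (1/2 + real m) t))"
    by (simp add: norm_mult)
  also have "\<dots> \<ge> t * (t ^ m * exp (- pi * t / 2))"
    using assms Suc abs_Im_le_cmod[of "Complex (1/2 + real m) t"] by (intro mult_mono) auto
  finally show ?case by simp
qed

text \<open>Interpolating the bounds at the two half-integers with weight \<open>w\<close> turns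
  \<open>t ^ m\<close> into \<open>t powr (\<sigma> - 1/2)\<close>, the growth known from Stirling's
  formula. The interpolated quotients are normalised by real Gamma values, which are bounded below
  on the compact interval; hence \<open>c\<close> is uniform in \<open>\<sigma>\<close>, as the
  later integration over \<open>\<sigma>\<close> requires.\<close>

lemma Gamma_lower_bound:
  fixes m :: nat
  shows "\<exists>c>0. \<forall>\<sigma> t. 1/2 \<le> \<sigma> \<longrightarrow> \<sigma> \<le> 1/2 + real m \<longrightarrow> 1 \<le> t \<longrightarrow>
           c * t powr (\<sigma> - 1/2) * exp (- pi * t / 2) \<le> norm (Gamma (Complex \<sigma> t))"
proof -
  have "continuous_on {1/2..1/2 + real m} (\<lambda>x::real. Gamma x)"
    by (intro continuous_intros) (auto dest: nonpos_Ints_nonpos)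
  then obtain x0 where x0: "x0 \<in> {1/2..1/2 + real m}" "\<And>x. x \<in> {1/2..1/2 + real m} \<Longrightarrow> Gamma x0 \<le> Gamma x"
    using continuous_attains_inf[of "{1/2..1/2 + real m}" "\<lambda>x::real. Gamma x"] by force
  define g0 where "g0 = Gamma x0"
  have g0: "g0 > 0" unfolding g0_def using x0 by (intro Gamma_real_pos) auto
  define g1 where "g1 = max 1 (max (Gamma (1/2::real)) (Gamma (1/2 + real m)))"
  have g1: "g1 \<ge> 1" "Gamma (1/2::real) \<le> g1" "Gamma (1/2 + real m) \<le> g1" unfolding g1_def by auto
  show ?thesis
  proof (intro exI[of _ "g0 / g1"] conjI allI impI)
    show "g0 / g1 > 0" using g0 g1 by simp
    fix \<sigma> t :: real assume s: "1/2 \<le> \<sigma>" "\<sigma> \<le> 1/2 + real m" and t: "1 \<le> t"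
    \<comment> \<open>For \<open>m = 0\<close> the range forces \<open>\<sigma> = 1/2\<close>, and
      division by zero yields \<open>w = 0\<close>, so this case needs no separate
      treatment.\<close>
    define w where "w = (\<sigma> - 1/2) / real m"
    have w: "0 \<le> w" "w \<le> 1" "\<sigma> = 1/2 + w * real m"
      using s by (auto simp: w_def divide_simps)
    have eq: "(exp (- pi * t / 2) / g1) powr (1 - w) * (t ^ m * exp (- pi * t / 2) / g1) powr w = t powr (\<sigma> - 1/2) * exp (- pi * t / 2) / g1"
    proof -
      have "(t ^ m * exp (- pi * t / 2) / g1) powr w = (t ^ m) powr w * (exp (- pi * t / 2) / g1) powr w"
        using t g1 by (subst powr_mult[symmetric]) auto
      moreover have "(t ^ m) powr w = t powr (\<sigma> - 1/2)"
        using t w(3) by (simp add: powr_powr mult.commute flip: powr_realpow)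
      moreover have "(exp (- pi * t / 2) / g1) powr (1 - w) * (exp (- pi * t / 2) / g1) powr w = exp (- pi * t / 2) / g1"
        using g1 by (simp flip: powr_add)
      ultimately show ?thesis by (simp add: mult_ac)
    qed
    have "t powr (\<sigma> - 1/2) * exp (- pi * t / 2) / g1 \<le> (norm (Gamma (Complex (1/2) t)) / Gamma (1/2)) powr (1 - w) * 
         (norm (Gamma (Complex (1/2 + real m) t)) / Gamma (1/2 + real m)) powr w"
      unfolding eq[symmetric]
      using w t g1 norm_Gamma_half_ge[of t] norm_Gamma_half_shift_ge[of t m]
      by (intro mult_mono powr_mono2 frac_le) (auto intro!: Gamma_real_pos)
    also have "\<dots> \<le> norm (Gamma (Complex \<sigma> t)) / Gamma \<sigma>"
      by (rule norm_Gamma_interp[OF w])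
    also have "\<dots> \<le> norm (Gamma (Complex \<sigma> t)) / g0"
      using x0(2)[of \<sigma>] s g0 unfolding g0_def by (intro divide_left_mono mult_pos_pos) auto
    finally show "g0 / g1 * t powr (\<sigma> - 1/2) * exp (- pi * t / 2) \<le> norm (Gamma (Complex \<sigma> t))"
      using g0 g1 by (simp add: field_simps)
  qed
qed

section \<open>Mellin transforms of exponentials\<close>

text \<open>The integrals over \<open>{- n..n}\<close> are holomorphic by differentiation under the
  integral sign. They converge uniformly on the disc, because the error is at most the tail of the
  integrable majorant.\<close>

lemma holomorphic_on_lborel_integral_exp:
  fixes h g :: "real \<Rightarrow> complex"
  assumes S: "open S" and h: "continuous_on UNIV h" and g: "continuous_on UNIV g"
    and dom: "\<And>z. z \<in> S \<Longrightarrow> \<exists>d>0. \<exists>B. cball z d \<subseteq> S \<and> integrable lborel B \<and>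
                (\<forall>w\<in>cball z d. \<forall>v. norm (h v * exp (w * g v)) \<le> B v)"
  shows "(\<lambda>z. LBINT v. h v * exp (z * g v)) holomorphic_on S"
proof (rule holomorphic_uniform_sequence[OF S])
  define f where "f n z = integral (cbox (- real n) (real n)) (\<lambda>v. h v * exp (z * g v))" for n z
  have [continuous_intros]: "continuous_on A (\<lambda>x. h (p x))" "continuous_on A (\<lambda>x. g (p x))"
    if "continuous_on A p" for A :: "'b :: topological_space set" and p
    using continuous_on_compose2[OF h that] continuous_on_compose2[OF g that] by auto
  have cont: "continuous_on A (\<lambda>v. h v * exp (w * g v))" for w A
    by (intro continuous_intros)
  show "f n holomorphic_on S" for n
  proof (rule holomorphic_on_subset)
    show "f n holomorphic_on UNIV" unfolding f_def
    proof (rule leibniz_rule_holomorphic[where fx = "\<lambda>z v. h v * (g v * exp (z * g v))"])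
      show "continuous_on (UNIV \<times> cbox (- real n) (real n)) (\<lambda>(x, t). h t * (g t * exp (x * g t)))"
        unfolding case_prod_unfold by (intro continuous_intros)
      show "(\<lambda>v. h v * exp (x * g v)) integrable_on cbox (- real n) (real n)" for x
        by (intro integrable_continuous cont)
    qed (auto intro!: derivative_eq_intros)
  qed auto
  fix z assume z: "z \<in> S"
  obtain d B where d: "d > 0" "cball z d \<subseteq> S" and B: "integrable lborel B"
    and le: "\<And>w v. w \<in> cball z d \<Longrightarrow> norm (h v * exp (w * g v)) \<le> B v"
    using dom[OF z] by blast
  have Bpos: "B v \<ge> 0" for v using le[of z v] d by (smt (verit) centre_in_cball norm_ge_zero)
  have [measurable]: "B \<in> borel_measurable borel" using B by auto
  define r where "r n = (LBINT v. indicator (- {- real n..real n}) v * B v)" for n :: nat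
  have r_int: "integrable lborel (\<lambda>v. indicator (- {- real n..real n}) v * B v)" for n
    by (rule Bochner_Integration.integrable_bound[OF B]) (auto simp: indicator_def)
  have r0: "r \<longlonglongrightarrow> 0"
  proof -
    have "(\<lambda>n. LBINT v. indicator (- {- real n..real n}) v * B v) \<longlonglongrightarrow> (LBINT v::real. (0::real))"
    proof (rule integral_dominated_convergence[where w = B])
      show "AE v in lborel. (\<lambda>n. indicator (- {- real n..real n}) v * B v) \<longlonglongrightarrow> 0"
      proof (intro AE_I2)
        fix v :: real
        have "\<forall>\<^sub>F n in sequentially. indicator (- {- real n..real n}) v * B v = 0"
          using eventually_ge_at_top[of "nat \<lceil>\<bar>v\<bar>\<rceil>"]
          by eventually_elim (auto simp: indicator_def nat_le_iff ceiling_le_iff abs_le_iff)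
        then show "(\<lambda>n. indicator (- {- real n..real n}) v * B v) \<longlonglongrightarrow> 0"
          by (rule tendsto_eventually)
      qed
    qed (use B Bpos in \<open>auto simp: indicator_def\<close>)
    then show ?thesis by (simp add: r_def[abs_def])
  qed
  have bound: "norm (f n w - (LBINT v. h v * exp (w * g v))) \<le> r n" if w: "w \<in> cball z d" for n w
  proof -
    have [measurable]: "(\<lambda>v. h v * exp (w * g v)) \<in> borel_measurable borel"
      by (rule borel_measurable_continuous_onI[OF cont])
    have int: "integrable lborel (\<lambda>v. h v * exp (w * g v))"
      by (rule Bochner_Integration.integrable_bound[OF B])
         (use le[OF w] in \<open>auto intro!: AE_I2 order.trans[OF _ abs_ge_self]\<close>)
    have "f n w = (LBINT v:{- real n..real n}. h v * exp (w * g v))"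
      unfolding f_def using set_borel_integral_eq_integral(2)[OF borel_integrable_atLeastAtMost'[OF cont]]
      by simp
    then have "f n w - (LBINT v. h v * exp (w * g v)) =
       (LBINT v. indicator {- real n..real n} v *\<^sub>R (h v * exp (w * g v)) - h v * exp (w * g v))"
      unfolding set_lebesgue_integral_def
      by (simp add: Bochner_Integration.integral_diff int integrable_mult_indicator)
    also have "norm \<dots> \<le> r n"
      unfolding r_def
    proof (rule Bochner_Integration.integral_norm_bound_integral[OF _ r_int])
      show "integrable lborel (\<lambda>v. indicator {- real n..real n} v *\<^sub>R (h v * exp (w * g v)) - h v * exp (w * g v))"
        by (intro Bochner_Integration.integrable_diff int integrable_mult_indicator) auto
      show "norm (indicator {- real n..real n} v *\<^sub>R (h v * exp (w * g v)) - h v * exp (w * g v))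
              \<le> indicator (- {- real n..real n}) v * B v" for v
        using le[OF w, of v] by (auto simp: indicator_def)
    qed
    finally show ?thesis .
  qed
  show "\<exists>d>0. cball z d \<subseteq> S \<and> uniform_limit (cball z d) f (\<lambda>z. LBINT v. h v * exp (z * g v)) sequentially"
  proof (intro exI[of _ d] conjI d uniform_limitI)
    fix e :: real assume "e > 0"
    with r0 have "\<forall>\<^sub>F n in sequentially. r n < e"
      by (rule order_tendstoD)
    then show "\<forall>\<^sub>F n in sequentially. \<forall>x\<in>cball z d. dist (f n x) (LBINT v. h v * exp (x * g v)) < e"
      by eventually_elim (auto simp: dist_norm intro: order.strict_trans1[OF bound])
  qed
qed

text \<open>Euler's integral under the substitution \<open>t = exp v\<close>; the parameter
  \<open>c\<close> enters by translating \<open>v\<close> by \<open>ln c\<close>.\<close>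

lemma mellin_exp_real:
  fixes s :: complex and c :: real
  assumes s: "Re s > 0" and c: "c > 0"
  shows "integrable lborel (\<lambda>v. exp (s * of_real v - of_real (c * exp v)))"
    and "(LBINT v. exp (s * of_real v - of_real (c * exp v))) = Gamma s * of_real c powr (- s)"
proof -
  define \<phi> where "\<phi> v = exp (s * of_real v - of_real (exp v))" for v :: real
  let ?f = "\<lambda>t. complex_of_real t powr (s - 1) / of_real (exp t)"
  have "?f absolutely_integrable_on {0<..}"
    using absolutely_integrable_Gamma_integral[OF s, of 1] by simp
  moreover have "integral {0<..} ?f = Gamma s"
    using Gamma_integral_complex'[OF s] by (rule integral_unique)
  moreover have "range (exp :: real \<Rightarrow> real) = {0<..}"
    by (auto simp: image_iff) (metis exp_ln)
  ultimately have *: "?f absolutely_integrable_on range (exp :: real \<Rightarrow> real) \<and> integral (range (exp :: real \<Rightarrow> real)) ?f = Gamma s"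
    by simp
  have "(\<lambda>v. \<bar>exp v\<bar> *\<^sub>R ?f (exp v)) absolutely_integrable_on UNIV \<and> integral UNIV (\<lambda>v. \<bar>exp v\<bar> *\<^sub>R ?f (exp v)) = Gamma s"
    using * by (subst has_absolute_integral_change_of_variables_real) (auto intro!: derivative_eq_intros injI)
  moreover have "\<bar>exp v\<bar> *\<^sub>R ?f (exp v) = \<phi> v" for v :: real
  proof -
    have "Ln (complex_of_real (exp v)) = of_real v" by (simp add: Ln_of_real)
    then have "complex_of_real (exp v) powr (s - 1) = exp ((s - 1) * of_real v)"
      by (simp add: powr_def)
    then show ?thesis
      unfolding \<phi>_def by (simp add: scaleR_conv_of_real exp_of_real exp_diff algebra_simps)
  qed
  ultimately have abs: "\<phi> absolutely_integrable_on UNIV" "integral UNIV \<phi> = Gamma s" by auto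
  have "\<phi> \<in> borel_measurable borel"
    unfolding \<phi>_def by (rule borel_measurable_continuous_onI) (intro continuous_intros)
  then have \<phi>m: "\<phi> \<in> borel_measurable lborel" by simp
  have i1: "integrable lborel \<phi>"
    using abs(1) \<phi>m by (simp add: set_integrable_def integrable_completion)
  have i2: "integral\<^sup>L lborel \<phi> = Gamma s"
    using abs(2) integral_lborel[OF i1] by simp
  have sh: "\<phi> (ln c + 1 * v) = of_real c powr s * exp (s * of_real v - of_real (c * exp v))" for v
    using c by (simp add: \<phi>_def exp_add powr_def Ln_of_real exp_diff ring_distribs)
  have cne: "of_real c powr s \<noteq> (0 :: complex)" using c by simp
  have "integrable lborel (\<lambda>v. \<phi> (ln c + 1 * v))"
    by (rule lborel_integrable_real_affine[OF i1]) simp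
  then have "integrable lborel (\<lambda>v. of_real c powr s * exp (s * of_real v - of_real (c * exp v)))"
    unfolding sh .
  then have "integrable lborel (\<lambda>v. inverse (of_real c powr s) * (of_real c powr s * exp (s * of_real v - of_real (c * exp v))))"
    by (rule integrable_mult_right)
  then show "integrable lborel (\<lambda>v. exp (s * of_real v - of_real (c * exp v)))"
    using cne by (simp only: mult.assoc[symmetric] left_inverse mult_1_left not_False_eq_True)
  have "integral\<^sup>L lborel \<phi> = \<bar>1\<bar> *\<^sub>R (LBINT v. \<phi> (ln c + 1 * v))"
    by (rule lborel_integral_real_affine) simp
  also have "\<dots> = of_real c powr s * (LBINT v. exp (s * of_real v - of_real (c * exp v)))"
    unfolding sh by simp
  finally show "(LBINT v. exp (s * of_real v - of_real (c * exp v))) = Gamma s * of_real c powr (- s)"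
    using i2 cne by (simp add: powr_minus field_simps)
qed

text \<open>The last identity extends from positive real \<open>c\<close> to the right half plane by
  the identity theorem, both sides being holomorphic in \<open>c\<close>. The absolute moment only
  involves \<open>Re s\<close> and \<open>Re c\<close>, hence reduces to the real case.\<close>

lemma mellin_exp:
  fixes s c :: complex
  assumes s: "Re s > 0" and c: "Re c > 0"
  shows "integrable lborel (\<lambda>v. exp (s * of_real v - c * of_real (exp v)))"
    and "(LBINT v. norm (exp (s * of_real v - c * of_real (exp v)))) = Gamma (Re s) * Re c powr (- Re s)"
    and "(LBINT v. exp (s * of_real v - c * of_real (exp v))) = Gamma s * c powr (- s)"
proof -
  have nrm: "norm (exp (s * of_real v - c * of_real (exp v))) = exp (Re s * v - Re c * exp v)" for v s c
    by simp
  have real_int: "integrable lborel (\<lambda>v. exp (x * v - y * exp v))"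
    and real_val: "(LBINT v. exp (x * v - y * exp v)) = Gamma x * y powr (- x)" if "x > 0" "y > 0" for x y :: real
  proof -
    have eq: "exp (of_real x * of_real v - of_real (y * exp v)) = complex_of_real (exp (x * v - y * exp v))" for v
      by (simp add: exp_of_real[symmetric])
    have "integrable lborel (\<lambda>v. complex_of_real (exp (x * v - y * exp v)))"
      using mellin_exp_real(1)[of "of_real x" y] that unfolding eq by simp
    then show "integrable lborel (\<lambda>v. exp (x * v - y * exp v))"
      by (simp only: complex_of_real_integrable_eq)
    have "complex_of_real (LBINT v. exp (x * v - y * exp v)) = of_real (Gamma x) * of_real y powr (- of_real x)"
      using mellin_exp_real(2)[of "of_real x" y] that unfolding eq
      by (simp only: integral_complex_of_real Gamma_complex_of_real Re_complex_of_real)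
    also have "\<dots> = of_real (Gamma x * y powr (- x))"
      using that powr_of_real[of y "-x"] by simp
    finally show "(LBINT v. exp (x * v - y * exp v)) = Gamma x * y powr (- x)"
      by (simp only: of_real_eq_iff)
  qed
  show "integrable lborel (\<lambda>v. exp (s * of_real v - c * of_real (exp v)))"
  proof (rule Bochner_Integration.integrable_bound[OF real_int[OF s c]])
    have "(\<lambda>v. exp (s * of_real v - c * of_real (exp v))) \<in> borel_measurable borel"
      by (rule borel_measurable_continuous_onI) (intro continuous_intros)
    then show "(\<lambda>v. exp (s * of_real v - c * of_real (exp v))) \<in> borel_measurable lborel"
      by simp
  qed auto
  show "(LBINT v. norm (exp (s * of_real v - c * of_real (exp v)))) = Gamma (Re s) * Re c powr (- Re s)"
    unfolding nrm by (rule real_val[OF s c])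
  define J where "J c = (LBINT v. exp (s * of_real v) * exp (c * (- of_real (exp v))))" for c
  have J: "J c = (LBINT v. exp (s * of_real v - c * of_real (exp v)))" for c
    unfolding J_def by (simp add: exp_add[symmetric])
  have J_hol: "J holomorphic_on {z. Re z > 0}"
    unfolding J_def
  proof (rule holomorphic_on_lborel_integral_exp)
    fix z assume "z \<in> {z. Re z > 0}"
    then have z: "Re z > 0" by simp
    have ge: "Re w \<ge> Re z / 2" if "w \<in> cball z (Re z / 2)" for w
      using that complex_Re_le_cmod[of "z - w"] by (simp add: dist_norm)
    show "\<exists>d>0. \<exists>B. cball z d \<subseteq> {z. Re z > 0} \<and> integrable lborel B \<and>
        (\<forall>w\<in>cball z d. \<forall>v. norm (exp (s * of_real v) * exp (w * (- of_real (exp v)))) \<le> B v)"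
    proof (intro exI[of _ "Re z / 2"] exI[of _ "\<lambda>v. exp (Re s * v - Re z / 2 * exp v)"] conjI ballI allI)
      show "cball z (Re z / 2) \<subseteq> {z. Re z > 0}" using ge z by force
      show "integrable lborel (\<lambda>v. exp (Re s * v - Re z / 2 * exp v))"
        using z s by (intro real_int) auto
      fix w v assume "w \<in> cball z (Re z / 2)"
      from ge[OF this] have "Re z / 2 * exp v \<le> Re w * exp v" for v by (rule mult_right_mono) auto
      then show "norm (exp (s * of_real v) * exp (w * (- of_real (exp v)))) \<le> exp (Re s * v - Re z / 2 * exp v)"
        by (simp add: norm_mult flip: exp_add)
    qed (use z in auto)
  qed (auto intro!: continuous_intros open_halfspace_Re_gt)
  have "J c - Gamma s * c powr (- s) = 0"
  proof (rule analytic_continuation[where f = "\<lambda>z. J z - Gamma s * z powr (- s)" and S = "{z. Re z > 0}" and U = "complex_of_real ` {0<..}" and \<xi> = 1])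
    show "(\<lambda>z. J z - Gamma s * z powr (- s)) holomorphic_on {z. Re z > 0}"
      by (intro holomorphic_intros J_hol) (auto simp: complex_nonpos_Reals_iff)
    show "connected {z. Re z > 0}" by (intro convex_connected convex_halfspace_Re_gt)
    have "(1::real) islimpt {0<..}"
      by (rule open_imp_islimpt) auto
    then have "complex_of_real 1 islimpt (complex_of_real ` {0<..})"
      by (rule islimpt_isCont_image) (auto simp: eventually_at intro!: exI[of _ 1])
    then show "1 islimpt (complex_of_real ` {0<..})" by simp
    fix z assume "z \<in> complex_of_real ` {0<..}"
    then obtain y where y: "z = of_real y" "y > 0" by auto
    show "J z - Gamma s * z powr (- s) = 0"
      unfolding J y(1) using mellin_exp_real(2)[OF s y(2)] by simp
  qed (use c in \<open>auto simp: open_halfspace_Re_gt\<close>)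
  then show "(LBINT v. exp (s * of_real v - c * of_real (exp v))) = Gamma s * c powr (- s)"
    by (simp add: J)
qed

section \<open>Analytic data of an additively twisted form\<close>

text \<open>This function is the standard majorant below, because \<open>F\<close> decays at both
  ends of every ray once the power weight is included.\<close>

lemma integral_two_sided_exp:
  fixes a b :: real
  assumes a: "a > 0" and b: "b > 0"
  shows "integrable lborel (\<lambda>v. if v \<le> 0 then exp (a * v) else exp (- b * v))" (is "integrable _ ?f")
    and "(LBINT v. if v \<le> 0 then exp (a * v) else exp (- b * v)) = 1 / a + 1 / b"
proof -
  have half: "integrable lborel (\<lambda>v. indicator {0..} v * exp (- c * v)) \<and>
     (LBINT v. indicator {0..} v * exp (- c * v)) = 1 / c" if c: "c > 0" for c :: real
  proof -
    have hi: "((\<lambda>x. exp (- c * x)) has_integral 1 / c) {0..}"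
      using has_integral_exp_minus_to_infinity[OF c, of 0] by simp
    have ai: "(\<lambda>x. exp (- c * x)) absolutely_integrable_on {0..}"
      using hi by (intro nonnegative_absolutely_integrable_1) (auto simp: has_integral_integrable)
    have m: "(\<lambda>x. indicator {0..} x *\<^sub>R exp (- c * x)) \<in> borel_measurable lborel"
      by simp
    have 1: "integrable lborel (\<lambda>x. indicator {0..} x *\<^sub>R exp (- c * x))"
      using ai m unfolding set_integrable_def by (simp only: integrable_completion)
    have "(LBINT x. indicator {0..} x *\<^sub>R exp (- c * x)) = integral\<^sup>L lebesgue (\<lambda>x. indicator {0..} x *\<^sub>R exp (- c * x))"
      using m by (rule integral_completion[symmetric])
    also have "\<dots> = integral {0..} (\<lambda>x. exp (- c * x))"
      using set_lebesgue_integral_eq_integral(2)[OF ai] by (simp add: set_lebesgue_integral_def)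
    finally show ?thesis using 1 integral_unique[OF hi] by simp
  qed
  define g where "g c v = indicator {0..} v * exp (- c * v)" for c v :: real
  have ga: "integrable lborel (\<lambda>v. g a (0 + - 1 * v))" "(LBINT v. g a (0 + - 1 * v)) = 1 / a"
    using half[OF a] lborel_integrable_real_affine[of "g a" "- 1" 0] lborel_integral_real_affine[of "- 1" "g a" 0]
    unfolding g_def by auto
  have gb: "integrable lborel (g b)" "(LBINT v. g b v) = 1 / b"
    using half[OF b] unfolding g_def by auto
  \<comment> \<open>At \<open>v = 0\<close> both half-line indicators contribute, so the
    decomposition into two halves holds only almost everywhere.\<close>
  have "AE v in lborel. v \<noteq> (0::real)"
    by (rule AE_lborel_singleton)
  then have ae: "AE v in lborel. ?f v = g a (0 + - 1 * v) + g b v"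
    by eventually_elim (auto simp: g_def indicator_def)
  have m: "?f \<in> borel_measurable lborel" by simp
  have i: "integrable lborel (\<lambda>v. g a (0 + - 1 * v) + g b v)"
    by (intro Bochner_Integration.integrable_add ga gb)
  show "integrable lborel ?f"
    by (rule integrable_cong_AE_imp[OF i m]) (use ae in auto)
  have "integral\<^sup>L lborel ?f = (LBINT v. g a (0 + - 1 * v) + g b v)"
    by (rule integral_cong_AE[OF m _ ae]) (use i in auto)
  also have "\<dots> = 1 / a + 1 / b"
    using ga gb by (simp add: Bochner_Integration.integral_add)
  finally show "(LBINT v. ?f v) = 1 / a + 1 / b" .
qed

lemma half_le_sin:
  fixes x :: real
  assumes "0 \<le> x" "x \<le> 1"
  shows "x / 2 \<le> sin x"
proof -
  have "sin 0 - 0 / 2 \<le> sin x - x / 2"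
  proof (rule DERIV_nonneg_imp_nondecreasing[OF assms(1)])
    fix y assume y: "0 \<le> y" "y \<le> x"
    have "\<bar>sin (y / 2)\<bar> \<le> \<bar>y / 2\<bar>" by (rule abs_sin_x_le_abs_x)
    then have "\<bar>sin (y / 2)\<bar> \<le> 1 / 2" using y assms by auto
    then have "(sin (y / 2))\<^sup>2 \<le> (1 / 2)\<^sup>2" by (metis abs_le_square_iff abs_of_nonneg zero_le_divide_1_iff zero_le_numeral)
    then have "cos y \<ge> 1 / 2"
      using cos_double_sin[of "y / 2"] by (simp add: power2_eq_square)
    then show "\<exists>z. ((\<lambda>x. sin x - x / 2) has_real_derivative z) (at y) \<and> 0 \<le> z"
      by (intro exI[of _ "cos y - 1 / 2"]) (auto intro!: derivative_eq_intros)
  qed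
  then show ?thesis by simp
qed

lemma cos_pos_of_abs: "\<bar>\<theta>\<bar> < pi / 2 \<Longrightarrow> cos \<theta> > 0" for \<theta> :: real
  by (intro cos_gt_zero_pi) auto

lemma Complex_conv: "Complex v \<theta> = of_real v + \<i> * of_real \<theta>"
  by (simp add: complex_eq_iff)

text \<open>Collects what the analytic argument uses of the modular form: \<open>lam\<close> is the
  weight, and the critical line is \<open>Re s = lam / 2\<close>, at or to the right of
  \<open>1 / 2\<close>. The case \<open>A = lam / 2\<close> of \<open>bound\<close> is the Hecke
  bound, while larger \<open>A\<close> give decay for large \<open>Re w\<close>. Off the real axis
  only the modulus of the inversion formula is recorded, since its phase matters only on the
  positive reals.\<close>

locale twisted_form =
  fixes F :: "complex \<Rightarrow> complex" and b :: "nat \<Rightarrow> complex" and lam \<alpha> :: real and C :: complex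
  assumes lam: "lam \<ge> 1" and \<alpha>: "\<alpha> > 0"
    and F_cont: "continuous_on {w. Re w > 0} F"
    and expansion: "Re w > 0 \<Longrightarrow> ((\<lambda>n. b n * exp (- (of_real \<alpha> * of_nat n * w))) has_sum F w) {1..}"
    and bound: "A \<ge> lam / 2 \<Longrightarrow> \<exists>M>0. \<forall>w. Re w > 0 \<longrightarrow> norm (F w) \<le> M * Re w powr (- A)"
    and inversion_norm: "Re w > 0 \<Longrightarrow> norm (F (1 / w)) = norm w powr lam * norm (F (cnj w))"
    and inversion: "x > 0 \<Longrightarrow> F (of_real (1 / x)) = C * of_real (x powr lam) * cnj (F (of_real x))"
    and C: "norm C = 1"
    and nontrivial: "\<exists>n\<ge>1. b n \<noteq> 0"
begin

text \<open>Hecke's argument: in the variable \<open>exp (- \<alpha> * w)\<close> the expansion is a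
  power series on the unit disc. Cauchy's estimate is taken on the circle corresponding to
  \<open>Re w = 1 / n\<close>, whose radius has \<open>n\<close>-th power
  \<open>exp (- \<alpha>)\<close>.\<close>

lemma coeff_bound: "\<exists>K>0. \<forall>n\<ge>1. norm (b n) \<le> K * real n powr (lam / 2)"
proof -
  obtain M where M: "M > 0" and MF: "\<And>w. Re w > 0 \<Longrightarrow> norm (F w) \<le> M * Re w powr (- (lam / 2))"
    using bound[of "lam / 2"] by auto
  \<comment> \<open>The expansion starts at index 1, so the constant term is set to 0;
    \<open>b 0\<close> is unconstrained.\<close>
  define c where "c n = (if n = 0 then 0 else b n)" for n
  define P where "P = Abs_fps c"
  have sums: "(\<lambda>n. c n * z ^ n) sums F (- Ln z / of_real \<alpha>)" and re: "Re (- Ln z / of_real \<alpha>) = - ln (norm z) / \<alpha>"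
    and re_pos: "- ln (norm z) / \<alpha> > 0" if z: "z \<noteq> 0" "norm z < 1" for z
  proof -
    show re: "Re (- Ln z / of_real \<alpha>) = - ln (norm z) / \<alpha>" using z by simp
    show re_pos: "- ln (norm z) / \<alpha> > 0" using z \<alpha> by (simp add: divide_neg_pos)
    have *: "exp (- (of_real \<alpha> * of_nat n * (- Ln z / of_real \<alpha>))) = z ^ n" for n
      using z \<alpha> by (simp add: exp_of_nat_mult)
    have "((\<lambda>n. b n * z ^ n) has_sum F (- Ln z / of_real \<alpha>)) {1..}"
    proof -
      have "Re (- Ln z / of_real \<alpha>) > 0" unfolding re by (rule re_pos)
      from expansion[OF this] show ?thesis unfolding * .
    qed
    then have "((\<lambda>n. c n * z ^ n) has_sum F (- Ln z / of_real \<alpha>)) UNIV"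
      by (subst has_sum_cong_neutral[where g = "\<lambda>n. b n * z ^ n" and T = "{1..}"]) (auto simp: c_def)
    then show "(\<lambda>n. c n * z ^ n) sums F (- Ln z / of_real \<alpha>)" by (rule has_sum_imp_sums)
  qed
  have rad: "fps_conv_radius P \<ge> 1"
    unfolding fps_conv_radius_def
  proof (rule conv_radius_geI_ex)
    fix r :: real assume "0 < r" "ereal r < 1"
    then show "\<exists>z. norm z = r \<and> summable (\<lambda>n. fps_nth P n * z ^ n)"
      using sums[of "of_real r"] by (intro exI[of _ "of_real r"]) (auto simp: P_def sums_iff)
  qed
  have ev: "eval_fps P z = F (- Ln z / of_real \<alpha>)" if "z \<noteq> 0" "norm z < 1" for z
    using sums[OF that] by (simp add: eval_fps_def P_def sums_iff)
  have ev0: "eval_fps P 0 = 0" by (simp add: eval_fps_at_0 P_def c_def)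
  have hol: "eval_fps P holomorphic_on ball 0 1"
  proof (rule holomorphic_on_eval_fps)
    show "ball 0 1 \<subseteq> eball 0 (fps_conv_radius P)"
      using rad by (intro ball_eball_mono) (simp add: one_ereal_def)
  qed
  have "norm (b n) \<le> 2 * M * exp \<alpha> * real n powr (lam / 2)" if n: "n \<ge> 1" for n
  proof -
    define r where "r = exp (- \<alpha> / real n)"
    have r: "0 < r" "r < 1" unfolding r_def using \<alpha> n by auto
    \<comment> \<open>The factor 2 makes the bound strict, since Cauchy's estimate asks for values
      in an open ball.\<close>
    define B0 where "B0 = 2 * M * real n powr (lam / 2)"
    have B0: "B0 > 0" unfolding B0_def using M n by simp
    have der: "norm ((deriv ^^ n) (eval_fps P) 0) \<le> fact n * B0 / r ^ n"
    proof (rule Cauchy_higher_deriv_bound[where y = 0])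
      show "eval_fps P holomorphic_on ball 0 r"
        using r by (intro holomorphic_on_subset[OF hol]) auto
      show "continuous_on (cball 0 r) (eval_fps P)"
        using r by (intro holomorphic_on_imp_continuous_on holomorphic_on_subset[OF hol]) auto
      fix w :: complex assume w: "w \<in> ball 0 r"
      show "eval_fps P w \<in> ball 0 B0"
      proof (cases "w = 0")
        case False
        have w1: "norm w < 1" using w r by simp
        have "ln (norm w) \<le> ln r" using w False r by (subst ln_le_cancel_iff) auto
        then have le: "1 / real n \<le> - ln (norm w) / \<alpha>" unfolding r_def using n \<alpha> by (simp add: field_simps)
        have "norm (F (- Ln w / of_real \<alpha>)) \<le> M * (- ln (norm w) / \<alpha>) powr (- (lam / 2))"
          by (rule MF[of "- Ln w / of_real \<alpha>", unfolded re[OF False w1], OF re_pos[OF False w1]])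
        also have "\<dots> \<le> M * (1 / real n) powr (- (lam / 2))"
          using le n lam M by (intro mult_left_mono powr_mono2') auto
        also have "\<dots> = M * real n powr (lam / 2)"
          using n by (simp add: powr_minus powr_divide field_simps)
        also have "\<dots> < B0" unfolding B0_def using M n by simp
        finally show ?thesis using ev[OF False w1] by simp
      qed (use B0 ev0 in auto)
    qed (use r n in auto)
    have "fps_nth P n = (deriv ^^ n) (eval_fps P) 0 / fact n"
      by (intro fps_nth_conv_deriv less_le_trans[OF _ rad]) auto
    then have "norm (c n) = norm ((deriv ^^ n) (eval_fps P) 0) / fact n"
      by (simp add: P_def norm_divide)
    also have "\<dots> \<le> fact n * B0 / r ^ n / fact n"
      by (intro divide_right_mono der) auto
    also have "\<dots> = B0 / r ^ n" by simp
    also have "r ^ n = exp (- \<alpha>)" using n by (simp add: r_def flip: exp_of_nat_mult)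
    finally show ?thesis using n by (simp add: c_def B0_def exp_minus field_simps)
  qed
  then show ?thesis using M by (intro exI[of _ "2 * M * exp \<alpha>"]) auto
qed

text \<open>The first bound uses
  \<open>Re (exp (Complex v \<theta>)) = exp v * cos \<theta>\<close>. The second is the first at
  \<open>- v\<close>, carried over by \<open>inversion_norm\<close>. For \<open>A > lam\<close> they
  give decay at opposite ends of the ray.\<close>

lemma ray_bound:
  assumes "A \<ge> lam / 2"
  shows "\<exists>M>0. \<forall>\<theta> v. \<bar>\<theta>\<bar> < pi / 2 \<longrightarrow>
           norm (F (exp (Complex v \<theta>))) \<le> M * cos \<theta> powr (- A) * exp (- (A * v)) \<and>
           norm (F (exp (Complex v \<theta>))) \<le> M * cos \<theta> powr (- A) * exp ((A - lam) * v)"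
proof -
  obtain M where M: "M > 0" and MF: "\<And>w. Re w > 0 \<Longrightarrow> norm (F w) \<le> M * Re w powr (- A)"
    using bound[OF assms] by auto
  show ?thesis
  proof (intro exI[of _ M] conjI allI impI M)
    fix \<theta> v :: real assume \<theta>: "\<bar>\<theta>\<bar> < pi / 2"
    have 1: "norm (F (exp (Complex v \<theta>))) \<le> M * cos \<theta> powr (- A) * exp (- (A * v))" for v
      using MF[of "exp (Complex v \<theta>)"] cos_pos_of_abs[OF \<theta>]
      by (simp add: Re_exp powr_mult exp_powr_real mult_ac)
    then show "norm (F (exp (Complex v \<theta>))) \<le> M * cos \<theta> powr (- A) * exp (- (A * v))" .
    define w where "w = exp (Complex (- v) (- \<theta>))"
    have "1 / w = exp (Complex v \<theta>)"
    proof -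
      have "exp (Complex v \<theta>) * w = 1"
        unfolding w_def exp_add[symmetric] by (simp add: complex_eq_iff Re_exp Im_exp)
      then show ?thesis by (metis mult_zero_right nonzero_eq_divide_eq zero_neq_one)
    qed
    moreover have "cnj w = exp (Complex (- v) \<theta>)"
      unfolding w_def exp_cnj[symmetric] by (simp add: complex_eq_iff Re_exp Im_exp)
    moreover have "norm w = exp (- v)" by (simp add: w_def)
    moreover have "Re w > 0" using cos_pos_of_abs[OF \<theta>] by (simp add: w_def Re_exp)
    ultimately have "norm (F (exp (Complex v \<theta>))) = exp (- v) powr lam * norm (F (exp (Complex (- v) \<theta>)))"
      using inversion_norm[of w] by simp
    also have "\<dots> \<le> exp (- v) powr lam * (M * cos \<theta> powr (- A) * exp (- (A * (- v))))"
      by (intro mult_left_mono 1) auto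
    also have "\<dots> = M * cos \<theta> powr (- A) * exp ((A - lam) * v)"
      by (simp add: exp_powr_real algebra_simps flip: exp_add)
    finally show "norm (F (exp (Complex v \<theta>))) \<le> M * cos \<theta> powr (- A) * exp ((A - lam) * v)" .
  qed
qed

text \<open>With the exponent \<open>A + lam\<close> the decay rates at the two ends are
  \<open>A + lam\<close> and \<open>A\<close>. As \<open>A\<close> is arbitrary, the Mellin integral
  converges for every \<open>s\<close>.\<close>

lemma ray_bound_two_sided:
  assumes "A \<ge> 0" "\<bar>\<theta>\<bar> < pi / 2"
  shows "\<exists>M>0. \<forall>v. norm (F (exp (Complex v \<theta>))) \<le> M * exp (- (A * \<bar>v\<bar>))"
proof -
  obtain M where M: "M > 0" "\<And>v. norm (F (exp (Complex v \<theta>))) \<le> M * cos \<theta> powr (- (A + lam)) * exp (- ((A + lam) * v))"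
    "\<And>v. norm (F (exp (Complex v \<theta>))) \<le> M * cos \<theta> powr (- (A + lam)) * exp ((A + lam - lam) * v)"
    using ray_bound[of "A + lam"] assms lam by auto
  have cp: "cos \<theta> > 0" using cos_pos_of_abs assms by simp
  show ?thesis
  proof (intro exI[of _ "M * cos \<theta> powr (- (A + lam))"] conjI allI)
    show "M * cos \<theta> powr (- (A + lam)) > 0" using M cp by simp
    fix v :: real
    show "norm (F (exp (Complex v \<theta>))) \<le> M * cos \<theta> powr (- (A + lam)) * exp (- (A * \<bar>v\<bar>))"
    proof (cases "v \<ge> 0")
      case True
      have "norm (F (exp (Complex v \<theta>))) \<le> M * cos \<theta> powr (- (A + lam)) * exp (- ((A + lam) * v))" by (rule M)
      also have "\<dots> \<le> M * cos \<theta> powr (- (A + lam)) * exp (- (A * \<bar>v\<bar>))"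
        using True lam M by (intro mult_left_mono) (auto simp: ring_distribs)
      finally show ?thesis .
    next
      case False
      then show ?thesis using M(3)[of v] by simp
    qed
  qed
qed

section \<open>Mellin transforms along rotated rays\<close>

lemma F_ray_cont:
  assumes "\<bar>\<theta>\<bar> < pi / 2"
  shows "continuous_on UNIV (\<lambda>v. F (exp (Complex v \<theta>)))"
proof (rule continuous_on_compose2[OF F_cont])
  have "continuous_on UNIV (\<lambda>v. exp (of_real v + \<i> * of_real \<theta>))"
    by (intro continuous_intros)
  moreover have "of_real v + \<i> * of_real \<theta> = Complex v \<theta>" for v by (simp add: complex_eq_iff)
  ultimately show "continuous_on UNIV (\<lambda>v. exp (Complex v \<theta>))" by simp
qed (use cos_pos_of_abs[OF assms] in \<open>auto simp: Re_exp\<close>)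

text \<open>The integral of \<open>F w\<close> times the \<open>s\<close>-th power of
  \<open>w\<close> against \<open>dw / w\<close>, along the ray of argument \<open>\<theta>\<close>.
  Writing \<open>w\<close> as an exponential makes the power independent of a branch.\<close>

definition Lam :: "real \<Rightarrow> complex \<Rightarrow> complex" where
  "Lam \<theta> s = (LBINT v. F (exp (Complex v \<theta>)) * exp (s * Complex v \<theta>))"

lemma Lam_holomorphic:
  assumes \<theta>: "\<bar>\<theta>\<bar> < pi / 2"
  shows "Lam \<theta> holomorphic_on UNIV"
  unfolding Lam_def
proof (rule holomorphic_on_lborel_integral_exp[OF open_UNIV F_ray_cont[OF \<theta>]])
  have "Complex v \<theta> = of_real v + \<i> * of_real \<theta>" for v by (simp add: complex_eq_iff)
  then show "continuous_on UNIV (\<lambda>v. Complex v \<theta>)" by (simp, intro continuous_intros)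
  fix z :: complex
  \<comment> \<open>\<open>R\<close> bounds \<open>norm w\<close> on the unit disc around
    \<open>z\<close>, and the decay rate \<open>R + 1\<close> leaves a factor
    \<open>exp (- \<bar>v\<bar>)\<close> for the majorant.\<close>
  define R where "R = norm z + 1"
  obtain M where M: "M > 0" "\<And>v. norm (F (exp (Complex v \<theta>))) \<le> M * exp (- ((R + 1) * \<bar>v\<bar>))"
    using ray_bound_two_sided[OF _ \<theta>, of "R + 1"] by (auto simp: R_def)
  show "\<exists>d>0. \<exists>B. cball z d \<subseteq> UNIV \<and> integrable lborel B \<and>
      (\<forall>w\<in>cball z d. \<forall>v. norm (F (exp (Complex v \<theta>)) * exp (w * Complex v \<theta>)) \<le> B v)"
  proof (intro exI[of _ 1] exI[of _ "\<lambda>v. M * exp (R * \<bar>\<theta>\<bar>) * (if v \<le> 0 then exp (1 * v) else exp (- 1 * v))"] conjI ballI allI)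
    show "integrable lborel (\<lambda>v. M * exp (R * \<bar>\<theta>\<bar>) * (if v \<le> 0 then exp (1 * v) else exp (- 1 * v)))"
      by (intro integrable_mult_right integral_two_sided_exp) auto
    fix w :: complex and v :: real assume "w \<in> cball z 1"
    then have "norm w \<le> R" unfolding R_def using norm_triangle_ineq2[of w z] by (simp add: dist_norm norm_minus_commute)
    then have wR: "\<bar>Re w\<bar> \<le> R" "\<bar>Im w\<bar> \<le> R" using abs_Re_le_cmod[of w] abs_Im_le_cmod[of w] by auto
    have "Re w * v \<le> R * \<bar>v\<bar>" "- (Im w * \<theta>) \<le> R * \<bar>\<theta>\<bar>"
      using mult_right_mono[OF wR(1), of "\<bar>v\<bar>"] mult_right_mono[OF wR(2), of "\<bar>\<theta>\<bar>"]
      by (auto simp: abs_mult[symmetric])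
    then have "norm (exp (w * Complex v \<theta>)) \<le> exp (R * \<bar>v\<bar>) * exp (R * \<bar>\<theta>\<bar>)"
      by (simp flip: exp_add)
    then have "norm (F (exp (Complex v \<theta>)) * exp (w * Complex v \<theta>)) \<le> (M * exp (- ((R + 1) * \<bar>v\<bar>))) * (exp (R * \<bar>v\<bar>) * exp (R * \<bar>\<theta>\<bar>))"
      unfolding norm_mult using M by (intro mult_mono) auto
    also have "\<dots> = M * exp (R * \<bar>\<theta>\<bar>) * exp (- \<bar>v\<bar>)"
      by (simp add: algebra_simps flip: exp_add)
    also have "exp (- \<bar>v\<bar>) = (if v \<le> 0 then exp (1 * v) else exp (- 1 * v))" by simp
    finally show "norm (F (exp (Complex v \<theta>)) * exp (w * Complex v \<theta>)) \<le>
        M * exp (R * \<bar>\<theta>\<bar>) * (if v \<le> 0 then exp (1 * v) else exp (- 1 * v))" .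
  qed auto
qed

end

section \<open>The twisted Dirichlet series\<close>

context twisted_form
begin

text \<open>Along the ray the parameter of the exponential is \<open>c\<close>, of argument exactly
  \<open>\<theta>\<close>. Since \<open>\<bar>\<theta>\<bar> < pi / 2\<close>, its principal power
  contributes \<open>exp (- \<i> * \<theta> * s)\<close>, which cancels the phase of the rotated
  power. Hence the value of the integral does not depend on \<open>\<theta>\<close>, while the
  absolute moment does.\<close>

lemma term_integral:
  assumes \<theta>: "\<bar>\<theta>\<bar> < pi / 2" and n: "n \<ge> 1" and s: "Re s > 0"
  defines "f \<equiv> (\<lambda>v. b n * exp (- (of_real \<alpha> * of_nat n * exp (Complex v \<theta>))) * exp (s * Complex v \<theta>))"
  shows "integrable lborel f"
    and "(LBINT v. norm (f v)) = norm (b n) * real n powr (- Re s) *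
           (exp (- (\<theta> * Im s)) * Gamma (Re s) * (\<alpha> * cos \<theta>) powr (- Re s))"
    and "(LBINT v. f v) = of_real \<alpha> powr (- s) * Gamma s * (b n * of_nat n powr (- s))"
proof -
  define c where "c = of_real (\<alpha> * real n) * exp (\<i> * of_real \<theta>)"
  have an: "\<alpha> * real n > 0" using \<alpha> n by simp
  have Rec: "Re c = \<alpha> * real n * cos \<theta>"
    unfolding c_def by (simp add: Re_exp)
  have c: "Re c > 0" unfolding Rec using an cos_pos_of_abs[OF \<theta>] by simp
  have f: "f v = b n * exp (\<i> * of_real \<theta> * s) * exp (s * of_real v - c * of_real (exp v))" for v
  proof -
    have "s * Complex v \<theta> - of_real \<alpha> * of_nat n * exp (Complex v \<theta>) =
          \<i> * of_real \<theta> * s + (s * of_real v - c * of_real (exp v))"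
      unfolding Complex_conv c_def by (simp add: exp_add exp_of_real algebra_simps)
    moreover have "f v = b n * exp (s * Complex v \<theta> - of_real \<alpha> * of_nat n * exp (Complex v \<theta>))"
      unfolding f_def mult.assoc exp_add[symmetric] by (simp add: add.commute)
    ultimately show ?thesis by (simp only: exp_add mult.assoc)
  qed
  show "integrable lborel f"
    unfolding f by (intro integrable_mult_right mellin_exp(1) s c)
  have "(LBINT v. norm (f v)) = norm (b n) * norm (exp (\<i> * of_real \<theta> * s)) * (LBINT v. norm (exp (s * of_real v - c * of_real (exp v))))"
    unfolding f norm_mult integral_mult_right_zero by simp
  also have "\<dots> = norm (b n) * exp (- (\<theta> * Im s)) * (Gamma (Re s) * (\<alpha> * real n * cos \<theta>) powr (- Re s))"
    unfolding mellin_exp(2)[OF s c] Rec by simp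
  also have "(\<alpha> * real n * cos \<theta>) powr (- Re s) = (\<alpha> * cos \<theta>) powr (- Re s) * real n powr (- Re s)"
    using \<alpha> cos_pos_of_abs[OF \<theta>] by (subst powr_mult[symmetric]) (auto simp: mult_ac)
  finally show "(LBINT v. norm (f v)) = norm (b n) * real n powr (- Re s) *
           (exp (- (\<theta> * Im s)) * Gamma (Re s) * (\<alpha> * cos \<theta>) powr (- Re s))"
    by (simp add: mult_ac)
  have Lnc: "Ln c = of_real (ln (\<alpha> * real n)) + \<i> * of_real \<theta>"
  proof -
    have "c = exp (of_real (ln (\<alpha> * real n)) + \<i> * of_real \<theta>)"
      unfolding c_def exp_add using an by (simp only: exp_of_real exp_ln)
    then show ?thesis
      using \<theta> by (simp only:) (rule Ln_exp; simp)
  qed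
  have cs: "c powr (- s) = exp (- (\<i> * of_real \<theta> * s)) * of_real (\<alpha> * real n) powr (- s)"
  proof -
    have LnR: "Ln (of_real (\<alpha> * real n)) = of_real (ln (\<alpha> * real n))"
      using an by (rule Ln_of_real)
    have ne: "complex_of_real (\<alpha> * real n) \<noteq> 0" using an by (simp only: of_real_eq_0_iff)
    have "c \<noteq> 0" using c by auto
    then have "c powr (- s) = exp (- s * (of_real (ln (\<alpha> * real n)) + \<i> * of_real \<theta>))"
      by (simp only: powr_def if_False Lnc)
    also have "\<dots> = exp (- (\<i> * of_real \<theta> * s) + - s * of_real (ln (\<alpha> * real n)))"
      by (simp add: algebra_simps)
    also have "\<dots> = exp (- (\<i> * of_real \<theta> * s)) * of_real (\<alpha> * real n) powr (- s)"
      unfolding exp_add powr_def LnR using ne by (simp only: if_False)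
    finally show ?thesis .
  qed
  have "(LBINT v. f v) = b n * exp (\<i> * of_real \<theta> * s) * (Gamma s * c powr (- s))"
    unfolding f integral_mult_right_zero mellin_exp(3)[OF s c] ..
  also have "\<dots> = b n * Gamma s * of_real (\<alpha> * real n) powr (- s)"
    unfolding cs by (simp add: exp_minus field_simps)
  also have "of_real (\<alpha> * real n) powr (- s) = of_real \<alpha> powr (- s) * of_nat n powr (- s)"
    using \<alpha> n by (simp add: powr_times_real)
  finally show "(LBINT v. f v) = of_real \<alpha> powr (- s) * Gamma s * (b n * of_nat n powr (- s))"
    by (simp add: mult_ac)
qed

lemma dirichlet_summable:
  assumes "\<sigma> > lam / 2 + 1"
  shows "summable (\<lambda>n. norm (b (Suc n)) * real (Suc n) powr (- \<sigma>))"
proof -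
  obtain K where K: "K > 0" "\<And>n. n \<ge> 1 \<Longrightarrow> norm (b n) \<le> K * real n powr (lam / 2)"
    using coeff_bound by auto
  have "summable (\<lambda>n. real n powr (lam / 2 - \<sigma>))"
    using assms by (simp add: summable_real_powr_iff)
  then have "summable (\<lambda>n. K * real (Suc n) powr (lam / 2 - \<sigma>))"
    by (intro summable_mult) (subst summable_Suc_iff)
  then show ?thesis
  proof (rule summable_comparison_test[rotated], intro exI allI impI)
    fix n
    have "norm (b (Suc n)) * real (Suc n) powr (- \<sigma>) \<le> K * real (Suc n) powr (lam / 2) * real (Suc n) powr (- \<sigma>)"
      by (intro mult_right_mono K) auto
    also have "\<dots> = K * real (Suc n) powr (lam / 2 - \<sigma>)"
      using powr_add[of "real (Suc n)" "lam / 2" "- \<sigma>"] by simp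
    finally show "norm (norm (b (Suc n)) * real (Suc n) powr (- \<sigma>)) \<le> K * real (Suc n) powr (lam / 2 - \<sigma>)"
      by simp
  qed
qed

lemma expansion_sums:
  assumes "Re w > 0"
  shows "(\<lambda>n. b (Suc n) * exp (- (of_real \<alpha> * of_nat (Suc n) * w))) sums F w"
    and "summable (\<lambda>n. norm (b (Suc n) * exp (- (of_real \<alpha> * of_nat (Suc n) * w))))"
proof -
  let ?g = "\<lambda>n. b n * exp (- (of_real \<alpha> * of_nat n * w))"
  have "range Suc = {1..}" by (auto simp: image_iff) (metis Suc_pred' less_eq_Suc_le)
  then have hs: "((\<lambda>n. ?g (Suc n)) has_sum F w) UNIV"
    using expansion[OF assms] has_sum_reindex[of Suc UNIV ?g "F w"] by (simp add: comp_def)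
  then show "(\<lambda>n. ?g (Suc n)) sums F w" by (rule has_sum_imp_sums)
  from hs have "(\<lambda>n. ?g (Suc n)) summable_on UNIV" by (rule has_sum_imp_summable)
  then have "(\<lambda>n. norm (?g (Suc n))) summable_on UNIV"
    by (simp only: summable_on_iff_abs_summable_on_complex)
  then show "summable (\<lambda>n. norm (?g (Suc n)))"
    by (subst (asm) summable_on_UNIV_nonneg_real_iff) simp_all
qed

text \<open>The absolute moments of the terms are a constant times the Dirichlet series of absolute
  values at \<open>Re s\<close>, which converges in this half plane; sum and integral may therefore
  be exchanged.\<close>

lemma Lam_series:
  assumes \<theta>: "\<bar>\<theta>\<bar> < pi / 2" and s: "Re s > lam / 2 + 1"
  shows "(\<lambda>n. of_real \<alpha> powr (- s) * Gamma s * (b (Suc n) * of_nat (Suc n) powr (- s))) sums Lam \<theta> s"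
proof -
  have s0: "Re s > 0" using s lam by simp
  define f where "f n v = b n * exp (- (of_real \<alpha> * of_nat n * exp (Complex v \<theta>))) * exp (s * Complex v \<theta>)" for n v
  note ti = term_integral[OF \<theta> _ s0, folded f_def]
  have pos: "Re (exp (Complex v \<theta>)) > 0" for v
    using cos_pos_of_abs[OF \<theta>] by (simp add: Re_exp)
  have "(\<lambda>n. LBINT v. f (Suc n) v) sums (LBINT v. \<Sum>n. f (Suc n) v)"
  proof (rule sums_integral)
    show "integrable lborel (f (Suc n))" for n using ti(1)[of "Suc n"] by simp
    show "AE v in lborel. summable (\<lambda>n. norm (f (Suc n) v))"
      using summable_mult2[OF expansion_sums(2)[OF pos]] by (auto simp: f_def norm_mult)
    show "summable (\<lambda>n. LBINT v. norm (f (Suc n) v))"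
      using summable_mult2[OF dirichlet_summable[OF s], of "exp (- (\<theta> * Im s)) * Gamma (Re s) * (\<alpha> * cos \<theta>) powr (- Re s)"]
      by (subst ti(2)) auto
  qed
  also have "(LBINT v. \<Sum>n. f (Suc n) v) = Lam \<theta> s"
    unfolding Lam_def
  proof (intro Bochner_Integration.integral_cong refl)
    fix v
    have "(\<lambda>n. f (Suc n) v) sums (F (exp (Complex v \<theta>)) * exp (s * Complex v \<theta>))"
      unfolding f_def by (intro sums_mult2 expansion_sums pos)
    then show "(\<Sum>n. f (Suc n) v) = F (exp (Complex v \<theta>)) * exp (s * Complex v \<theta>)"
      by (rule sums_unique[symmetric])
  qed
  also have "(\<lambda>n. LBINT v. f (Suc n) v) = (\<lambda>n. of_real \<alpha> powr (- s) * Gamma s * (b (Suc n) * of_nat (Suc n) powr (- s)))"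
    using ti(3) by (intro ext) simp
  finally show ?thesis .
qed

text \<open>Using the entire function \<open>rGamma\<close> instead of dividing by
  \<open>Gamma\<close> makes \<open>L\<close> entire without a case distinction at the
  poles.\<close>

definition L :: "complex \<Rightarrow> complex" where
  "L s = of_real \<alpha> powr s * rGamma s * Lam 0 s"

lemma L_holomorphic: "L holomorphic_on A"
proof -
  have "L holomorphic_on UNIV"
    unfolding L_def using \<alpha> by (intro holomorphic_intros Lam_holomorphic) auto
  then show ?thesis by (rule holomorphic_on_subset) simp
qed

lemma L_sums:
  assumes \<theta>: "\<bar>\<theta>\<bar> < pi / 2" and s: "Re s > lam / 2 + 1"
  shows "(\<lambda>n. b (Suc n) * of_nat (Suc n) powr (- s)) sums (of_real \<alpha> powr s * rGamma s * Lam \<theta> s)"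
proof -
  have s0: "Re s > 0" using s lam by simp
  have "s \<notin> \<int>\<^sub>\<le>\<^sub>0" using s0 by (auto elim!: nonpos_Ints_cases)
  then have "rGamma s * Gamma s = 1" by (simp add: rGamma_inverse_Gamma Gamma_eq_zero_iff)
  moreover have "of_real \<alpha> powr s * of_real \<alpha> powr (- s) = (1 :: complex)"
    using \<alpha> by (simp add: powr_minus)
  ultimately have eq: "of_real \<alpha> powr s * rGamma s * (of_real \<alpha> powr (- s) * Gamma s * x) = x" for x
    by (metis (no_types, opaque_lifting) mult.assoc mult.commute mult_1)
  show ?thesis
    using sums_mult[OF Lam_series[OF \<theta> s], of "of_real \<alpha> powr s * rGamma s"] unfolding eq .
qed

lemma L_has_sum:
  assumes s: "Re s > lam / 2 + 1"
  shows "((\<lambda>n. b n * of_nat n powr (- s)) has_sum L s) {1..}"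
proof -
  let ?g = "\<lambda>n. b n * of_nat n powr (- s)"
  have "range Suc = {1..}" by (auto simp: image_iff) (metis Suc_pred' less_eq_Suc_le)
  moreover have "norm (?g (Suc n)) = norm (b (Suc n)) * real (Suc n) powr (- Re s)" for n
    using norm_powr_real_powr[of "complex_of_real (real (Suc n))" "- s"] by (simp add: norm_mult)
  then have "summable (\<lambda>n. norm (?g (Suc n)))"
    using dirichlet_summable[OF s] by simp
  then have "((\<lambda>n. ?g (Suc n)) has_sum L s) UNIV"
    using L_sums[of 0 s] s unfolding L_def by (intro norm_summable_imp_has_sum) auto
  ultimately show ?thesis
    using has_sum_reindex[of Suc UNIV ?g "L s"] by (simp add: comp_def)
qed

text \<open>The rotation of the line of integration by \<open>\<theta>\<close> is justified by the identity theorem in \<open>s\<close>, since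
  termwise integration gives the same Dirichlet series for every \<open>\<theta>\<close>.\<close>

lemma Lam_eq_L:
  assumes \<theta>: "\<bar>\<theta>\<bar> < pi / 2"
  shows "of_real \<alpha> powr s * rGamma s * Lam \<theta> s = L s"
proof -
  have hol: "(\<lambda>s. of_real \<alpha> powr s * rGamma s * Lam \<theta> s - L s) holomorphic_on UNIV"
    using \<alpha> by (intro holomorphic_intros Lam_holomorphic \<theta> L_holomorphic) auto
  have "of_real \<alpha> powr s * rGamma s * Lam \<theta> s - L s = 0"
  proof (rule analytic_continuation[OF hol, where U = "{s. Re s > lam / 2 + 1}" and \<xi> = "of_real (lam / 2 + 2)"])
    show "of_real (lam / 2 + 2) islimpt {s. Re s > lam / 2 + 1}"
      by (rule open_imp_islimpt) (auto simp: open_halfspace_Re_gt)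
    fix s assume "s \<in> {s. Re s > lam / 2 + 1}"
    then have s: "Re s > lam / 2 + 1" by simp
    have "L s = of_real \<alpha> powr s * rGamma s * Lam 0 s" by (rule L_def)
    also have "\<dots> = of_real \<alpha> powr s * rGamma s * Lam \<theta> s"
      by (rule sums_unique2[OF L_sums[OF _ s] L_sums[OF \<theta> s]]) simp
    finally show "of_real \<alpha> powr s * rGamma s * Lam \<theta> s - L s = 0" by simp
  qed auto
  then show ?thesis by simp
qed

lemma Lam_fourier:
  "Lam \<theta> (Complex \<sigma> t) = iexp (\<theta> * \<sigma>) * of_real (exp (- (\<theta> * t))) *
     (LBINT v. F (exp (Complex v \<theta>)) * of_real (exp (\<sigma> * v)) * iexp (t * v))"
proof -
  have eq: "F (exp (Complex v \<theta>)) * exp (Complex \<sigma> t * Complex v \<theta>) =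
     iexp (\<theta> * \<sigma>) * of_real (exp (- (\<theta> * t))) *
     (F (exp (Complex v \<theta>)) * of_real (exp (\<sigma> * v)) * iexp (t * v))" for v
  proof -
    have "Complex \<sigma> t * Complex v \<theta> = \<i> * of_real (\<theta> * \<sigma>) + of_real (- (\<theta> * t)) + of_real (\<sigma> * v) + \<i> * of_real (t * v)"
      by (simp add: complex_eq_iff algebra_simps)
    then show ?thesis by (simp only: exp_add exp_of_real) (simp only: mult_ac)
  qed
  show ?thesis unfolding Lam_def eq integral_mult_right_zero ..
qed

end

section \<open>Mean values of the Dirichlet series\<close>

text \<open>Cauchy-Schwarz, obtained by integrating
  \<open>f \<le> Q / 2 + f\<^sup>2 / (2 * Q)\<close>; \<open>Q\<close> is a bound for the root mean
  square.\<close>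

lemma integral_le_of_square:
  fixes f :: "real \<Rightarrow> real"
  assumes f: "continuous_on {a..b} f" and Q: "Q > 0" and ab: "a \<le> b"
    and sq: "integral {a..b} (\<lambda>t. (f t)\<^sup>2) \<le> Q\<^sup>2 * (b - a)"
  shows "integral {a..b} f \<le> Q * (b - a)"
proof -
  have i2: "(\<lambda>t. (f t)\<^sup>2) integrable_on {a..b}"
    by (intro integrable_continuous_real continuous_intros f)
  have "integral {a..b} f \<le> integral {a..b} (\<lambda>t. Q / 2 + (f t)\<^sup>2 / (2 * Q))"
  proof (rule integral_le)
    show "f integrable_on {a..b}" by (intro integrable_continuous_real f)
    show "(\<lambda>t. Q / 2 + (f t)\<^sup>2 / (2 * Q)) integrable_on {a..b}"
      using Q by (intro integrable_continuous_real continuous_intros f) auto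
    fix t
    have "f t * (2 * Q) \<le> Q * Q + (f t)\<^sup>2"
      using sum_squares_bound[of Q "f t"] by (simp add: power2_eq_square mult_ac)
    then show "f t \<le> Q / 2 + (f t)\<^sup>2 / (2 * Q)" using Q by (simp add: field_simps power2_eq_square)
  qed
  also have "\<dots> = integral {a..b} (\<lambda>t. Q / 2) + integral {a..b} (\<lambda>t. (f t)\<^sup>2 / (2 * Q))"
    using Q by (intro Henstock_Kurzweil_Integration.integral_add integrable_continuous_real continuous_intros f) auto
  also have "\<dots> = Q / 2 * (b - a) + integral {a..b} (\<lambda>t. (f t)\<^sup>2) / (2 * Q)"
    using ab by simp
  also have "\<dots> \<le> Q / 2 * (b - a) + Q\<^sup>2 * (b - a) / (2 * Q)"
    using Q by (intro add_left_mono divide_right_mono sq) auto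
  also have "\<dots> = Q * (b - a)" using Q by (simp add: power2_eq_square field_simps)
  finally show ?thesis .
qed

text \<open>The antiderivative is continuous at \<open>a\<close> although the integrand is singular
  there, so derivatives are taken only in the interior. With \<open>a = lam / 2\<close> this is the
  integrability that keeps the strip mean free of a logarithm.\<close>

lemma integral_inverse_sqrt:
  fixes a b :: real
  assumes "a \<le> b"
  shows "((\<lambda>x. (2 * x - 2 * a) powr (- 1 / 2)) has_integral sqrt (2 * b - 2 * a)) {a..b}"
proof -
  have "((\<lambda>x. (2 * x - 2 * a) powr (- 1 / 2)) has_integral sqrt (2 * b - 2 * a) - sqrt (2 * a - 2 * a)) {a..b}"
  proof (rule fundamental_theorem_of_calculus_interior[OF assms])
    show "continuous_on {a..b} (\<lambda>x. sqrt (2 * x - 2 * a))" by (intro continuous_intros)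
    fix x assume x: "x \<in> {a<..<b}"
    have eq: "(2 * x - 2 * a) powr (- 1 / 2) = inverse (sqrt (2 * x - 2 * a))"
      using x by (simp add: powr_minus powr_half_sqrt)
    show "((\<lambda>x. sqrt (2 * x - 2 * a)) has_vector_derivative (2 * x - 2 * a) powr (- 1 / 2)) (at x)"
      unfolding eq has_real_derivative_iff_has_vector_derivative[symmetric]
      using x by (auto intro!: derivative_eq_intros simp: field_simps)
  qed
  then show ?thesis by simp
qed

section \<open>Mean values through the rotated line\<close>

definition tilt_angle :: "real \<Rightarrow> real" where
  "tilt_angle T = pi / 2 - 1 / T"

text \<open>The cosine equals \<open>sin (1 / T)\<close>, so a factor
  \<open>cos \<theta> powr (- A)\<close> with \<open>A \<ge> 0\<close> costs at most a constant
  times \<open>T powr A\<close>.\<close>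

lemma tilt_angle:
  assumes "T \<ge> 1"
  shows "\<bar>tilt_angle T\<bar> < pi / 2" and "cos (tilt_angle T) \<ge> 1 / (2 * T)"
proof -
  have T: "0 < 1 / T" "1 / T \<le> 1" using assms by auto
  show "\<bar>tilt_angle T\<bar> < pi / 2" unfolding tilt_angle_def using T pi_gt3 by linarith
  have "cos (tilt_angle T) = sin (1 / T)" by (simp add: tilt_angle_def cos_diff)
  then show "cos (tilt_angle T) \<ge> 1 / (2 * T)" using half_le_sin[of "1 / T"] T by simp
qed

context twisted_form
begin

definition ray :: "real \<Rightarrow> real \<Rightarrow> real \<Rightarrow> complex" where
  "ray \<theta> \<sigma> v = F (exp (Complex v \<theta>)) * of_real (exp (\<sigma> * v))"

text \<open>Up to a factor of modulus \<open>exp (- (\<theta> * t))\<close> this is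
  \<open>Lam \<theta> (Complex \<sigma> t)\<close>, see \<open>Lam_fourier\<close>; in this form it
  is a Fourier transform to which \<open>fourier_bessel\<close> applies.\<close>

definition hat :: "real \<Rightarrow> real \<Rightarrow> real \<Rightarrow> complex" where
  "hat \<theta> \<sigma> t = (LBINT v. ray \<theta> \<sigma> v * iexp (t * v))"

lemma ray_cont:
  assumes "\<bar>\<theta>\<bar> < pi / 2"
  shows "continuous_on UNIV (ray \<theta> \<sigma>)"
  unfolding ray_def by (intro continuous_intros F_ray_cont assms)

lemma ray_decay:
  assumes "\<bar>\<theta>\<bar> < pi / 2"
  shows "\<exists>M>0. \<forall>v. norm (ray \<theta> \<sigma> v) \<le> M * (if v \<le> 0 then exp (1 * v) else exp (- 1 * v))"
proof -
  obtain M where M: "M > 0" "\<And>v. norm (F (exp (Complex v \<theta>))) \<le> M * exp (- ((\<bar>\<sigma>\<bar> + 1) * \<bar>v\<bar>))"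
    using ray_bound_two_sided[OF _ assms, of "\<bar>\<sigma>\<bar> + 1"] by auto
  show ?thesis
  proof (intro exI[of _ M] conjI allI M)
    fix v :: real
    have "\<sigma> * v \<le> \<bar>\<sigma>\<bar> * \<bar>v\<bar>" by (simp flip: abs_mult)
    then have "norm (ray \<theta> \<sigma> v) \<le> M * exp (- ((\<bar>\<sigma>\<bar> + 1) * \<bar>v\<bar>)) * exp (\<bar>\<sigma>\<bar> * \<bar>v\<bar>)"
      unfolding ray_def norm_mult using M by (intro mult_mono) auto
    also have "\<dots> = M * exp (- \<bar>v\<bar>)" by (simp add: algebra_simps flip: exp_add)
    also have "exp (- \<bar>v\<bar>) = (if v \<le> 0 then exp (1 * v) else exp (- 1 * v))" by simp
    finally show "norm (ray \<theta> \<sigma> v) \<le> M * (if v \<le> 0 then exp (1 * v) else exp (- 1 * v))" .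
  qed
qed

lemma ray_integrable:
  assumes "\<bar>\<theta>\<bar> < pi / 2"
  shows "integrable lborel (ray \<theta> \<sigma>)" and "integrable lborel (\<lambda>v. (norm (ray \<theta> \<sigma> v))\<^sup>2)"
proof -
  obtain M where M: "M > 0" "\<And>v. norm (ray \<theta> \<sigma> v) \<le> M * (if v \<le> 0 then exp (1 * v) else exp (- 1 * v))"
    using ray_decay[OF assms] by blast
  let ?e = "\<lambda>v::real. (if v \<le> 0 then exp (1 * v) else exp (- 1 * v))"
  have m[measurable]: "ray \<theta> \<sigma> \<in> borel_measurable borel"
    by (rule borel_measurable_continuous_onI[OF ray_cont[OF assms]])
  have e: "integrable lborel (\<lambda>v. M * ?e v)" "integrable lborel (\<lambda>v. M\<^sup>2 * ?e v)"
    by (intro integrable_mult_right integral_two_sided_exp; simp)+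
  have e1: "0 \<le> ?e v" "?e v \<le> 1" for v by auto
  show "integrable lborel (ray \<theta> \<sigma>)"
    by (rule Bochner_Integration.integrable_bound[OF e(1)])
       (use M e1 in \<open>auto intro!: AE_I2 order.trans[OF _ abs_ge_self] simp del: mult_minus_left\<close>)
  show "integrable lborel (\<lambda>v. (norm (ray \<theta> \<sigma> v))\<^sup>2)"
  proof (rule Bochner_Integration.integrable_bound[OF e(2)])
    show "AE v in lborel. norm ((norm (ray \<theta> \<sigma> v))\<^sup>2) \<le> norm (M\<^sup>2 * ?e v)"
    proof (intro AE_I2)
      fix v
      have "(norm (ray \<theta> \<sigma> v))\<^sup>2 \<le> (M * ?e v)\<^sup>2" by (intro power_mono M) auto
      also have "\<dots> = M\<^sup>2 * (?e v)\<^sup>2" by (rule power_mult_distrib)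
      also have "\<dots> \<le> M\<^sup>2 * ?e v"
        using e1[of v] by (intro mult_left_mono) (auto simp: power2_eq_square intro: mult_left_le)
      finally have "(norm (ray \<theta> \<sigma> v))\<^sup>2 \<le> M\<^sup>2 * ?e v" .
      then show "norm ((norm (ray \<theta> \<sigma> v))\<^sup>2) \<le> norm (M\<^sup>2 * ?e v)" by simp
    qed
  qed measurable
qed

lemma hat_cont: "\<bar>\<theta>\<bar> < pi / 2 \<Longrightarrow> continuous_on A (hat \<theta> \<sigma>)"
  unfolding hat_def by (rule fourier_continuous[OF ray_integrable(1)])

lemma norm_L_eq:
  assumes \<theta>: "\<bar>\<theta>\<bar> < pi / 2"
  shows "norm (L (Complex \<sigma> t)) = \<alpha> powr \<sigma> * norm (rGamma (Complex \<sigma> t)) * exp (- (\<theta> * t)) * norm (hat \<theta> \<sigma> t)"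
proof -
  have "norm (of_real \<alpha> powr Complex \<sigma> t) = \<alpha> powr \<sigma>"
    using \<alpha> by (simp add: norm_powr_real_powr)
  then show ?thesis
    unfolding Lam_eq_L[OF \<theta>, symmetric] Lam_fourier hat_def ray_def by (simp add: norm_mult)
qed

text \<open>In the variable \<open>ln (cos \<theta>) + v\<close>, the logarithm of the real part on
  the ray, the bounds for \<open>F\<close> lose their dependence on \<open>\<theta>\<close>. The
  Hecke exponent \<open>lam / 2\<close> is used where this variable is at most 0 and the large
  exponent \<open>A\<close> elsewhere; the translation produces the power of
  \<open>cos \<theta>\<close>.\<close>

lemma ray_square_integral:
  assumes "\<sigma>0 \<ge> 0"
  shows "\<exists>K>0. \<forall>\<sigma> \<theta>. lam / 2 < \<sigma> \<longrightarrow> \<sigma> \<le> \<sigma>0 \<longrightarrow> \<bar>\<theta>\<bar> < pi / 2 \<longrightarrow>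
           (LBINT v. (norm (ray \<theta> \<sigma> v))\<^sup>2) \<le> K * cos \<theta> powr (- 2 * \<sigma>) / (2 * \<sigma> - lam)"
proof -
  \<comment> \<open>Chosen so that \<open>2 * A - 2 * \<sigma> \<ge> 2\<close> on the whole range;
    the tail then contributes at most \<open>1 / 2\<close>, which is absorbed by the main
    term.\<close>
  define A where "A = \<sigma>0 + lam / 2 + 1"
  obtain M1 where M1: "M1 > 0" "\<And>\<theta> v. \<bar>\<theta>\<bar> < pi / 2 \<Longrightarrow>
      norm (F (exp (Complex v \<theta>))) \<le> M1 * cos \<theta> powr (- (lam / 2)) * exp (- (lam / 2 * v))"
    using ray_bound[of "lam / 2"] by auto
  obtain M2 where M2: "M2 > 0" "\<And>\<theta> v. \<bar>\<theta>\<bar> < pi / 2 \<Longrightarrow>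
      norm (F (exp (Complex v \<theta>))) \<le> M2 * cos \<theta> powr (- A) * exp (- (A * v))"
    using ray_bound[of A] assms lam by (auto simp: A_def)
  define M where "M = max M1 M2"
  have M: "M > 0" "M1 \<le> M" "M2 \<le> M" using M1 by (auto simp: M_def)
  show ?thesis
  proof (intro exI[of _ "M\<^sup>2 * (1 + \<sigma>0)"] conjI allI impI)
    show "M\<^sup>2 * (1 + \<sigma>0) > 0" using M assms by simp
    fix \<sigma> \<theta> :: real assume \<sigma>: "lam / 2 < \<sigma>" "\<sigma> \<le> \<sigma>0" and \<theta>: "\<bar>\<theta>\<bar> < pi / 2"
    define \<kappa> where "\<kappa> = cos \<theta>"
    have \<kappa>: "\<kappa> > 0" unfolding \<kappa>_def by (rule cos_pos_of_abs[OF \<theta>])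
    define h where "h x = (if x \<le> 0 then exp ((2 * \<sigma> - lam) * x) else exp (- (2 * A - 2 * \<sigma>) * x))" for x
    have ab: "2 * \<sigma> - lam > 0" "2 * A - 2 * \<sigma> > 0" using \<sigma> lam by (auto simp: A_def)
    have hi: "integrable lborel h" "(LBINT x. h x) = 1 / (2 * \<sigma> - lam) + 1 / (2 * A - 2 * \<sigma>)"
      unfolding h_def using integral_two_sided_exp[OF ab] by auto
    have hs: "integrable lborel (\<lambda>v. h (ln \<kappa> + 1 * v))" "(LBINT v. h (ln \<kappa> + 1 * v)) = (LBINT x. h x)"
      using lborel_integrable_real_affine[OF hi(1), of 1 "ln \<kappa>"] lborel_integral_real_affine[of 1 h "ln \<kappa>"] by auto
    have le: "norm (F (exp (Complex v \<theta>))) \<le> M * exp (- (lam / 2 * (ln \<kappa> + v)))"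
             "norm (F (exp (Complex v \<theta>))) \<le> M * exp (- (A * (ln \<kappa> + v)))" for v
    proof -
      have "norm (F (exp (Complex v \<theta>))) \<le> M1 * exp (- (lam / 2 * (ln \<kappa> + v)))"
        using M1(2)[OF \<theta>, of v] \<kappa> unfolding \<kappa>_def[symmetric]
        by (simp add: powr_def ring_distribs mult.assoc flip: exp_add)
      also have "\<dots> \<le> M * exp (- (lam / 2 * (ln \<kappa> + v)))" using M by (intro mult_right_mono) auto
      finally show "norm (F (exp (Complex v \<theta>))) \<le> M * exp (- (lam / 2 * (ln \<kappa> + v)))" .
      have "norm (F (exp (Complex v \<theta>))) \<le> M2 * exp (- (A * (ln \<kappa> + v)))"
        using M2(2)[OF \<theta>, of v] \<kappa> unfolding \<kappa>_def[symmetric]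
        by (simp add: powr_def ring_distribs mult.assoc flip: exp_add)
      also have "\<dots> \<le> M * exp (- (A * (ln \<kappa> + v)))" using M by (intro mult_right_mono) auto
      finally show "norm (F (exp (Complex v \<theta>))) \<le> M * exp (- (A * (ln \<kappa> + v)))" .
    qed
    have pw: "(norm (ray \<theta> \<sigma> v))\<^sup>2 \<le> M\<^sup>2 * \<kappa> powr (- 2 * \<sigma>) * h (ln \<kappa> + 1 * v)" for v
    proof -
      have *: "(norm (ray \<theta> \<sigma> v))\<^sup>2 \<le> M\<^sup>2 * \<kappa> powr (- 2 * \<sigma>) * exp ((2 * \<sigma> - 2 * B) * (ln \<kappa> + v))"
        if "norm (F (exp (Complex v \<theta>))) \<le> M * exp (- (B * (ln \<kappa> + v)))" for B
      proof -
        have "norm (ray \<theta> \<sigma> v) \<le> M * exp (- (B * (ln \<kappa> + v))) * exp (\<sigma> * v)"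
          unfolding ray_def norm_mult by (simp add: that)
        also have "\<dots> = M * exp (\<sigma> * v - B * (ln \<kappa> + v))" 
          unfolding mult.assoc exp_add[symmetric] by (simp add: algebra_simps)
        finally have "(norm (ray \<theta> \<sigma> v))\<^sup>2 \<le> (M * exp (\<sigma> * v - B * (ln \<kappa> + v)))\<^sup>2"
          by (intro power_mono) auto
        also have "\<dots> = M\<^sup>2 * exp (2 * (\<sigma> * v - B * (ln \<kappa> + v)))"
          by (simp only: power_mult_distrib exp_double)
        also have "exp (2 * (\<sigma> * v - B * (ln \<kappa> + v))) = \<kappa> powr (- 2 * \<sigma>) * exp ((2 * \<sigma> - 2 * B) * (ln \<kappa> + v))"
        proof -
          have "2 * (\<sigma> * v - B * (ln \<kappa> + v)) = - 2 * \<sigma> * ln \<kappa> + (2 * \<sigma> - 2 * B) * (ln \<kappa> + v)"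
            by (simp add: algebra_simps)
          moreover have "\<kappa> powr (- 2 * \<sigma>) = exp (- 2 * \<sigma> * ln \<kappa>)"
            using \<kappa> by (simp add: powr_def)
          ultimately show ?thesis by (simp only: exp_add)
        qed
        finally show ?thesis by (simp only: mult.assoc)
      qed
      show ?thesis
      proof (cases "ln \<kappa> + v \<le> 0")
        case True
        then show ?thesis using *[OF le(1)] by (simp add: h_def)
      next
        case False
        moreover have "(2 * \<sigma> - 2 * A) * (ln \<kappa> + v) = - (2 * A - 2 * \<sigma>) * (ln \<kappa> + v)" by (simp add: algebra_simps)
        ultimately show ?thesis using *[OF le(2)] by (simp add: h_def)
      qed
    qed
    have "(LBINT v. (norm (ray \<theta> \<sigma> v))\<^sup>2) \<le> (LBINT v. M\<^sup>2 * \<kappa> powr (- 2 * \<sigma>) * h (ln \<kappa> + 1 * v))"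
      by (intro integral_mono ray_integrable \<theta> integrable_mult_right hs pw)
    also have "\<dots> = M\<^sup>2 * \<kappa> powr (- 2 * \<sigma>) * (1 / (2 * \<sigma> - lam) + 1 / (2 * A - 2 * \<sigma>))"
      unfolding integral_mult_right_zero hs(2) hi(2) ..
    also have "\<dots> \<le> M\<^sup>2 * \<kappa> powr (- 2 * \<sigma>) * ((1 + \<sigma>0) / (2 * \<sigma> - lam))"
    proof (intro mult_left_mono)
      have "1 / (2 * A - 2 * \<sigma>) \<le> 1 / 2" using \<sigma> lam by (intro divide_left_mono) (auto simp: A_def)
      also have "\<dots> \<le> \<sigma>0 / (2 * \<sigma> - lam)" using \<sigma> lam by (simp add: field_simps)
      finally show "1 / (2 * \<sigma> - lam) + 1 / (2 * A - 2 * \<sigma>) \<le> (1 + \<sigma>0) / (2 * \<sigma> - lam)"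
        by (simp add: add_divide_distrib)
    qed auto
    finally show "(LBINT v. (norm (ray \<theta> \<sigma> v))\<^sup>2) \<le> M\<^sup>2 * (1 + \<sigma>0) * cos \<theta> powr (- 2 * \<sigma>) / (2 * \<sigma> - lam)"
      unfolding \<kappa>_def[symmetric] by (simp add: mult_ac)
  qed
qed

text \<open>Dividing by Gamma costs \<open>T powr (1 / 2 - \<sigma>) * exp (pi * t / 2)\<close>. The
  rotation returns all of the exponential except \<open>exp (t / T) \<le> exp 3\<close>. The range
  extends to \<open>3 * T\<close> because segments start at most at \<open>2 * T\<close> and have
  length at most \<open>T\<close>.\<close>

lemma norm_L_le_hat:
  assumes "\<sigma>0 \<ge> 0"
  shows "\<exists>c>0. \<forall>\<sigma> T t. 1 / 2 \<le> \<sigma> \<longrightarrow> \<sigma> \<le> \<sigma>0 \<longrightarrow> 1 \<le> T \<longrightarrow> T \<le> t \<longrightarrow> t \<le> 3 * T \<longrightarrow>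
           norm (L (Complex \<sigma> t)) \<le> c * T powr (1 / 2 - \<sigma>) * norm (hat (tilt_angle T) \<sigma> t)"
proof -
  define m where "m = nat \<lceil>\<sigma>0\<rceil>"
  have m: "\<sigma>0 \<le> real m" unfolding m_def by (simp add: real_nat_ceiling_ge)
  obtain g where g: "g > 0" "\<And>\<sigma> t. 1 / 2 \<le> \<sigma> \<Longrightarrow> \<sigma> \<le> 1 / 2 + real m \<Longrightarrow> 1 \<le> t \<Longrightarrow>
      g * t powr (\<sigma> - 1 / 2) * exp (- pi * t / 2) \<le> norm (Gamma (Complex \<sigma> t))"
    using Gamma_lower_bound[of m] by auto
  show ?thesis
  proof (intro exI[of _ "(1 + \<alpha>) powr \<sigma>0 * exp 3 / g"] conjI allI impI)
    show "(1 + \<alpha>) powr \<sigma>0 * exp 3 / g > 0" using g \<alpha> by simp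
    fix \<sigma> T t :: real
    assume \<sigma>: "1 / 2 \<le> \<sigma>" "\<sigma> \<le> \<sigma>0" and T: "1 \<le> T" "T \<le> t" "t \<le> 3 * T"
    have t1: "1 \<le> t" using T by simp
    define d where "d = g * T powr (\<sigma> - 1 / 2) * exp (- pi * t / 2)"
    have d: "d > 0" unfolding d_def using g T by simp
    have "d \<le> g * t powr (\<sigma> - 1 / 2) * exp (- pi * t / 2)"
      unfolding d_def using g T \<sigma> by (intro mult_right_mono mult_left_mono powr_mono2) auto
    also have "\<dots> \<le> norm (Gamma (Complex \<sigma> t))"
      using \<sigma> m t1 by (intro g) auto
    finally have "norm (rGamma (Complex \<sigma> t)) \<le> 1 / d"
      using d unfolding rGamma_inverse_Gamma norm_inverse by (simp add: inverse_eq_divide frac_le)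
    also have "1 / d = T powr (1 / 2 - \<sigma>) * exp (pi * t / 2) / g"
    proof -
      have "T powr (1 / 2 - \<sigma>) = 1 / T powr (\<sigma> - 1 / 2)"
        using powr_minus_divide[of T "\<sigma> - 1 / 2"] by simp
      then show ?thesis by (simp add: d_def exp_minus inverse_eq_divide)
    qed
    finally have G: "norm (rGamma (Complex \<sigma> t)) \<le> T powr (1 / 2 - \<sigma>) * exp (pi * t / 2) / g" .
    have a: "\<alpha> powr \<sigma> \<le> (1 + \<alpha>) powr \<sigma>0"
    proof -
      have "\<alpha> powr \<sigma> \<le> (1 + \<alpha>) powr \<sigma>" using \<alpha> \<sigma> by (intro powr_mono2) auto
      also have "\<dots> \<le> (1 + \<alpha>) powr \<sigma>0" using \<alpha> \<sigma> by (intro powr_mono) auto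
      finally show ?thesis .
    qed
    have e: "exp (pi * t / 2) * exp (- (tilt_angle T * t)) \<le> exp 3"
    proof -
      have "exp (pi * t / 2) * exp (- (tilt_angle T * t)) = exp (t / T)"
      proof -
        have "pi * t / 2 + - (tilt_angle T * t) = t / T" by (simp add: tilt_angle_def left_diff_distrib)
        then show ?thesis unfolding exp_add[symmetric] by (simp only:)
      qed
      also have "\<dots> \<le> exp 3" using T by (simp add: field_simps)
      finally show ?thesis .
    qed
    have "norm (L (Complex \<sigma> t)) = \<alpha> powr \<sigma> * norm (rGamma (Complex \<sigma> t)) * exp (- (tilt_angle T * t)) * norm (hat (tilt_angle T) \<sigma> t)"
      by (rule norm_L_eq[OF tilt_angle(1)[OF T(1)]])
    also have "\<dots> \<le> (1 + \<alpha>) powr \<sigma>0 * (T powr (1 / 2 - \<sigma>) * exp (pi * t / 2) / g) * exp (- (tilt_angle T * t)) * norm (hat (tilt_angle T) \<sigma> t)"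
      using a G by (intro mult_right_mono mult_mono) auto
    also have "\<dots> = (exp (pi * t / 2) * exp (- (tilt_angle T * t))) * ((1 + \<alpha>) powr \<sigma>0 * T powr (1 / 2 - \<sigma>) / g * norm (hat (tilt_angle T) \<sigma> t))"
      by (simp add: mult_ac)
    also have "\<dots> \<le> exp 3 * ((1 + \<alpha>) powr \<sigma>0 * T powr (1 / 2 - \<sigma>) / g * norm (hat (tilt_angle T) \<sigma> t))"
      using g by (intro mult_right_mono e) auto
    finally show "norm (L (Complex \<sigma> t)) \<le> (1 + \<alpha>) powr \<sigma>0 * exp 3 / g * T powr (1 / 2 - \<sigma>) * norm (hat (tilt_angle T) \<sigma> t)"
      by (simp add: mult_ac)
  qed
qed

lemma L_vertical_cont: "continuous_on A (\<lambda>t. L (Complex \<sigma> t))"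
proof (rule continuous_on_compose2[OF holomorphic_on_imp_continuous_on[OF L_holomorphic[of UNIV]]])
  show "continuous_on A (\<lambda>t. Complex \<sigma> t)" unfolding Complex_conv by (intro continuous_intros)
qed auto

text \<open>The Gamma factor contributes \<open>T powr (1 - 2 * \<sigma>)\<close> to the mean square
  and the ray integral \<open>T powr (2 * \<sigma>)\<close>. Their product is \<open>T\<close> for
  every \<open>\<sigma>\<close>, so only \<open>1 / (2 * \<sigma> - lam)\<close> remains, with a
  constant uniform in \<open>\<sigma>\<close>; Cauchy-Schwarz halves the exponent.\<close>

lemma L_mean:
  assumes "\<sigma>0 \<ge> 0"
  shows "\<exists>K>0. \<forall>\<sigma> T. lam / 2 < \<sigma> \<longrightarrow> \<sigma> \<le> \<sigma>0 \<longrightarrow> 1 \<le> T \<longrightarrow>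
           integral {T..3 * T} (\<lambda>t. norm (L (Complex \<sigma> t))) \<le> K * T * (2 * \<sigma> - lam) powr (- 1 / 2)"
proof -
  obtain c where c: "c > 0" "\<And>\<sigma> T t. 1 / 2 \<le> \<sigma> \<Longrightarrow> \<sigma> \<le> \<sigma>0 \<Longrightarrow> 1 \<le> T \<Longrightarrow> T \<le> t \<Longrightarrow> t \<le> 3 * T \<Longrightarrow>
           norm (L (Complex \<sigma> t)) \<le> c * T powr (1 / 2 - \<sigma>) * norm (hat (tilt_angle T) \<sigma> t)"
    using norm_L_le_hat[OF assms] by blast
  obtain K where K: "K > 0" "\<And>\<sigma> \<theta>. lam / 2 < \<sigma> \<Longrightarrow> \<sigma> \<le> \<sigma>0 \<Longrightarrow> \<bar>\<theta>\<bar> < pi / 2 \<Longrightarrow>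
           (LBINT v. (norm (ray \<theta> \<sigma> v))\<^sup>2) \<le> K * cos \<theta> powr (- 2 * \<sigma>) / (2 * \<sigma> - lam)"
    using ray_square_integral[OF assms] by blast
  define D where "D = c\<^sup>2 * (2 * pi * exp (9 / 2)) * K * 2 powr (2 * \<sigma>0)"
  have D: "D > 0" unfolding D_def using c K by simp
  show ?thesis
  proof (intro exI[of _ "2 * sqrt (D / 2)"] conjI allI impI)
    show "2 * sqrt (D / 2) > 0" using D by simp
    fix \<sigma> T :: real assume \<sigma>: "lam / 2 < \<sigma>" "\<sigma> \<le> \<sigma>0" and T: "1 \<le> T"
    have \<sigma>': "1 / 2 \<le> \<sigma>" "2 * \<sigma> - lam > 0" using \<sigma> lam by auto
    note \<theta> = tilt_angle[OF T]
    have cosb: "cos (tilt_angle T) powr (- 2 * \<sigma>) \<le> 2 powr (2 * \<sigma>0) * T powr (2 * \<sigma>)"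
    proof -
      have "cos (tilt_angle T) powr (- 2 * \<sigma>) \<le> (1 / (2 * T)) powr (- 2 * \<sigma>)"
        using \<theta> T \<sigma>' by (intro powr_mono2') auto
      also have "\<dots> = 2 powr (2 * \<sigma>) * T powr (2 * \<sigma>)"
        using T by (simp add: powr_minus powr_divide powr_mult field_simps)
      also have "\<dots> \<le> 2 powr (2 * \<sigma>0) * T powr (2 * \<sigma>)"
        using \<sigma> by (intro mult_right_mono powr_mono) auto
      finally show ?thesis .
    qed
    have i: "(\<lambda>t. (norm (hat (tilt_angle T) \<sigma> t))\<^sup>2) integrable_on {T..3 * T}"
      by (intro integrable_continuous_real continuous_intros hat_cont \<theta>)
    have "integral {T..3 * T} (\<lambda>t. (norm (L (Complex \<sigma> t)))\<^sup>2) \<le>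
        integral {T..3 * T} (\<lambda>t. (c * T powr (1 / 2 - \<sigma>))\<^sup>2 * (norm (hat (tilt_angle T) \<sigma> t))\<^sup>2)"
    proof (rule integral_le)
      show "(\<lambda>t. (norm (L (Complex \<sigma> t)))\<^sup>2) integrable_on {T..3 * T}"
        by (intro integrable_continuous_real continuous_intros L_vertical_cont)
      show "(\<lambda>t. (c * T powr (1 / 2 - \<sigma>))\<^sup>2 * (norm (hat (tilt_angle T) \<sigma> t))\<^sup>2) integrable_on {T..3 * T}"
        using i by (rule integrable_on_mult_right)
      fix t assume "t \<in> {T..3 * T}"
      then have "norm (L (Complex \<sigma> t)) \<le> c * T powr (1 / 2 - \<sigma>) * norm (hat (tilt_angle T) \<sigma> t)"
        using \<sigma> \<sigma>' T by (intro c) auto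
      then show "(norm (L (Complex \<sigma> t)))\<^sup>2 \<le> (c * T powr (1 / 2 - \<sigma>))\<^sup>2 * (norm (hat (tilt_angle T) \<sigma> t))\<^sup>2"
        unfolding power_mult_distrib[symmetric] by (intro power_mono) auto
    qed
    also have "\<dots> = (c * T powr (1 / 2 - \<sigma>))\<^sup>2 * integral {T..3 * T} (\<lambda>t. (norm (hat (tilt_angle T) \<sigma> t))\<^sup>2)"
      by simp
    also have "\<dots> \<le> (c * T powr (1 / 2 - \<sigma>))\<^sup>2 * (2 * pi * exp (9 / 2) * (K * (2 powr (2 * \<sigma>0) * T powr (2 * \<sigma>)) / (2 * \<sigma> - lam)))"
    proof (intro mult_left_mono)
      have "integral {T..3 * T} (\<lambda>t. (norm (hat (tilt_angle T) \<sigma> t))\<^sup>2) \<le> 2 * pi * exp (9 / 2) * (LBINT v. (norm (ray (tilt_angle T) \<sigma> v))\<^sup>2)"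
        unfolding hat_def using T by (intro fourier_bessel[of _ T] ray_integrable \<theta>) auto
      also have "\<dots> \<le> 2 * pi * exp (9 / 2) * (K * cos (tilt_angle T) powr (- 2 * \<sigma>) / (2 * \<sigma> - lam))"
        by (intro mult_left_mono K \<sigma> \<theta>) auto
      also have "\<dots> \<le> 2 * pi * exp (9 / 2) * (K * (2 powr (2 * \<sigma>0) * T powr (2 * \<sigma>)) / (2 * \<sigma> - lam))"
        using \<sigma>' K by (intro mult_left_mono divide_right_mono cosb) auto
      finally show "integral {T..3 * T} (\<lambda>t. (norm (hat (tilt_angle T) \<sigma> t))\<^sup>2) \<le>
          2 * pi * exp (9 / 2) * (K * (2 powr (2 * \<sigma>0) * T powr (2 * \<sigma>)) / (2 * \<sigma> - lam))" .
    qed auto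
    also have "\<dots> = D / (2 * \<sigma> - lam) * ((T powr (1 / 2 - \<sigma>))\<^sup>2 * T powr (2 * \<sigma>))"
      unfolding D_def power_mult_distrib by simp
    also have "(T powr (1 / 2 - \<sigma>))\<^sup>2 * T powr (2 * \<sigma>) = T"
      using T by (simp add: power2_eq_square flip: powr_add)
    also have "D / (2 * \<sigma> - lam) * T = (sqrt (D / 2) * (2 * \<sigma> - lam) powr (- 1 / 2))\<^sup>2 * (3 * T - T)"
    proof -
      have "((2 * \<sigma> - lam) powr (- 1 / 2))\<^sup>2 = 1 / (2 * \<sigma> - lam)"
        using \<sigma>' by (simp add: power2_eq_square powr_minus_divide flip: powr_add)
      then have "(sqrt (D / 2) * (2 * \<sigma> - lam) powr (- 1 / 2))\<^sup>2 = D / 2 * (1 / (2 * \<sigma> - lam))"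
        using D by (simp only: power_mult_distrib) simp
      moreover have "D / X * T = D / 2 * (1 / X) * (3 * T - T)" for X by simp
      ultimately show ?thesis by (simp only:)
    qed
    finally have sq: "integral {T..3 * T} (\<lambda>t. (norm (L (Complex \<sigma> t)))\<^sup>2) \<le>
        (sqrt (D / 2) * (2 * \<sigma> - lam) powr (- 1 / 2))\<^sup>2 * (3 * T - T)" .
    have Q: "sqrt (D / 2) * (2 * \<sigma> - lam) powr (- 1 / 2) > 0" using D \<sigma>' by simp
    have "integral {T..3 * T} (\<lambda>t. norm (L (Complex \<sigma> t))) \<le> sqrt (D / 2) * (2 * \<sigma> - lam) powr (- 1 / 2) * (3 * T - T)"
      by (rule integral_le_of_square[OF _ Q _ sq]) (use T in \<open>auto intro!: continuous_intros L_vertical_cont\<close>)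
    then show "integral {T..3 * T} (\<lambda>t. norm (L (Complex \<sigma> t))) \<le> 2 * sqrt (D / 2) * T * (2 * \<sigma> - lam) powr (- 1 / 2)"
      by (simp add: mult_ac)
  qed
qed

lemma L_strip_cont: "continuous_on A (\<lambda>(t, x). L (Complex x t))"
proof -
  have "continuous_on A (\<lambda>p. L (Complex (snd p) (fst p)))"
  proof (rule continuous_on_compose2[OF holomorphic_on_imp_continuous_on[OF L_holomorphic[of UNIV]]])
    show "continuous_on A (\<lambda>p. Complex (snd p) (fst p))" unfolding Complex_conv by (intro continuous_intros)
  qed auto
  then show ?thesis by (simp add: case_prod_unfold)
qed

text \<open>After exchanging the order of integration \<open>L_mean\<close> applies on each vertical
  line, and its inverse square root is integrable up to the critical line.\<close>

lemma L_strip_mean: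
  assumes \<sigma>0: "lam / 2 \<le> \<sigma>0"
  shows "\<exists>K>0. \<forall>T\<ge>1. integral {T..3 * T} (\<lambda>t. integral {lam / 2..\<sigma>0} (\<lambda>x. norm (L (Complex x t)))) \<le> K * T"
proof -
  obtain K where K: "K > 0" "\<And>\<sigma> T. lam / 2 < \<sigma> \<Longrightarrow> \<sigma> \<le> \<sigma>0 \<Longrightarrow> 1 \<le> T \<Longrightarrow>
           integral {T..3 * T} (\<lambda>t. norm (L (Complex \<sigma> t))) \<le> K * T * (2 * \<sigma> - lam) powr (- 1 / 2)"
    using L_mean[of \<sigma>0] \<sigma>0 lam by auto
  show ?thesis
  \<comment> \<open>The summand 1 keeps the constant positive when
    \<open>\<sigma>0 = lam / 2\<close>.\<close>
  proof (intro exI[of _ "K * sqrt (2 * \<sigma>0 - lam) + 1"] conjI allI impI)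
    show "K * sqrt (2 * \<sigma>0 - lam) + 1 > 0" using K \<sigma>0 by (simp add: add_nonneg_pos)
    fix T :: real assume T: "T \<ge> 1"
    define m where "m x = integral {T..3 * T} (\<lambda>t. norm (L (Complex x t)))" for x
    have cont: "continuous_on A (\<lambda>(t, x). norm (L (Complex x t)))" for A
      using continuous_on_norm[OF L_strip_cont[of A]] by (simp add: case_prod_unfold)
    have cont': "continuous_on A (\<lambda>(x, t). norm (L (Complex x t)))" for A
    proof -
      have "continuous_on A (\<lambda>p. norm (L (Complex (fst p) (snd p))))"
        using continuous_on_compose2[OF cont[of UNIV] continuous_on_swap[of A]] by (simp add: case_prod_unfold)
      then show ?thesis by (simp add: case_prod_unfold)
    qed
    have "integral {T..3 * T} (\<lambda>t. integral {lam / 2..\<sigma>0} (\<lambda>x. norm (L (Complex x t)))) = integral {lam / 2..\<sigma>0} m"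
      using integral_swap_continuous[of T "lam / 2" "3 * T" \<sigma>0 "\<lambda>t x. norm (L (Complex x t))", OF cont]
      unfolding m_def by simp
    \<comment> \<open>At the endpoint \<open>x = lam / 2\<close> the majorant reads
      \<open>0 powr (- 1 / 2) = 0\<close>, so it is replaced there by \<open>m x\<close>; one point
      does not affect the integral.\<close>
    also have "\<dots> \<le> integral {lam / 2..\<sigma>0} (\<lambda>x. if x = lam / 2 then m x else K * T * (2 * x - 2 * (lam / 2)) powr (- 1 / 2))"
    proof (rule integral_le)
      have "continuous_on {lam / 2..\<sigma>0} m"
        unfolding m_def using integral_continuous_on_param[of "{lam / 2..\<sigma>0}" T "3 * T" "\<lambda>x t. norm (L (Complex x t))", OF cont']
        by simp
      then show "m integrable_on {lam / 2..\<sigma>0}" by (rule integrable_continuous_real)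
      have "(\<lambda>x. K * T * (2 * x - 2 * (lam / 2)) powr (- 1 / 2)) integrable_on {lam / 2..\<sigma>0}"
        using integral_inverse_sqrt[OF \<sigma>0] by (intro integrable_on_mult_right) (rule has_integral_integrable)
      then show "(\<lambda>x. if x = lam / 2 then m x else K * T * (2 * x - 2 * (lam / 2)) powr (- 1 / 2)) integrable_on {lam / 2..\<sigma>0}"
        by (rule integrable_spike_finite[of "{lam / 2}", rotated 2]) auto
      fix x assume "x \<in> {lam / 2..\<sigma>0}"
      then show "m x \<le> (if x = lam / 2 then m x else K * T * (2 * x - 2 * (lam / 2)) powr (- 1 / 2))"
        using K(2)[of x T] T by (auto simp: m_def)
    qed
    also have "\<dots> = integral {lam / 2..\<sigma>0} (\<lambda>x. K * T * (2 * x - 2 * (lam / 2)) powr (- 1 / 2))"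
      by (rule integral_spike[of "{lam / 2}"]) auto
    also have "\<dots> = K * T * sqrt (2 * \<sigma>0 - 2 * (lam / 2))"
      using integral_unique[OF integral_inverse_sqrt[OF \<sigma>0]] by simp
    also have "\<dots> \<le> (K * sqrt (2 * \<sigma>0 - lam) + 1) * T" using T by (simp add: algebra_simps)
    finally show "integral {T..3 * T} (\<lambda>t. integral {lam / 2..\<sigma>0} (\<lambda>x. norm (L (Complex x t)))) \<le> (K * sqrt (2 * \<sigma>0 - lam) + 1) * T" .
  qed
qed

end

section \<open>Short integrals of the Fourier transform\<close>

text \<open>Passes to the whole line from compact intervals, which is where
  \<open>fourier_bessel\<close> controls the square of \<open>box_hat\<close>.\<close>

lemma lborel_integral_le_of_truncations:
  fixes f :: "real \<Rightarrow> real"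
  assumes f: "integrable lborel f"
    and le: "\<And>n::nat. (LBINT v:{- real n..real n}. f v) \<le> B"
  shows "(LBINT v. f v) \<le> B"
proof -
  have [measurable]: "f \<in> borel_measurable borel" using f by auto
  have "(\<lambda>n. LBINT v. indicator {- real n..real n} v *\<^sub>R f v) \<longlonglongrightarrow> (LBINT v. f v)"
  proof (rule integral_dominated_convergence[where w = "\<lambda>v. norm (f v)"])
    show "AE v in lborel. (\<lambda>n. indicator {- real n..real n} v *\<^sub>R f v) \<longlonglongrightarrow> f v"
    proof (intro AE_I2)
      fix v :: real
      have "\<forall>\<^sub>F n in sequentially. indicator {- real n..real n} v *\<^sub>R f v = f v"
        using eventually_ge_at_top[of "nat \<lceil>\<bar>v\<bar>\<rceil>"]
        by eventually_elim (auto simp: indicator_def nat_le_iff ceiling_le_iff abs_le_iff)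
      then show "(\<lambda>n. indicator {- real n..real n} v *\<^sub>R f v) \<longlonglongrightarrow> f v"
        by (rule tendsto_eventually)
    qed
  qed (use f in \<open>auto simp: indicator_def\<close>)
  then show ?thesis
    by (rule LIMSEQ_le_const2) (use le in \<open>auto simp: set_lebesgue_integral_def\<close>)
qed

text \<open>For \<open>v \<noteq> 0\<close> this is \<open>(iexp (v * H) - 1) / (\<i> * v)\<close>.
  The integral form exhibits it as the Fourier transform of an interval, so that
  \<open>fourier_bessel\<close> bounds its square mean.\<close>

definition box_hat :: "real \<Rightarrow> real \<Rightarrow> complex" where
  "box_hat H v = (LBINT r. indicator {0..H} r * iexp (v * r))"

lemma integrable_indicator_Icc: "integrable lborel (indicator {a..b} :: real \<Rightarrow> real)"
  by (rule integrable_real_indicator) (auto simp: emeasure_lborel_Icc_eq)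

lemma box_hat:
  assumes H: "H > 0"
  shows "norm (box_hat H v) \<le> H" and "continuous_on A (box_hat H)"
    and "integral {- real n..real n} (\<lambda>v. (norm (box_hat H v))\<^sup>2) \<le> 2 * pi * exp (9 / 2) * H"
proof -
  have ir: "integrable lborel (\<lambda>r. indicator {0..H} r :: real)"
    by (rule integrable_indicator_Icc)
  have "(indicator {0..H} r :: complex) = of_real (indicator {0..H} r)" for r by (simp add: indicator_def)
  then have i: "integrable lborel (\<lambda>r. indicator {0..H} r :: complex)"
    using integrable_of_real[OF ir] by simp
  have sq: "(norm (indicator {0..H} r :: complex))\<^sup>2 = indicator {0..H} r" for r by (simp add: indicator_def)
  have nm: "norm (indicator {0..H} r :: complex) = indicator {0..H} r" for r by (simp add: indicator_def)
  have H': "(LBINT r. indicator {0..H} r) = H" using H by simp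
  show "norm (box_hat H v) \<le> H"
    using fourier_norm_le[OF i, of v] H by (simp add: box_hat_def nm)
  show "continuous_on A (box_hat H)" unfolding box_hat_def by (rule fourier_continuous[OF i])
  have "integral {- real n..real n} (\<lambda>v. (norm (box_hat H v))\<^sup>2)
      \<le> 2 * pi * exp (9 / 2) * (LBINT r. (norm (indicator {0..H} r :: complex))\<^sup>2)"
    \<comment> \<open>The width \<open>real n + 1\<close> instead of \<open>real n\<close> stays
      positive for \<open>n = 0\<close>.\<close>
    unfolding box_hat_def by (rule fourier_bessel[OF i, of "real n + 1"]) (use ir in \<open>auto simp: sq\<close>)
  then show "integral {- real n..real n} (\<lambda>v. (norm (box_hat H v))\<^sup>2) \<le> 2 * pi * exp (9 / 2) * H"
    unfolding sq H' .
qed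

text \<open>By Fubini, integrating a Fourier transform over a segment of frequencies multiplies the
  function by the transform of that segment.\<close>

lemma integral_shift_fourier:
  fixes g :: "real \<Rightarrow> complex"
  assumes g: "integrable lborel g"
  shows "integral {0..H} (\<lambda>r. LBINT v. g v * iexp ((t + r) * v)) =
           (LBINT v. (g v * box_hat H v) * iexp (t * v))"
proof -
  have [measurable]: "g \<in> borel_measurable borel" using g by auto
  have cont: "continuous_on {0..H} (\<lambda>r. LBINT v. g v * iexp ((t + r) * v))"
    by (rule continuous_on_compose2[OF fourier_continuous[OF g, of UNIV]]) (auto intro!: continuous_intros)
  have "integral {0..H} (\<lambda>r. LBINT v. g v * iexp ((t + r) * v)) =
        (LBINT r:{0..H}. LBINT v. g v * iexp ((t + r) * v))"
    using set_borel_integral_eq_integral(2)[OF borel_integrable_atLeastAtMost'[OF cont]] by simp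
  also have "\<dots> = (LBINT r. LBINT v. indicator {0..H} r * (g v * iexp ((t + r) * v)))"
    unfolding set_lebesgue_integral_def integral_mult_right_zero
    by (intro Bochner_Integration.integral_cong refl) (simp add: indicator_def)
  also have "\<dots> = (LBINT v. LBINT r. indicator {0..H} r * (g v * iexp ((t + r) * v)))"
  proof (rule lborel_pair.Fubini_integral[symmetric])
    show "integrable (lborel \<Otimes>\<^sub>M lborel) (\<lambda>(r, v). indicator {0..H} r * (g v * iexp ((t + r) * v)))"
      by (rule Bochner_Integration.integrable_bound[OF integrable_lborel_pair_times[OF integrable_indicator_Icc[of 0 H] integrable_norm[OF g]]])
         (auto simp: norm_mult indicator_def)
  qed
  also have "\<dots> = (LBINT v. (g v * box_hat H v) * iexp (t * v))"
  proof (intro Bochner_Integration.integral_cong refl)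
    fix v :: real
    have eq: "indicator {0..H} r * (g v * iexp ((t + r) * v)) =
          (g v * iexp (t * v)) * (indicator {0..H} r * iexp (v * r))" for r
      by (simp add: ring_distribs exp_add mult_ac)
    show "(LBINT r. indicator {0..H} r * (g v * iexp ((t + r) * v))) =
       (g v * box_hat H v) * iexp (t * v)"
      unfolding box_hat_def eq integral_mult_right_zero by (simp only: mult_ac)
  qed
  finally show ?thesis .
qed

section \<open>Square mean and sign of short integrals on the critical line\<close>

context twisted_form
begin

text \<open>On the critical line the weight \<open>exp (lam / 2 * v)\<close> cancels the Hecke bound
  exactly, so the estimate is uniform in \<open>v\<close>.\<close>

lemma ray_norm_le_critical:
  "\<exists>M>0. \<forall>\<theta> v. \<bar>\<theta>\<bar> < pi / 2 \<longrightarrow> norm (ray \<theta> (lam / 2) v) \<le> M * cos \<theta> powr (- (lam / 2))"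
proof -
  obtain M where M: "M > 0" "\<And>\<theta> v. \<bar>\<theta>\<bar> < pi / 2 \<Longrightarrow>
      norm (F (exp (Complex v \<theta>))) \<le> M * cos \<theta> powr (- (lam / 2)) * exp (- (lam / 2 * v))"
    using ray_bound[of "lam / 2"] by auto
  show ?thesis
  proof (intro exI[of _ M] conjI allI impI M)
    fix \<theta> v :: real assume \<theta>: "\<bar>\<theta>\<bar> < pi / 2"
    have "norm (ray \<theta> (lam / 2) v) \<le> M * cos \<theta> powr (- (lam / 2)) * exp (- (lam / 2 * v)) * exp (lam / 2 * v)"
      unfolding ray_def norm_mult using M(2)[OF \<theta>, of v] by (simp add: mult_right_mono)
    also have "\<dots> = M * cos \<theta> powr (- (lam / 2))"
      unfolding mult.assoc exp_add[symmetric] by simp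
    finally show "norm (ray \<theta> (lam / 2) v) \<le> M * cos \<theta> powr (- (lam / 2))" .
  qed
qed

definition short :: "real \<Rightarrow> real \<Rightarrow> real \<Rightarrow> complex" where
  "short \<theta> H t = integral {0..H} (\<lambda>r. hat \<theta> (lam / 2) (t + r))"

lemma short_cont:
  assumes "\<bar>\<theta>\<bar> < pi / 2"
  shows "continuous_on A (short \<theta> H)"
proof -
  have "continuous_on (A \<times> cbox 0 H) (\<lambda>p. hat \<theta> (lam / 2) (fst p + snd p))"
    by (rule continuous_on_compose2[OF hat_cont[OF assms, of UNIV]]) (auto intro!: continuous_intros)
  then show ?thesis
    unfolding short_def using integral_continuous_on_param[of A 0 H "\<lambda>t r. hat \<theta> (lam / 2) (t + r)"]
    by (simp add: case_prod_unfold)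
qed

text \<open>The ray is estimated by its supremum, of order \<open>T powr (lam / 2)\<close>, and the
  square integral is carried by \<open>box_hat\<close>, of order \<open>H\<close>. Hence the bound
  is linear in \<open>H\<close> and free of logarithms.\<close>

lemma short_square_mean:
  "\<exists>K>0. \<forall>T H. 1 \<le> T \<longrightarrow> 0 < H \<longrightarrow>
     integral {T..2 * T} (\<lambda>t. (norm (short (tilt_angle T) H t))\<^sup>2) \<le> K * H * T powr lam"
proof -
  obtain M where M: "M > 0" "\<And>\<theta> v. \<bar>\<theta>\<bar> < pi / 2 \<Longrightarrow>
      norm (ray \<theta> (lam / 2) v) \<le> M * cos \<theta> powr (- (lam / 2))"
    using ray_norm_le_critical by blast
  define b where "b = 2 * pi * exp (9 / 2 :: real)"
  have b: "b > 0" by (simp add: b_def)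
  show ?thesis
  proof (intro exI[of _ "b * (M\<^sup>2 * 2 powr lam * b)"] conjI allI impI)
    show "b * (M\<^sup>2 * 2 powr lam * b) > 0" using b M by simp
    fix T H :: real assume T: "1 \<le> T" and H: "0 < H"
    note \<theta> = tilt_angle[OF T]
    define g where "g v = ray (tilt_angle T) (lam / 2) v * box_hat H v" for v
    define S where "S = M * cos (tilt_angle T) powr (- (lam / 2))"
    have ri: "integrable lborel (ray (tilt_angle T) (lam / 2))" "integrable lborel (\<lambda>v. (norm (ray (tilt_angle T) (lam / 2) v))\<^sup>2)"
      using ray_integrable[OF \<theta>(1)] by auto
    have [measurable]: "ray (tilt_angle T) (lam / 2) \<in> borel_measurable borel" "box_hat H \<in> borel_measurable borel"
      using ray_cont[OF \<theta>(1)] box_hat(2)[OF H] by (auto intro: borel_measurable_continuous_onI)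
    have [measurable]: "g \<in> borel_measurable borel" unfolding g_def[abs_def] by measurable
    have gi: "integrable lborel g"
    proof (rule Bochner_Integration.integrable_bound)
      show "integrable lborel (\<lambda>v. norm (ray (tilt_angle T) (lam / 2) v) * H)" using ri by simp
      show "AE v in lborel. norm (g v) \<le> norm (norm (ray (tilt_angle T) (lam / 2) v) * H)"
        using H box_hat(1)[OF H] by (auto simp: g_def norm_mult intro!: AE_I2 mult_left_mono)
    qed simp
    have g2i: "integrable lborel (\<lambda>v. (norm (g v))\<^sup>2)"
    proof (rule Bochner_Integration.integrable_bound)
      show "integrable lborel (\<lambda>v. (norm (ray (tilt_angle T) (lam / 2) v))\<^sup>2 * H\<^sup>2)" using ri by simp
      show "AE v in lborel. norm ((norm (g v))\<^sup>2) \<le> norm ((norm (ray (tilt_angle T) (lam / 2) v))\<^sup>2 * H\<^sup>2)"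
        using H box_hat(1)[OF H] by (auto simp: g_def norm_mult power_mult_distrib intro!: AE_I2 mult_left_mono power_mono)
    qed simp
    have "(LBINT v. (norm (g v))\<^sup>2) \<le> S\<^sup>2 * (b * H)"
    proof (rule lborel_integral_le_of_truncations[OF g2i])
      fix n :: nat
      have c1: "continuous_on {- real n..real n} (\<lambda>v. (norm (g v))\<^sup>2)"
        unfolding g_def by (intro continuous_intros box_hat H continuous_on_subset[OF ray_cont[OF \<theta>(1)]]) auto
      have "(LBINT v:{- real n..real n}. (norm (g v))\<^sup>2) = integral {- real n..real n} (\<lambda>v. (norm (g v))\<^sup>2)"
        by (rule set_borel_integral_eq_integral(2)[OF borel_integrable_atLeastAtMost'[OF c1]])
      also have "\<dots> \<le> integral {- real n..real n} (\<lambda>v. S\<^sup>2 * (norm (box_hat H v))\<^sup>2)"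
      proof (rule integral_le)
        show "(\<lambda>v. (norm (g v))\<^sup>2) integrable_on {- real n..real n}" by (rule integrable_continuous_real[OF c1])
        show "(\<lambda>v. S\<^sup>2 * (norm (box_hat H v))\<^sup>2) integrable_on {- real n..real n}"
          by (intro integrable_continuous_real continuous_intros box_hat H)
        show "(norm (g v))\<^sup>2 \<le> S\<^sup>2 * (norm (box_hat H v))\<^sup>2" for v
        proof -
          have "(norm (ray (tilt_angle T) (lam / 2) v))\<^sup>2 \<le> S\<^sup>2"
            unfolding S_def by (intro power_mono M \<theta>) auto
          then show ?thesis by (simp add: g_def norm_mult power_mult_distrib mult_right_mono)
        qed
      qed
      also have "\<dots> = S\<^sup>2 * integral {- real n..real n} (\<lambda>v. (norm (box_hat H v))\<^sup>2)" by simp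
      also have "\<dots> \<le> S\<^sup>2 * (b * H)" unfolding b_def by (intro mult_left_mono box_hat H) auto
      finally show "(LBINT v:{- real n..real n}. (norm (g v))\<^sup>2) \<le> S\<^sup>2 * (b * H)" .
    qed
    moreover have "S\<^sup>2 \<le> M\<^sup>2 * (2 powr lam * T powr lam)"
    proof -
      have "S\<^sup>2 = M\<^sup>2 * cos (tilt_angle T) powr (- lam)"
        unfolding S_def power_mult_distrib using \<theta> T by (simp add: power2_eq_square flip: powr_add)
      also have "\<dots> \<le> M\<^sup>2 * (1 / (2 * T)) powr (- lam)"
        using \<theta> T lam by (intro mult_left_mono powr_mono2') auto
      also have "(1 / (2 * T)) powr (- lam) = 2 powr lam * T powr lam"
        using T by (simp add: powr_minus powr_divide powr_mult field_simps)
      finally show ?thesis .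
    qed
    ultimately have g2: "(LBINT v. (norm (g v))\<^sup>2) \<le> M\<^sup>2 * (2 powr lam * T powr lam) * (b * H)"
      using b H by (meson mult_right_mono order.trans mult_nonneg_nonneg less_imp_le)
    have "short (tilt_angle T) H t = (LBINT v. g v * iexp (t * v))" for t
      unfolding short_def hat_def g_def by (rule integral_shift_fourier[OF ri(1)])
    then have "integral {T..2 * T} (\<lambda>t. (norm (short (tilt_angle T) H t))\<^sup>2) \<le> b * (LBINT v. (norm (g v))\<^sup>2)"
      unfolding b_def using fourier_bessel[OF gi g2i, of T T "2 * T"] T by simp
    also have "\<dots> \<le> b * (M\<^sup>2 * (2 powr lam * T powr lam) * (b * H))"
      using b by (intro mult_left_mono g2) auto
    finally show "integral {T..2 * T} (\<lambda>t. (norm (short (tilt_angle T) H t))\<^sup>2) \<le> b * (M\<^sup>2 * 2 powr lam * b) * H * T powr lam"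
      by (simp add: mult_ac)
  qed
qed

text \<open>Equality of \<open>Lam \<theta>\<close> and \<open>Lam 0\<close>, rewritten for Fourier
  transforms. The rotation introduces only a positive factor and a phase independent of
  \<open>t\<close>, so it preserves constancy of sign.\<close>

lemma hat_rotate:
  assumes \<theta>: "\<bar>\<theta>\<bar> < pi / 2" and \<sigma>: "\<sigma> > 0"
  shows "hat 0 \<sigma> t * of_real (exp (\<theta> * t)) = iexp (\<theta> * \<sigma>) * hat \<theta> \<sigma> t"
proof -
  have "Complex \<sigma> t \<notin> \<int>\<^sub>\<le>\<^sub>0" using \<sigma> by (auto elim!: nonpos_Ints_cases simp: complex_eq_iff)
  then have "rGamma (Complex \<sigma> t) \<noteq> 0" by (simp add: rGamma_eq_zero_iff)
  moreover have "of_real \<alpha> powr Complex \<sigma> t \<noteq> 0" using \<alpha> by simp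
  moreover have "of_real \<alpha> powr Complex \<sigma> t * rGamma (Complex \<sigma> t) * Lam \<theta> (Complex \<sigma> t) =
        of_real \<alpha> powr Complex \<sigma> t * rGamma (Complex \<sigma> t) * Lam 0 (Complex \<sigma> t)"
    using Lam_eq_L[OF \<theta>] Lam_eq_L[of 0] by simp
  ultimately have "Lam \<theta> (Complex \<sigma> t) = Lam 0 (Complex \<sigma> t)" by simp
  then have "iexp (\<theta> * \<sigma>) * of_real (exp (- (\<theta> * t))) * hat \<theta> \<sigma> t = hat 0 \<sigma> t"
    unfolding Lam_fourier hat_def ray_def by simp
  then have "hat 0 \<sigma> t * of_real (exp (\<theta> * t)) =
      iexp (\<theta> * \<sigma>) * hat \<theta> \<sigma> t * (of_real (exp (- (\<theta> * t))) * of_real (exp (\<theta> * t)))"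
    unfolding \<open>_ = hat 0 \<sigma> t\<close>[symmetric] by (simp only: mult_ac)
  also have "of_real (exp (- (\<theta> * t))) * of_real (exp (\<theta> * t)) = (1 :: complex)"
    unfolding of_real_mult[symmetric] exp_add[symmetric] by simp
  finally show ?thesis by simp
qed

lemma L_critical_zero_iff: "L (Complex (lam / 2) t) = 0 \<longleftrightarrow> hat 0 (lam / 2) t = 0"
proof -
  have "Complex (lam / 2) t \<notin> \<int>\<^sub>\<le>\<^sub>0" using lam by (auto elim!: nonpos_Ints_cases simp: complex_eq_iff)
  then have "rGamma (Complex (lam / 2) t) \<noteq> 0" by (simp add: rGamma_eq_zero_iff)
  then show ?thesis
    using norm_L_eq[of 0 "lam / 2" t] \<alpha> by (metis abs_zero exp_not_eq_zero mult_eq_0_iff norm_eq_zero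
        norm_zero pi_half_gt_zero powr_eq_0_iff less_irrefl)
qed

text \<open>Reflecting \<open>v\<close> to \<open>- v\<close> applies \<open>inversion\<close> on
  the positive reals; exactly at \<open>\<sigma> = lam / 2\<close> the weights
  \<open>exp (lam * v)\<close> and \<open>exp (- (lam / 2 * v))\<close> combine to the original
  one.\<close>

lemma hat_functional_equation: "hat 0 (lam / 2) t = C * cnj (hat 0 (lam / 2) t)"
proof -
  have E: "exp (Complex v 0) = of_real (exp v)" for v
    by (simp add: Complex_conv exp_of_real)
  have refl: "ray 0 (lam / 2) (0 + - 1 * v) = C * cnj (ray 0 (lam / 2) v)" for v
  proof -
    have "F (of_real (exp (- v))) = C * of_real (exp (lam * v)) * cnj (F (of_real (exp v)))"
      using inversion[of "exp v"] by (simp add: exp_minus exp_powr_real inverse_eq_divide mult.commute)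
    moreover have "exp (lam * v) * exp (- (lam / 2 * v)) = exp (lam / 2 * v)"
      unfolding exp_add[symmetric] by simp
    then have "complex_of_real (exp (lam * v)) * of_real (exp (- (lam / 2 * v))) = of_real (exp (lam / 2 * v))"
      by (metis of_real_mult)
    ultimately show ?thesis unfolding ray_def by (simp add: E mult_ac del: of_real_mult)
  qed
  have "hat 0 (lam / 2) t = \<bar>- 1\<bar> *\<^sub>R (LBINT v. ray 0 (lam / 2) (0 + - 1 * v) * iexp (t * (0 + - 1 * v)))"
    unfolding hat_def by (rule lborel_integral_real_affine) simp
  also have "\<dots> = (LBINT v. C * cnj (ray 0 (lam / 2) v * iexp (t * v)))"
    unfolding refl by (simp add: exp_cnj mult_ac)
  also have "\<dots> = C * cnj (hat 0 (lam / 2) t)"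
    unfolding hat_def integral_mult_right_zero Bochner_Integration.integral_cnj ..
  finally show ?thesis .
qed

text \<open>By the functional equation the Fourier transform is real up to a constant phase, so it
  does not oscillate on an interval free of zeros.\<close>

lemma norm_short_eq:
  assumes \<theta>: "\<bar>\<theta>\<bar> < pi / 2" and H: "H \<ge> 0"
    and nz: "\<And>r. r \<in> {0..H} \<Longrightarrow> hat 0 (lam / 2) (t + r) \<noteq> 0"
  shows "norm (short \<theta> H t) = integral {0..H} (\<lambda>r. norm (hat \<theta> (lam / 2) (t + r)))"
proof -
  have C0: "C \<noteq> 0" using C by auto
  \<comment> \<open>Half the phase of \<open>C\<close>, inverted: \<open>cnj w = w * C\<close>, so
    multiplication by \<open>w\<close> turns the functional equation into invariance under
    conjugation.\<close>
  define w where "w = csqrt (1 / C)"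
  have w2: "w * w * C = 1" unfolding w_def using C0 by (simp flip: power2_eq_square)
  have wn: "norm w = 1"
  proof -
    have "norm w * norm w = 1" using arg_cong[OF w2, of norm] C by (simp add: norm_mult)
    then show ?thesis by (metis abs_norm_cancel abs_1 power2_eq_square power2_eq_1_iff norm_ge_zero abs_of_nonneg real_sqrt_abs2 real_sqrt_one)
  qed
  have wcnj: "cnj w = w * C"
  proof -
    have "w * cnj w = 1" using wn by (simp add: complex_norm_square[symmetric])
    then have "w * cnj w = w * (w * C)" using w2 by (simp add: mult_ac)
    moreover have "w \<noteq> 0" using wn by auto
    ultimately show ?thesis by simp
  qed
  have real: "w * hat 0 (lam / 2) u = of_real (Re (w * hat 0 (lam / 2) u))" for u
  proof -
    have "cnj (w * hat 0 (lam / 2) u) = w * (C * cnj (hat 0 (lam / 2) u))"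
      by (simp add: wcnj)
    also have "\<dots> = w * hat 0 (lam / 2) u" using hat_functional_equation[of u] by simp
    finally show ?thesis by (metis Reals_cnj_iff of_real_Re)
  qed
  \<comment> \<open>The rotated transform up to the constant phase \<open>e\<close>: a continuous
    real function without zeros on the segment, hence of constant sign.\<close>
  define \<rho> where "\<rho> r = exp (\<theta> * (t + r)) * Re (w * hat 0 (lam / 2) (t + r))" for r
  define e where "e = w * iexp (\<theta> * (lam / 2))"
  have en: "norm e = 1" by (simp add: e_def norm_mult wn)
  have \<rho>: "e * hat \<theta> (lam / 2) (t + r) = of_real (\<rho> r)" for r
  proof -
    have "e * hat \<theta> (lam / 2) (t + r) = w * (hat 0 (lam / 2) (t + r) * of_real (exp (\<theta> * (t + r))))"
      using hat_rotate[OF \<theta>, of "lam / 2" "t + r"] lam by (simp add: e_def mult.assoc)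
    also have "\<dots> = of_real (exp (\<theta> * (t + r))) * of_real (Re (w * hat 0 (lam / 2) (t + r)))"
      using real[of "t + r"] by (simp add: mult_ac)
    finally show ?thesis by (simp add: \<rho>_def)
  qed
  have \<rho>n: "norm (hat \<theta> (lam / 2) (t + r)) = \<bar>\<rho> r\<bar>" for r
    using arg_cong[OF \<rho>[of r], of norm] en by (simp add: norm_mult)
  have \<rho>0: "\<rho> r \<noteq> 0" if "r \<in> {0..H}" for r
  proof
    assume "\<rho> r = 0"
    then have "Re (w * hat 0 (lam / 2) (t + r)) = 0" by (simp add: \<rho>_def)
    then have "w * hat 0 (lam / 2) (t + r) = 0" using real[of "t + r"] by simp
    then show False using nz[OF that] wn by auto
  qed
  have hc: "continuous_on {0..H} (\<lambda>r. hat \<theta> (lam / 2) (t + r))" if "\<bar>\<theta>\<bar> < pi / 2" for \<theta>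
    by (rule continuous_on_compose2[OF hat_cont[OF that, of UNIV]]) (auto intro!: continuous_intros)
  have \<rho>c: "continuous_on {0..H} \<rho>"
    unfolding \<rho>_def by (intro continuous_intros hc) auto
  have "e * short \<theta> H t = integral {0..H} (\<lambda>r. of_real (\<rho> r))"
    unfolding short_def \<rho>[symmetric] by simp
  also have "\<dots> = of_real (integral {0..H} \<rho>)"
    using has_integral_of_real[OF integrable_integral[OF integrable_continuous_real[OF \<rho>c]]]
    by (rule integral_unique)
  finally have "norm (short \<theta> H t) = \<bar>integral {0..H} \<rho>\<bar>"
    using en by (metis mult_1 norm_mult norm_of_real)
  also have "\<dots> = integral {0..H} (\<lambda>r. \<bar>\<rho> r\<bar>)"
  proof -
    have "(\<forall>r\<in>{0..H}. \<rho> r > 0) \<or> (\<forall>r\<in>{0..H}. \<rho> r < 0)"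
    proof (rule ccontr)
      assume "\<not> ?thesis"
      then obtain r1 r2 where r: "r1 \<in> {0..H}" "r2 \<in> {0..H}" "\<rho> r1 < 0" "\<rho> r2 > 0"
        using \<rho>0 by (metis linorder_neqE_linordered_idom)
      have "connected (\<rho> ` {0..H})" by (intro connected_continuous_image \<rho>c) auto
      then have "0 \<in> \<rho> ` {0..H}"
        by (rule connectedD_interval[of _ "\<rho> r1" "\<rho> r2"]) (use r in auto)
      then show False using \<rho>0 by auto
    qed
    then show ?thesis
    proof
      assume p: "\<forall>r\<in>{0..H}. \<rho> r > 0"
      then have "integral {0..H} (\<lambda>r. \<bar>\<rho> r\<bar>) = integral {0..H} \<rho>"
        by (intro integral_cong) (metis abs_of_pos)
      moreover have "integral {0..H} \<rho> \<ge> 0"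
        by (intro integral_nonneg integrable_continuous_real \<rho>c) (metis p less_imp_le)
      ultimately show ?thesis by simp
    next
      assume p: "\<forall>r\<in>{0..H}. \<rho> r < 0"
      then have "integral {0..H} (\<lambda>r. \<bar>\<rho> r\<bar>) = integral {0..H} (\<lambda>r. - \<rho> r)"
        by (intro integral_cong) (metis abs_of_neg)
      moreover have "integral {0..H} (\<lambda>r. - \<rho> r) \<ge> 0"
        by (intro integral_nonneg integrable_continuous_real continuous_intros \<rho>c) (metis p neg_0_le_iff_le less_imp_le)
      ultimately show ?thesis by simp
    qed
  qed
  finally show ?thesis unfolding \<rho>n .
qed

end

section \<open>Lower bounds for short integrals\<close>

context twisted_form
begin

text \<open>\<open>m\<close> is the least index with \<open>b m \<noteq> 0\<close>. After
  multiplication by \<open>of_nat m powr s\<close> every later term carries a ratio of at most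
  \<open>q = m / (m + 1)\<close>, so the remainder decays like \<open>q powr Re s\<close>, uniformly
  in \<open>Im s\<close>.\<close>

lemma leading_coefficient:
  "\<exists>m c. m \<ge> 1 \<and> c \<noteq> 0 \<and> (\<forall>e>0. \<exists>\<sigma>0\<ge>lam / 2. \<forall>s. Re s = \<sigma>0 \<longrightarrow> norm (of_nat m powr s * L s - c) \<le> e)"
proof -
  define m where "m = (LEAST n. n \<ge> 1 \<and> b n \<noteq> 0)"
  have m: "m \<ge> 1" "b m \<noteq> 0"
    using LeastI_ex[OF nontrivial] by (auto simp: m_def)
  have lt_m: "b n = 0" if "n \<ge> 1" "n < m" for n
    using not_less_Least[of n "\<lambda>n. n \<ge> 1 \<and> b n \<noteq> 0"] that by (auto simp: m_def)
  define \<sigma>1 where "\<sigma>1 = lam / 2 + 2"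
  define u where "u n = norm (b (Suc n)) * real (Suc n) powr (- \<sigma>1)" for n
  have u: "summable u" unfolding u_def by (rule dirichlet_summable) (simp add: \<sigma>1_def)
  define q where "q = real m / real (Suc m)"
  have q: "0 < q" "q < 1" using m by (auto simp: q_def)
  have est: "norm (of_nat m powr s * L s - b m) \<le> q powr (Re s - \<sigma>1) * (real m powr \<sigma>1 * suminf u)"
    if s: "Re s \<ge> \<sigma>1" for s
  proof -
    have s': "Re s > lam / 2 + 1" using s by (simp add: \<sigma>1_def)
    \<comment> \<open>Index \<open>n\<close> stands for the coefficient \<open>Suc n\<close>, so the
      leading term sits at \<open>n = m - 1\<close>.\<close>
    define d where "d n = of_nat m powr s * (b (Suc n) * of_nat (Suc n) powr (- s)) - (if n = m - 1 then b m else 0)" for n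
    have "(\<lambda>n. b (Suc n) * of_nat (Suc n) powr (- s)) sums L s"
      using L_sums[of 0 s] s' by (simp add: L_def)
    moreover have "(\<lambda>n. if n = m - 1 then b m else 0) sums b m"
      by (rule sums_single)
    ultimately have ds: "d sums (of_nat m powr s * L s - b m)"
      unfolding d_def by (intro sums_diff sums_mult)
    have dle: "norm (d n) \<le> q powr (Re s - \<sigma>1) * (real m powr \<sigma>1 * u n)" for n
    proof (cases "n < m")
      case True
      have "d n = 0"
      proof (cases "n = m - 1")
        case True
        then have "Suc n = m" using m by simp
        then show ?thesis using True m by (simp add: d_def powr_minus)
      next
        case False
        then show ?thesis using \<open>n < m\<close> lt_m[of "Suc n"] by (simp add: d_def)
      qed
      then show ?thesis using q by (auto simp: u_def intro!: mult_nonneg_nonneg)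
    next
      case False
      then have n: "Suc n \<ge> Suc m" "n \<noteq> m - 1" using m by auto
      have "real m / real (Suc n) \<le> q" unfolding q_def using n by (intro divide_left_mono) auto
      then have "(real m / real (Suc n)) powr (Re s - \<sigma>1) \<le> q powr (Re s - \<sigma>1)"
        using s by (intro powr_mono2) auto
      then have le: "real m powr (Re s - \<sigma>1) / real (Suc n) powr (Re s - \<sigma>1) \<le> q powr (Re s - \<sigma>1)"
        by (simp add: powr_divide)
      have "norm (d n) = real m powr Re s * (norm (b (Suc n)) * real (Suc n) powr (- Re s))"
        using n(2) m norm_powr_real_powr[of "complex_of_real (real (Suc n))" "- s"] norm_powr_real_powr[of "complex_of_real (real m)" s]
        by (simp add: d_def norm_mult)
      also have "real m powr Re s = real m powr (Re s - \<sigma>1) * real m powr \<sigma>1"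
        by (simp flip: powr_add)
      also have "real (Suc n) powr (- Re s) = real (Suc n) powr (- \<sigma>1) / real (Suc n) powr (Re s - \<sigma>1)"
        by (simp flip: powr_diff)
      finally have "norm (d n) = real m powr (Re s - \<sigma>1) / real (Suc n) powr (Re s - \<sigma>1) * (real m powr \<sigma>1 * u n)"
        by (simp add: u_def)
      also have "\<dots> \<le> q powr (Re s - \<sigma>1) * (real m powr \<sigma>1 * u n)"
        by (intro mult_right_mono le) (auto simp: u_def)
      finally show ?thesis .
    qed
    have su: "summable (\<lambda>n. q powr (Re s - \<sigma>1) * (real m powr \<sigma>1 * u n))"
      using u by (intro summable_mult)
    have sd: "summable (\<lambda>n. norm (d n))"
      by (rule summable_comparison_test'[OF su]) (use dle in auto)
    have "norm (suminf d) \<le> (\<Sum>n. q powr (Re s - \<sigma>1) * (real m powr \<sigma>1 * u n))"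
      by (rule order.trans[OF summable_norm[OF sd] suminf_le[OF dle sd su]])
    then show ?thesis
      using ds u by (simp add: sums_iff suminf_mult summable_mult)
  qed
  show ?thesis
  proof (intro exI[of _ m] exI[of _ "b m"] conjI m allI impI)
    fix e :: real assume e: "e > 0"
    have "((\<lambda>x. q powr (x - \<sigma>1) * (real m powr \<sigma>1 * suminf u)) \<longlongrightarrow> 0 * (real m powr \<sigma>1 * suminf u)) at_top"
    proof (intro tendsto_intros)
      have "((\<lambda>x. exp (ln q * (x - \<sigma>1))) \<longlongrightarrow> 0) at_top"
      proof (rule filterlim_compose[OF exp_at_bot])
        have "filterlim (\<lambda>x. x - \<sigma>1) at_top at_top"
          using filterlim_tendsto_add_at_top[OF tendsto_const[of "- \<sigma>1"] filterlim_ident] by simp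
        then show "filterlim (\<lambda>x. ln q * (x - \<sigma>1)) at_bot at_top"
          using q by (subst filterlim_tendsto_neg_mult_at_bot_iff[OF tendsto_const]) auto
      qed
      then show "((\<lambda>x. q powr (x - \<sigma>1)) \<longlongrightarrow> 0) at_top"
        using q by (simp add: powr_def mult.commute)
    qed
    then have "\<forall>\<^sub>F x in at_top. q powr (x - \<sigma>1) * (real m powr \<sigma>1 * suminf u) < e"
      using e by (intro order_tendstoD(2)[where y = "0 * (real m powr \<sigma>1 * suminf u)"]) auto
    then have "\<forall>\<^sub>F x in at_top. q powr (x - \<sigma>1) * (real m powr \<sigma>1 * suminf u) < e \<and> x \<ge> \<sigma>1"
      using eventually_ge_at_top by (rule eventually_conj)
    then obtain x where x: "q powr (x - \<sigma>1) * (real m powr \<sigma>1 * suminf u) < e" "x \<ge> \<sigma>1"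
      by (metis (mono_tags, lifting) eventually_happens trivial_limit_at_top_linorder)
    show "\<exists>\<sigma>0\<ge>lam / 2. \<forall>s. Re s = \<sigma>0 \<longrightarrow> norm (of_nat m powr s * L s - b m) \<le> e"
    proof (intro exI[of _ x] conjI allI impI)
      show "lam / 2 \<le> x" using x by (simp add: \<sigma>1_def)
      fix s assume "Re s = x"
      then show "norm (of_nat m powr s * L s - b m) \<le> e" using est[of s] x by simp
    qed
  qed
qed

lemma L_nonzero: "\<exists>s. L s \<noteq> 0"
proof -
  obtain m c where mc: "c \<noteq> 0" "\<And>e. e > 0 \<Longrightarrow> \<exists>\<sigma>0\<ge>lam / 2. \<forall>s. Re s = \<sigma>0 \<longrightarrow> norm (of_nat m powr s * L s - c) \<le> e"
    using leading_coefficient by blast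
  obtain \<sigma>0 where "\<And>s. Re s = \<sigma>0 \<Longrightarrow> norm (of_nat m powr s * L s - c) \<le> norm c / 2"
    using mc(2)[of "norm c / 2"] mc(1) by auto
  from this[of "of_real \<sigma>0"] have "norm (of_nat m powr of_real \<sigma>0 * L (of_real \<sigma>0) - c) \<le> norm c / 2"
    by simp
  then have "L (of_real \<sigma>0) \<noteq> 0" using mc(1) by auto
  then show ?thesis by blast
qed

definition strip :: "real \<Rightarrow> real \<Rightarrow> real" where
  "strip \<sigma>0 t = integral {lam / 2..\<sigma>0} (\<lambda>x. norm (L (Complex x t)))"

text \<open>Moving the segment of integration from the critical line to a line where the leading term
  of the Dirichlet series dominates costs two horizontal integrals.\<close>

lemma critical_integral_lower:
  "\<exists>h>0. \<exists>c>0. \<exists>\<sigma>0\<ge>lam / 2. \<forall>t H. H \<ge> 0 \<longrightarrow>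
     h * H \<le> c * (integral {0..H} (\<lambda>r. norm (L (Complex (lam / 2) (t + r)))) + strip \<sigma>0 t + strip \<sigma>0 (t + H))"
proof -
  obtain m a where m: "m \<ge> 1" and a: "a \<noteq> 0"
    and ma: "\<And>e. e > 0 \<Longrightarrow> \<exists>\<sigma>0\<ge>lam / 2. \<forall>s. Re s = \<sigma>0 \<longrightarrow> norm (of_nat m powr s * L s - a) \<le> e"
    using leading_coefficient by blast
  \<comment> \<open>An error of at most \<open>h\<close> against the leading coefficient of size
    \<open>2 * h\<close> leaves at least \<open>h\<close> per unit length.\<close>
  define h where "h = norm a / 2"
  have h: "h > 0" using a by (simp add: h_def)
  obtain \<sigma>0 where \<sigma>0: "\<sigma>0 \<ge> lam / 2" and dom: "\<And>s. Re s = \<sigma>0 \<Longrightarrow> norm (of_nat m powr s * L s - a) \<le> h"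
    using ma[OF h] by blast
  \<comment> \<open>The factor \<open>of_nat m powr s\<close> removes the oscillation of the leading
    term, whose integral over a vertical segment then grows like the length.\<close>
  define D where "D s = of_nat m powr s * L s" for s
  have Dhol: "D holomorphic_on UNIV"
    unfolding D_def using m by (intro holomorphic_intros L_holomorphic) auto
  have Dn: "norm (D (Complex x t)) = real m powr x * norm (L (Complex x t))" for x t
    using norm_powr_real_powr[of "complex_of_real (real m)" "Complex x t"] by (simp add: D_def norm_mult)
  have Dc: "continuous_on A (\<lambda>y. D (Complex (p y) (r y)))" if "continuous_on A p" "continuous_on A r"
    for A :: "real set" and p r
    by (rule continuous_on_compose2[OF holomorphic_on_imp_continuous_on[OF Dhol]])
       (use that in \<open>auto simp: Complex_conv intro!: continuous_intros\<close>)
  \<comment> \<open>With a primitive, Cauchy's theorem for the rectangle becomes a telescoping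
    identity between the values of \<open>P\<close> at the four corners.\<close>
  obtain P where P: "\<And>s. (P has_field_derivative D s) (at s)"
    using holomorphic_convex_primitive'[of UNIV D] Dhol by auto
  have vert: "((\<lambda>r. \<i> * D (Complex x (t + r))) has_integral P (Complex x (t + H)) - P (Complex x t)) {0..H}"
    if "H \<ge> 0" for x t H
  proof -
    have "((\<lambda>r. \<i> * D (Complex x (t + r))) has_integral P (Complex x (t + H)) - P (Complex x (t + 0))) {0..H}"
    proof (rule fundamental_theorem_of_calculus[OF that])
      fix r
      have "((\<lambda>r. Complex x (t + r)) has_vector_derivative \<i>) (at r within {0..H})"
        unfolding Complex_conv by (auto intro!: derivative_eq_intros)
      from field_vector_diff_chain_within[OF this has_field_derivative_at_within[OF P]]
      show "((\<lambda>r. P (Complex x (t + r))) has_vector_derivative \<i> * D (Complex x (t + r))) (at r within {0..H})"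
        by (simp add: comp_def)
    qed
    then show ?thesis by simp
  qed
  have horiz: "norm (P (Complex \<sigma>0 t) - P (Complex (lam / 2) t)) \<le> real m powr \<sigma>0 * strip \<sigma>0 t" for t
  proof -
    have hi: "((\<lambda>x. D (Complex x t)) has_integral P (Complex \<sigma>0 t) - P (Complex (lam / 2) t)) {lam / 2..\<sigma>0}"
    proof (rule fundamental_theorem_of_calculus[OF \<sigma>0])
      fix x
      have "((\<lambda>x. Complex x t) has_vector_derivative 1) (at x within {lam / 2..\<sigma>0})"
        unfolding Complex_conv by (auto intro!: derivative_eq_intros)
      from field_vector_diff_chain_within[OF this has_field_derivative_at_within[OF P]]
      show "((\<lambda>x. P (Complex x t)) has_vector_derivative D (Complex x t)) (at x within {lam / 2..\<sigma>0})"
        by (simp add: comp_def)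
    qed
    have Lc: "continuous_on {lam / 2..\<sigma>0} (\<lambda>x. norm (L (Complex x t)))"
      by (intro continuous_intros continuous_on_compose2[OF holomorphic_on_imp_continuous_on[OF L_holomorphic[of UNIV]]])
         (auto simp: Complex_conv intro!: continuous_intros)
    have "norm (P (Complex \<sigma>0 t) - P (Complex (lam / 2) t)) = norm (integral {lam / 2..\<sigma>0} (\<lambda>x. D (Complex x t)))"
      using integral_unique[OF hi] by simp
    also have "\<dots> \<le> integral {lam / 2..\<sigma>0} (\<lambda>x. real m powr \<sigma>0 * norm (L (Complex x t)))"
    proof (rule Henstock_Kurzweil_Integration.integral_norm_bound_integral)
      show "(\<lambda>x. D (Complex x t)) integrable_on {lam / 2..\<sigma>0}" using hi by (rule has_integral_integrable)
      show "(\<lambda>x. real m powr \<sigma>0 * norm (L (Complex x t))) integrable_on {lam / 2..\<sigma>0}"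
        by (intro integrable_continuous_real continuous_intros Lc)
      show "norm (D (Complex x t)) \<le> real m powr \<sigma>0 * norm (L (Complex x t))" if "x \<in> {lam / 2..\<sigma>0}" for x
        unfolding Dn using that m by (intro mult_right_mono powr_mono) auto
    qed
    also have "\<dots> = real m powr \<sigma>0 * strip \<sigma>0 t" unfolding strip_def by simp
    finally show ?thesis .
  qed
  have m0: "real m powr \<sigma>0 > 0" using m by simp
  show ?thesis
  proof (rule exI[of _ h], rule conjI[OF h], rule exI[of _ "real m powr \<sigma>0"], rule conjI[OF m0],
      rule exI[of _ \<sigma>0], rule conjI[OF \<sigma>0], intro allI impI)
    fix t H :: real assume H: "H \<ge> 0"
    define V where "V x = P (Complex x (t + H)) - P (Complex x t)" for x
    have V0: "norm (V \<sigma>0) \<ge> h * H"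
    proof -
      have c: "((\<lambda>r. \<i> * a) has_integral H *\<^sub>R (\<i> * a)) {0..H}"
        using has_integral_const_real[of "\<i> * a" 0 H] H by simp
      have hd: "((\<lambda>r. \<i> * D (Complex \<sigma>0 (t + r)) - \<i> * a) has_integral V \<sigma>0 - H *\<^sub>R (\<i> * a)) {0..H}"
        unfolding V_def by (intro has_integral_diff vert H c)
      have bd: "norm (\<i> * D (Complex \<sigma>0 (t + r)) - \<i> * a) \<le> h" for r
        using dom[of "Complex \<sigma>0 (t + r)"] unfolding right_diff_distrib[symmetric] norm_mult by (simp add: D_def)
      have "norm (V \<sigma>0 - H *\<^sub>R (\<i> * a)) \<le> h * measure lborel {0..H}"
        by (rule has_integral_bound_real[of h "{}", OF _ _ hd]) (use h bd in auto)
      then have "norm (V \<sigma>0 - H *\<^sub>R (\<i> * a)) \<le> h * H" using H by simp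
      moreover have "norm (H *\<^sub>R (\<i> * a)) = 2 * h * H" using H by (simp add: norm_mult h_def)
      ultimately show ?thesis using norm_triangle_ineq2[of "H *\<^sub>R (\<i> * a)" "V \<sigma>0"]
        by (simp add: norm_minus_commute)
    qed
    have Vc: "norm (V (lam / 2)) \<le> real m powr \<sigma>0 * integral {0..H} (\<lambda>r. norm (L (Complex (lam / 2) (t + r))))"
    proof -
      have Lc: "continuous_on {0..H} (\<lambda>r. norm (L (Complex (lam / 2) (t + r))))"
        by (intro continuous_intros continuous_on_compose2[OF holomorphic_on_imp_continuous_on[OF L_holomorphic[of UNIV]]])
           (auto simp: Complex_conv intro!: continuous_intros)
      have "norm (V (lam / 2)) = norm (integral {0..H} (\<lambda>r. \<i> * D (Complex (lam / 2) (t + r))))"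
        using integral_unique[OF vert[OF H]] unfolding V_def by simp
      also have "\<dots> \<le> integral {0..H} (\<lambda>r. real m powr \<sigma>0 * norm (L (Complex (lam / 2) (t + r))))"
      proof (rule Henstock_Kurzweil_Integration.integral_norm_bound_integral)
        show "(\<lambda>r. \<i> * D (Complex (lam / 2) (t + r))) integrable_on {0..H}"
          using vert[OF H] by (rule has_integral_integrable)
        show "(\<lambda>r. real m powr \<sigma>0 * norm (L (Complex (lam / 2) (t + r)))) integrable_on {0..H}"
          by (intro integrable_continuous_real continuous_intros Lc)
        show "norm (\<i> * D (Complex (lam / 2) (t + r))) \<le> real m powr \<sigma>0 * norm (L (Complex (lam / 2) (t + r)))" for r
          unfolding norm_mult Dn using m \<sigma>0 by (auto intro!: mult_right_mono powr_mono)
      qed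
      finally show ?thesis by simp
    qed
    have "V \<sigma>0 = V (lam / 2) - (P (Complex \<sigma>0 t) - P (Complex (lam / 2) t)) + (P (Complex \<sigma>0 (t + H)) - P (Complex (lam / 2) (t + H)))"
      unfolding V_def by simp
    then have "norm (V \<sigma>0) \<le> norm (V (lam / 2)) + norm (P (Complex \<sigma>0 t) - P (Complex (lam / 2) t)) + norm (P (Complex \<sigma>0 (t + H)) - P (Complex (lam / 2) (t + H)))"
      using norm_triangle_ineq[of "V (lam / 2) - (P (Complex \<sigma>0 t) - P (Complex (lam / 2) t))" "P (Complex \<sigma>0 (t + H)) - P (Complex (lam / 2) (t + H))"]
        norm_triangle_ineq4[of "V (lam / 2)" "P (Complex \<sigma>0 t) - P (Complex (lam / 2) t)"] by simp
    with V0 Vc horiz[of t] horiz[of "t + H"]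
    show "h * H \<le> real m powr \<sigma>0 * (integral {0..H} (\<lambda>r. norm (L (Complex (lam / 2) (t + r)))) + strip \<sigma>0 t + strip \<sigma>0 (t + H))"
      by (simp add: distrib_left)
  qed
qed

text \<open>Zeros of a nonzero entire function do not accumulate in a compact disc. Finiteness
  matters because \<open>card\<close> of an infinite set is 0, which would defeat a lower
  bound.\<close>

lemma finite_critical_zeros: "finite {t. 0 \<le> t \<and> t \<le> T \<and> L (Complex (lam / 2) t) = 0}"
proof -
  define Z where "Z = {s. L s = 0}"
  have "finite (cball (of_real (lam / 2)) \<bar>T\<bar> \<inter> Z)"
  proof (rule finite_not_islimpt_in_compact)
    fix z assume "z \<in> cball (complex_of_real (lam / 2)) \<bar>T\<bar>"
    show "\<not> z islimpt Z"
    proof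
      assume "z islimpt Z"
      then have "L s = 0" for s
        by (rule analytic_continuation[OF L_holomorphic[of UNIV] open_UNIV connected_UNIV subset_UNIV UNIV_I])
           (auto simp: Z_def)
      then show False using L_nonzero by blast
    qed
  qed auto
  moreover have "(\<lambda>t. Complex (lam / 2) t) ` {t. 0 \<le> t \<and> t \<le> T \<and> L (Complex (lam / 2) t) = 0} \<subseteq> cball (of_real (lam / 2)) \<bar>T\<bar> \<inter> Z"
    by (auto simp: Z_def dist_norm Complex_conv norm_mult)
  ultimately have "finite ((\<lambda>t. Complex (lam / 2) t) ` {t. 0 \<le> t \<and> t \<le> T \<and> L (Complex (lam / 2) t) = 0})"
    by (rule rev_finite_subset)
  then show ?thesis by (rule finite_imageD) (auto intro: inj_onI)
qed

lemma strip_cont: "continuous_on A (strip \<sigma>0)"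
proof -
  have "continuous_on (A \<times> cbox (lam / 2) \<sigma>0) (\<lambda>(t, x). norm (L (Complex x t)))"
    using continuous_on_norm[OF L_strip_cont] by (simp add: case_prod_unfold)
  then show ?thesis
    unfolding strip_def using integral_continuous_on_param[of A "lam / 2" \<sigma>0 "\<lambda>t x. norm (L (Complex x t))"] by simp
qed

lemma strip_nonneg: "strip \<sigma>0 t \<ge> 0"
proof -
  have "(\<lambda>x. norm (L (Complex x t))) integrable_on {lam / 2..\<sigma>0}"
    by (intro integrable_continuous_real continuous_intros continuous_on_compose2[OF holomorphic_on_imp_continuous_on[OF L_holomorphic[of UNIV]]])
       (auto simp: Complex_conv intro!: continuous_intros)
  then show ?thesis unfolding strip_def by (intro integral_nonneg) auto
qed

end

section \<open>Counting zeros\<close>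

text \<open>Each window of width \<open>w\<close> lies in its own block of length \<open>l\<close>,
  and a nonnegative \<open>G\<close> only gains when windows and missing blocks are filled
  up.\<close>

lemma sum_integral_blocks_le:
  fixes G :: "real \<Rightarrow> real"
  assumes G: "continuous_on UNIV G" "\<And>t. G t \<ge> 0"
    and "0 \<le> w" "w \<le> l" and J: "J \<subseteq> {..<n}" and c: "a + l * real n \<le> c"
  shows "(\<Sum>j\<in>J. integral {a + l * real j..a + l * real j + w} G) \<le> integral {a..c} G"
proof -
  have int: "G integrable_on {x..y}" for x y
    using continuous_on_subset[OF G(1)] by (intro integrable_continuous_real) auto
  have "(\<Sum>j\<in>J. integral {a + l * real j..a + l * real j + w} G) \<le>
        (\<Sum>j\<in>J. integral {a + l * real j..a + l * real (Suc j)} G)"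
    using assms by (intro sum_mono integral_subset_le int) (auto simp: algebra_simps)
  also have "\<dots> \<le> (\<Sum>j<n. integral {a + l * real j..a + l * real (Suc j)} G)"
    using J G(2) by (intro sum_mono2 integral_nonneg int) auto
  also have "\<dots> = integral {a..a + l * real n} G"
  proof (induction n)
    case (Suc n)
    have "integral {a..a + l * real n} G + integral {a + l * real n..a + l * real (Suc n)} G = integral {a..a + l * real (Suc n)} G"
      using assms(3,4) by (intro Henstock_Kurzweil_Integration.integral_combine int) (auto simp: algebra_simps)
    with Suc show ?case by simp
  qed simp
  also have "\<dots> \<le> integral {a..c} G"
    using c G(2) by (intro integral_subset_le int) auto
  finally show ?thesis .
qed

context twisted_form
begin

text \<open>Condenses the analysis into one function: \<open>G\<close> has mean
  \<open>O(sqrt H)\<close> on \<open>{T..2 * T}\<close>, but is at least of order \<open>H\<close>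
  wherever a zero-free segment of length \<open>H\<close> starts, because there the integral of the
  modulus equals the modulus of the integral.\<close>

lemma exists_block_majorant:
  "\<exists>h>0. \<exists>E1>0. \<exists>E2>0. \<forall>T H. 1 \<le> H \<longrightarrow> H \<le> T \<longrightarrow>
     (\<exists>G. continuous_on UNIV G \<and> (\<forall>t. G t \<ge> 0) \<and> integral {T..2 * T} G \<le> T * (E1 * sqrt H + E2) \<and>
        (\<forall>t. T \<le> t \<longrightarrow> t \<le> 2 * T \<longrightarrow> (\<forall>r\<in>{0..H}. L (Complex (lam / 2) (t + r)) \<noteq> 0) \<longrightarrow> h * H \<le> G t))"
proof -
  obtain h c \<sigma>0 where h: "h > 0" and c: "c > 0" and \<sigma>0: "\<sigma>0 \<ge> lam / 2" and
    lower: "\<And>t H. H \<ge> 0 \<Longrightarrow> h * H \<le> c * (integral {0..H} (\<lambda>r. norm (L (Complex (lam / 2) (t + r)))) + strip \<sigma>0 t + strip \<sigma>0 (t + H))"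
    using critical_integral_lower by blast
  obtain K1 where K1: "K1 > 0" "\<And>T t. 1 \<le> T \<Longrightarrow> T \<le> t \<Longrightarrow> t \<le> 3 * T \<Longrightarrow>
      norm (L (Complex (lam / 2) t)) \<le> K1 * T powr (1 / 2 - lam / 2) * norm (hat (tilt_angle T) (lam / 2) t)"
  proof -
    have "lam / 2 \<ge> 0" "1 / 2 \<le> lam / 2" using lam by auto
    then show ?thesis using norm_L_le_hat[of "lam / 2"] that by blast
  qed
  obtain K2 where K2: "K2 > 0" "\<And>T H. 1 \<le> T \<Longrightarrow> 0 < H \<Longrightarrow>
     integral {T..2 * T} (\<lambda>t. (norm (short (tilt_angle T) H t))\<^sup>2) \<le> K2 * H * T powr lam"
    using short_square_mean by blast
  obtain K3 where K3: "K3 > 0" "\<And>T. T \<ge> 1 \<Longrightarrow> integral {T..3 * T} (strip \<sigma>0) \<le> K3 * T"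
    using L_strip_mean[OF \<sigma>0] unfolding strip_def[symmetric] by blast
  have E: "c * K1 * sqrt K2 > 0" "2 * c * K3 > 0" using c K1 K2 K3 by auto
  show ?thesis
  proof (rule exI[of _ h], rule conjI[OF h], rule exI[of _ "c * K1 * sqrt K2"], rule conjI[OF E(1)],
      rule exI[of _ "2 * c * K3"], rule conjI[OF E(2)], intro allI impI)
    fix T H :: real assume H: "1 \<le> H" "H \<le> T"
    then have T: "1 \<le> T" by simp
    note \<theta> = tilt_angle[OF T]
    \<comment> \<open>The factor comparing \<open>L\<close> with the rotated transform; its power of
      \<open>T\<close> cancels the root mean square of \<open>short\<close> exactly.\<close>
    define A where "A = K1 * T powr (1 / 2 - lam / 2)"
    have A: "A > 0" unfolding A_def using K1 T by simp
    define G where "G t = c * (A * norm (short (tilt_angle T) H t) + strip \<sigma>0 t + strip \<sigma>0 (t + H))" for t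
    have sc: "continuous_on B (\<lambda>t. strip \<sigma>0 (t + H))" for B
      by (rule continuous_on_compose2[OF strip_cont[of UNIV]]) (auto intro!: continuous_intros)
    have Gc: "continuous_on B G" for B
      unfolding G_def by (intro continuous_intros short_cont \<theta> strip_cont sc)
    have Gpos: "G t \<ge> 0" for t
      unfolding G_def using c A by (intro mult_nonneg_nonneg add_nonneg_nonneg strip_nonneg) auto
    have short_int: "integral {T..2 * T} (\<lambda>t. norm (short (tilt_angle T) H t)) \<le> sqrt (K2 * H) * T powr (lam / 2 - 1 / 2) * (2 * T - T)"
    proof (rule integral_le_of_square)
      show "continuous_on {T..2 * T} (\<lambda>t. norm (short (tilt_angle T) H t))"
        by (intro continuous_intros short_cont \<theta>)
      show "sqrt (K2 * H) * T powr (lam / 2 - 1 / 2) > 0" using K2 H T by simp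
      have "(T powr (lam / 2 - 1 / 2))\<^sup>2 * T = T powr lam"
      proof -
        have "(T powr (lam / 2 - 1 / 2))\<^sup>2 = T powr (lam - 1)"
          by (simp add: power2_eq_square flip: powr_add)
        then show ?thesis using T by (simp add: powr_diff)
      qed
      then have "K2 * H * T powr lam = (sqrt (K2 * H) * T powr (lam / 2 - 1 / 2))\<^sup>2 * (2 * T - T)"
        using K2 H by (simp add: power_mult_distrib)
      then show "integral {T..2 * T} (\<lambda>t. (norm (short (tilt_angle T) H t))\<^sup>2) \<le>
          (sqrt (K2 * H) * T powr (lam / 2 - 1 / 2))\<^sup>2 * (2 * T - T)"
        using K2(2)[of T H] T H by simp
    qed (use T in auto)
    have strip_int: "integral {T..2 * T} (strip \<sigma>0) \<le> K3 * T"
    proof -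
      have "integral {T..2 * T} (strip \<sigma>0) \<le> integral {T..3 * T} (strip \<sigma>0)"
        using T by (intro integral_subset_le integrable_continuous_real strip_cont) (auto simp: strip_nonneg)
      then show ?thesis using K3(2)[OF T] by simp
    qed
    have strip_int': "integral {T..2 * T} (\<lambda>t. strip \<sigma>0 (t + H)) \<le> K3 * T"
    proof -
      \<comment> \<open>The right edge of the rectangle is a translate by \<open>H \<le> T\<close>,
        so it stays inside \<open>{T..3 * T}\<close>.\<close>
      have "integral {T..2 * T} (\<lambda>t. strip \<sigma>0 (t + H)) = integral {T + H..2 * T + H} (strip \<sigma>0)"
        using integral_shift_Icc_real[of T "2 * T" "strip \<sigma>0" H] by (simp add: comp_def add.commute)
      also have "\<dots> \<le> integral {T..3 * T} (strip \<sigma>0)"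
        using T H by (intro integral_subset_le integrable_continuous_real strip_cont) (auto simp: strip_nonneg)
      finally show ?thesis using K3(2)[OF T] by simp
    qed
    have "integral {T..2 * T} G = c * (A * integral {T..2 * T} (\<lambda>t. norm (short (tilt_angle T) H t)) +
        integral {T..2 * T} (strip \<sigma>0) + integral {T..2 * T} (\<lambda>t. strip \<sigma>0 (t + H)))"
    proof -
      have i1: "(\<lambda>t. A * norm (short (tilt_angle T) H t)) integrable_on {T..2 * T}"
        by (intro integrable_continuous_real continuous_intros short_cont \<theta>)
      have i2: "strip \<sigma>0 integrable_on {T..2 * T}" "(\<lambda>t. strip \<sigma>0 (t + H)) integrable_on {T..2 * T}"
        by (intro integrable_continuous_real strip_cont sc)+
      have i12: "(\<lambda>t. A * norm (short (tilt_angle T) H t) + strip \<sigma>0 t) integrable_on {T..2 * T}"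
        by (rule integrable_add[OF i1 i2(1)])
      show ?thesis
        unfolding G_def by (simp add: Henstock_Kurzweil_Integration.integral_add[OF i12 i2(2)] Henstock_Kurzweil_Integration.integral_add[OF i1 i2(1)])
    qed
    also have "\<dots> \<le> c * (A * (sqrt (K2 * H) * T powr (lam / 2 - 1 / 2) * (2 * T - T)) + K3 * T + K3 * T)"
      using c A by (intro mult_left_mono add_mono short_int strip_int strip_int') auto
    also have "\<dots> = T * (c * K1 * sqrt K2 * sqrt H + 2 * c * K3)"
    proof -
      have "T powr (1 / 2 - lam / 2) * T powr (lam / 2 - 1 / 2) = 1" using T by (simp flip: powr_add)
      then have "A * (sqrt (K2 * H) * T powr (lam / 2 - 1 / 2)) = K1 * (sqrt K2 * sqrt H)"
        unfolding A_def real_sqrt_mult by (simp add: mult_ac)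
      then have "A * (sqrt (K2 * H) * T powr (lam / 2 - 1 / 2) * (2 * T - T)) = K1 * (sqrt K2 * sqrt H) * T"
        by (simp add: mult.assoc[symmetric])
      then show ?thesis by (simp only:) (simp add: algebra_simps)
    qed
    finally have Gint: "integral {T..2 * T} G \<le> T * (c * K1 * sqrt K2 * sqrt H + 2 * c * K3)" .
    have Glow: "h * H \<le> G t" if t: "T \<le> t" "t \<le> 2 * T" and nz: "\<forall>r\<in>{0..H}. L (Complex (lam / 2) (t + r)) \<noteq> 0" for t
    proof -
      have hc: "continuous_on {0..H} (\<lambda>r. hat (tilt_angle T) (lam / 2) (t + r))"
        by (rule continuous_on_compose2[OF hat_cont[OF \<theta>(1), of UNIV]]) (auto intro!: continuous_intros)
      have Lc: "continuous_on {0..H} (\<lambda>r. L (Complex (lam / 2) (t + r)))"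
        by (rule continuous_on_compose2[OF L_vertical_cont[of UNIV]]) (auto intro!: continuous_intros)
      have "integral {0..H} (\<lambda>r. norm (L (Complex (lam / 2) (t + r)))) \<le>
            integral {0..H} (\<lambda>r. A * norm (hat (tilt_angle T) (lam / 2) (t + r)))"
      proof (rule integral_le)
        show "norm (L (Complex (lam / 2) (t + r))) \<le> A * norm (hat (tilt_angle T) (lam / 2) (t + r))" if "r \<in> {0..H}" for r
          unfolding A_def using that t H by (intro K1 T) auto
      qed (intro integrable_continuous_real continuous_intros hc Lc)+
      also have "\<dots> = A * integral {0..H} (\<lambda>r. norm (hat (tilt_angle T) (lam / 2) (t + r)))" by simp
      also have "integral {0..H} (\<lambda>r. norm (hat (tilt_angle T) (lam / 2) (t + r))) = norm (short (tilt_angle T) H t)"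
        using nz H L_critical_zero_iff by (intro norm_short_eq[symmetric] \<theta>) auto
      finally have "integral {0..H} (\<lambda>r. norm (L (Complex (lam / 2) (t + r)))) \<le> A * norm (short (tilt_angle T) H t)" .
      then have "c * (integral {0..H} (\<lambda>r. norm (L (Complex (lam / 2) (t + r)))) + strip \<sigma>0 t + strip \<sigma>0 (t + H)) \<le> G t"
        unfolding G_def using c by (intro mult_left_mono add_mono) auto
      with lower[of H t] H show ?thesis by simp
    qed
    show "\<exists>G. continuous_on UNIV G \<and> (\<forall>t. G t \<ge> 0) \<and> integral {T..2 * T} G \<le> T * (c * K1 * sqrt K2 * sqrt H + 2 * c * K3) \<and>
        (\<forall>t. T \<le> t \<longrightarrow> t \<le> 2 * T \<longrightarrow> (\<forall>r\<in>{0..H}. L (Complex (lam / 2) (t + r)) \<noteq> 0) \<longrightarrow> h * H \<le> G t)"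
      using Gc Gpos Gint Glow by (intro exI[of _ G]) blast
  qed
qed

text \<open>\<open>{T..2 * T}\<close> is cut into blocks of length \<open>3 * H\<close>. In a
  zero-free block every \<open>t\<close> in the initial part of length \<open>H\<close> starts a
  zero-free segment, so the block contributes at least \<open>h * H * H\<close> to the integral of
  \<open>G\<close>. For large \<open>H\<close> at most half as many blocks as the guaranteed total
  can be zero-free.\<close>

lemma critical_zeros_density:
  "\<exists>d>0. \<exists>T0. \<forall>T\<ge>T0. d * T \<le> real (card {t. 0 \<le> t \<and> t \<le> T \<and> L (Complex (lam / 2) t) = 0})"
proof -
  obtain h E1 E2 where h: "h > 0" and E: "E1 > 0" "E2 > 0" and maj: "\<And>T H. 1 \<le> H \<Longrightarrow> H \<le> T \<Longrightarrow>
     (\<exists>G. continuous_on UNIV G \<and> (\<forall>t. G t \<ge> 0) \<and> integral {T..2 * T} G \<le> T * (E1 * sqrt H + E2) \<and>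
        (\<forall>t. T \<le> t \<longrightarrow> t \<le> 2 * T \<longrightarrow> (\<forall>r\<in>{0..H}. L (Complex (lam / 2) (t + r)) \<noteq> 0) \<longrightarrow> h * H \<le> G t))"
    using exists_block_majorant by blast
  \<comment> \<open>Large enough that \<open>(E1 + E2) * sqrt H \<le> h * H / 12\<close>. The number
    12 makes zero-free blocks at most \<open>T / (12 * H)\<close>, against at least
    \<open>T / (6 * H)\<close> blocks in total.\<close>
  define H where "H = max 1 ((12 * (E1 + E2) / h)\<^sup>2)"
  have H1: "H \<ge> 1" by (simp add: H_def)
  have Hs: "sqrt H \<ge> 1" "sqrt H \<ge> 12 * (E1 + E2) / h"
    using H1 by (auto simp: H_def intro!: real_le_rsqrt)
  have EH: "E1 * sqrt H + E2 \<le> h * H / 12"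
  proof -
    have "E1 * sqrt H + E2 \<le> E1 * sqrt H + E2 * sqrt H" using Hs(1) E by simp
    also have "\<dots> = (E1 + E2) * sqrt H" by (simp add: algebra_simps)
    also have "\<dots> \<le> (h * sqrt H / 12) * sqrt H"
      using Hs h by (intro mult_right_mono) (auto simp: field_simps)
    also have "\<dots> = h * H / 12" using H1 by simp
    finally show ?thesis .
  qed
  define Z where "Z T = {t. 0 \<le> t \<and> t \<le> T \<and> L (Complex (lam / 2) t) = 0}" for T
  have main: "T / (12 * H) \<le> real (card (Z (2 * T)))" if T: "T \<ge> 6 * H" for T
  proof -
    have HT: "H \<le> T" "0 < T" using T H1 by auto
    obtain G where G: "continuous_on UNIV G" "\<And>t. G t \<ge> 0" "integral {T..2 * T} G \<le> T * (E1 * sqrt H + E2)"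
      and Glow: "\<And>t. T \<le> t \<Longrightarrow> t \<le> 2 * T \<Longrightarrow> (\<And>r. r \<in> {0..H} \<Longrightarrow> L (Complex (lam / 2) (t + r)) \<noteq> 0) \<Longrightarrow> h * H \<le> G t"
      using maj[OF H1 HT(1)] by metis
    define n where "n = nat \<lfloor>T / (3 * H)\<rfloor>"
    have quot: "T / (3 * H) \<ge> 0" using HT H1 by simp
    have n_le: "3 * H * real n \<le> T"
    proof -
      have "real n \<le> T / (3 * H)" unfolding n_def using quot by linarith
      then show ?thesis using H1 by (simp add: field_simps)
    qed
    have n_ge: "real n \<ge> T / (6 * H)"
    proof -
      have "real n \<ge> T / (3 * H) - 1" unfolding n_def using quot by linarith
      moreover have "T / (6 * H) \<ge> 1" using T H1 by simp
      moreover have "T / (3 * H) = 2 * (T / (6 * H))" by simp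
      ultimately show ?thesis by linarith
    qed
    define x where "x j = T + 3 * H * real j" for j
    \<comment> \<open>Half-open blocks are disjoint, so zeros chosen in different blocks are
      distinct.\<close>
    define J where "J = {j. j < n \<and> (\<forall>t\<in>{x j..<x (Suc j)}. L (Complex (lam / 2) t) \<noteq> 0)}"
    have x_bounds: "T \<le> x j" "x (Suc j) = x j + 3 * H" "x (Suc j) \<le> 2 * T" if "j < n" for j
    proof -
      show "T \<le> x j" "x (Suc j) = x j + 3 * H" using H1 by (auto simp: x_def algebra_simps)
      have "3 * H * real (Suc j) \<le> 3 * H * real n" using that H1 by (intro mult_left_mono) auto
      then show "x (Suc j) \<le> 2 * T" using n_le by (simp add: x_def)
    qed
    have "real (card J) * (h * H * H) = (\<Sum>j\<in>J. h * H * H)" by simp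
    also have "\<dots> \<le> (\<Sum>j\<in>J. integral {T + 3 * H * real j..T + 3 * H * real j + H} G)"
    proof (intro sum_mono)
      fix j assume j: "j \<in> J"
      then have jn: "j < n" by (simp add: J_def)
      note xb = x_bounds[OF jn]
      have "h * H * H = integral {x j..x j + H} (\<lambda>t. h * H)" using H1 by simp
      also have "\<dots> \<le> integral {x j..x j + H} G"
      proof (rule integral_le)
        show "G integrable_on {x j..x j + H}"
          using continuous_on_subset[OF G(1)] by (intro integrable_continuous_real) auto
        fix t assume t: "t \<in> {x j..x j + H}"
        show "h * H \<le> G t"
        proof (rule Glow)
          show "T \<le> t" "t \<le> 2 * T" using t xb H1 by auto
          fix r assume "r \<in> {0..H}"
          \<comment> \<open>\<open>t\<close> and \<open>r\<close> together advance by at most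
            \<open>2 * H\<close>, strictly less than the block length \<open>3 * H\<close>; the
            excluded right end is not reached.\<close>
          then have "t + r \<in> {x j..<x (Suc j)}" using t xb H1 by auto
          then show "L (Complex (lam / 2) (t + r)) \<noteq> 0" using j by (auto simp: J_def)
        qed
      qed auto
      finally show "h * H * H \<le> integral {T + 3 * H * real j..T + 3 * H * real j + H} G"
        by (simp add: x_def)
    qed
    also have "\<dots> \<le> integral {T..2 * T} G"
      using H1 n_le by (intro sum_integral_blocks_le[where n = n] G) (auto simp: J_def)
    also have "\<dots> \<le> T * (h * H / 12)"
      by (rule order.trans[OF G(3) mult_left_mono[OF EH]]) (use HT in auto)
    finally have "real (card J) * (h * H * H) \<le> T / (12 * H) * (h * H * H)"
      using H1 by (simp add: field_simps)
    then have cardJ: "real (card J) \<le> T / (12 * H)"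
      using h H1 by (subst (asm) mult_le_cancel_right) auto
    have "\<forall>j. j \<in> {..<n} - J \<longrightarrow> (\<exists>t. t \<in> {x j..<x (Suc j)} \<and> L (Complex (lam / 2) t) = 0)"
      by (auto simp: J_def)
    then obtain z where z: "\<And>j. j \<in> {..<n} - J \<Longrightarrow> z j \<in> {x j..<x (Suc j)} \<and> L (Complex (lam / 2) (z j)) = 0"
      by metis
    have x_mono: "x i \<le> x j" if "i \<le> j" for i j
      unfolding x_def using that H1 by simp
    have "inj_on z ({..<n} - J)"
    proof (rule linorder_inj_onI)
      fix i j assume ij: "i < j" "i \<in> {..<n} - J" "j \<in> {..<n} - J"
      then have "z i < x (Suc i)" "x (Suc i) \<le> x j" "x j \<le> z j"
        using z x_mono[of "Suc i" j] by auto
      then show "z i \<noteq> z j" by simp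
    qed auto
    moreover have "z ` ({..<n} - J) \<subseteq> Z (2 * T)"
    proof safe
      fix j assume j: "j < n" "j \<notin> J"
      then show "z j \<in> Z (2 * T)"
        using z[of j] x_bounds[OF j(1)] HT by (auto simp: Z_def)
    qed
    moreover have "finite (Z (2 * T))" unfolding Z_def by (rule finite_critical_zeros)
    ultimately have "card ({..<n} - J) \<le> card (Z (2 * T))"
      by (metis card_image card_mono)
    moreover have "J \<subseteq> {..<n}" by (auto simp: J_def)
    then have "card ({..<n} - J) = n - card J" "card J \<le> n"
      using card_mono[of "{..<n}" J] by (auto simp: card_Diff_subset finite_subset)
    ultimately have "real n - real (card J) \<le> real (card (Z (2 * T)))" by linarith
    moreover have "T / (6 * H) = 2 * (T / (12 * H))" by simp
    ultimately show ?thesis using cardJ n_ge by linarith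
  qed
  show ?thesis
  \<comment> \<open>The count up to \<open>T\<close> is \<open>main\<close> at \<open>T / 2\<close>,
    hence the doubled constants.\<close>
  proof (rule exI[of _ "1 / (24 * H)"], intro conjI exI[of _ "12 * H"] allI impI)
    show "1 / (24 * H) > 0" using H1 by simp
    fix T assume "T \<ge> 12 * H"
    then show "1 / (24 * H) * T \<le> real (card {t. 0 \<le> t \<and> t \<le> T \<and> L (Complex (lam / 2) t) = 0})"
      using main[of "T / 2"] by (simp add: Z_def)
  qed
qed

end

section \<open>Modular transformations and periodic functions\<close>

lemma Jacobi_unit:
  assumes "coprime c n"
  shows "\<bar>Jacobi c n\<bar> = 1"
proof -
  have leg: "\<bar>Legendre c p\<bar> = 1" if "p \<in># prime_factorization n" for p
  proof -
    have "prime p" "p dvd n" using that by (auto intro: in_prime_factors_imp_prime in_prime_factors_imp_dvd)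
    then have "\<not> p dvd c" using assms coprime_common_divisor not_prime_unit by blast
    then show ?thesis by (auto simp: Legendre_def cong_0_iff)
  qed
  have "\<bar>\<Prod>p\<in>#A. Legendre c p\<bar> = 1" if "\<And>p. p \<in># A \<Longrightarrow> \<bar>Legendre c p\<bar> = 1" for A
    using that by (induction A) (auto simp: abs_mult)
  then show ?thesis unfolding Jacobi_def using leg by blast
qed

lemma Shimura_symbol_unit:
  assumes "a * d - b * c = 1"
  shows "\<bar>Shimura_symbol c d\<bar> = 1"
proof -
  have "coprime c d"
  proof (rule coprimeI)
    fix e assume "e dvd c" "e dvd d"
    then have "e dvd a * d - b * c" by (intro dvd_diff dvd_mult)
    then show "is_unit e" using assms by simp
  qed
  moreover have "\<bar>d\<bar> = 1" if "c = 0" using assms that by (simp add: zmult_eq_1_iff) linarith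
  ultimately show ?thesis
    using Jacobi_unit[of c d] Jacobi_unit[of c "\<bar>d\<bar>"] by (auto simp: Shimura_symbol_def)
qed

lemma norm_eps_factor [simp]: "norm (eps_factor d) = 1"
  by (simp add: eps_factor_def)

lemma norm_half_power: "norm (half_power z k) = norm z powr (real k + 1 / 2)"
proof (cases "z = 0")
  case False
  have "norm (half_power z k) = sqrt (norm z) ^ (2 * k + 1)"
    by (simp add: half_power_def norm_power norm_mult power_add)
  also have "\<dots> = (norm z powr (1 / 2)) powr (real (2 * k + 1))"
    using False by (subst powr_realpow) (auto simp: powr_half_sqrt)
  also have "\<dots> = norm z powr (real k + 1 / 2)"
    by (simp add: powr_powr field_simps)
  finally show ?thesis .
qed (simp add: half_power_def)

lemma half_power_square: "(half_power z k)\<^sup>2 = z ^ (2 * k + 1)"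
  unfolding half_power_def by (metis power2_csqrt power_mult power_mult_distrib mult.commute)

section \<open>The action of \<open>SL2Z\<close> on the upper half plane\<close>

definition moebius :: "int \<times> int \<times> int \<times> int \<Rightarrow> complex \<Rightarrow> complex" where
  "moebius = (\<lambda>(a, b, c, d) z. (of_int a * z + of_int b) / (of_int c * z + of_int d))"

definition autom :: "int \<times> int \<times> int \<times> int \<Rightarrow> complex \<Rightarrow> complex" where
  "autom = (\<lambda>(a, b, c, d) z. of_int c * z + of_int d)"

lemma autom_nonzero:
  assumes "(a, b, c, d) \<in> SL2Z" "Im z > 0"
  shows "autom (a, b, c, d) z \<noteq> 0"
proof
  assume "autom (a, b, c, d) z = 0"
  then have "Im (of_int c * z + of_int d) = 0" "Re (of_int c * z + of_int d) = 0" by (auto simp: autom_def)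
  then have "c = 0" "d = 0" using assms(2) by auto
  then show False using assms(1) by (simp add: SL2Z_def)
qed

lemma moebius_Im:
  assumes "(a, b, c, d) \<in> SL2Z" "Im z > 0"
  shows "Im (moebius (a, b, c, d) z) = Im z / (norm (autom (a, b, c, d) z))\<^sup>2"
proof -
  have "real_of_int a * real_of_int d - real_of_int b * real_of_int c = 1"
    using assms(1) by (simp add: SL2Z_def flip: of_int_mult of_int_diff)
  then have "Im z * (real_of_int a * real_of_int d - real_of_int b * real_of_int c) = Im z" by simp
  then have "(of_int a * Im z) * (of_int c * Re z + of_int d) - (of_int a * Re z + of_int b) * (of_int c * Im z) = Im z"
    by (simp add: algebra_simps)
  then show ?thesis
    by (simp add: moebius_def autom_def Im_divide cmod_power2)
qed

lemma moebius_Im_pos: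
  assumes "(a, b, c, d) \<in> SL2Z" "Im z > 0"
  shows "Im (moebius (a, b, c, d) z) > 0"
  unfolding moebius_Im[OF assms] using autom_nonzero[OF assms] assms(2) by simp

lemma moebius_compose:
  assumes "(a', b', c', d') \<in> SL2Z" "Im z > 0"
  shows "moebius (a, b, c, d) (moebius (a', b', c', d') z) =
           moebius (a * a' + b * c', a * b' + b * d', c * a' + d * c', c * b' + d * d') z"
    and "autom (a, b, c, d) (moebius (a', b', c', d') z) * autom (a', b', c', d') z =
           autom (a * a' + b * c', a * b' + b * d', c * a' + d * c', c * b' + d * d') z"
proof -
  define X Y where "X = of_int a' * z + of_int b'" and "Y = of_int c' * z + of_int d'"
  have Y: "Y \<noteq> 0" using autom_nonzero[OF assms] by (simp add: autom_def Y_def)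
  have m: "moebius (a', b', c', d') z = X / Y" by (simp add: moebius_def X_def Y_def)
  have n: "of_int a * X + of_int b * Y = of_int (a * a' + b * c') * z + of_int (a * b' + b * d')"
     "of_int c * X + of_int d * Y = of_int (c * a' + d * c') * z + of_int (c * b' + d * d')"
    unfolding X_def Y_def by (simp_all add: algebra_simps)
  have e: "of_int a * (X / Y) + of_int b = (of_int a * X + of_int b * Y) / Y"
      "of_int c * (X / Y) + of_int d = (of_int c * X + of_int d * Y) / Y"
    using Y by (simp_all add: field_simps)
  show "moebius (a, b, c, d) (moebius (a', b', c', d') z) =
           moebius (a * a' + b * c', a * b' + b * d', c * a' + d * c', c * b' + d * d') z"
    unfolding m unfolding moebius_def prod.case e n using Y by simp
  show "autom (a, b, c, d) (moebius (a', b', c', d') z) * autom (a', b', c', d') z =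
           autom (a * a' + b * c', a * b' + b * d', c * a' + d * c', c * b' + d * d') z"
    unfolding m unfolding autom_def prod.case e n Y_def[symmetric] using Y by simp
qed

text \<open>A holomorphic function on the upper half plane with period \<open>M\<close> is a holomorphic function
  of \<open>exp (2 pi i z / M)\<close> on the punctured unit disc; its singularity at 0 is removable.\<close>

lemma periodic_exponential_decay:
  fixes G :: "complex \<Rightarrow> complex" and M :: real
  assumes hol: "G holomorphic_on {z. Im z > 0}" and M: "M > 0"
    and per: "\<And>z. Im z > 0 \<Longrightarrow> G (z + of_real M) = G z"
    and lim: "(G \<longlongrightarrow> 0) (filtercomap Im at_top)" and Y: "Y > 0"
  shows "\<exists>B>0. \<forall>z. Im z \<ge> Y \<longrightarrow> norm (G z) \<le> B * exp (- (2 * pi / M) * Im z)"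
proof -
  have per_nat: "G (z + of_real (real n * M)) = G z" if "Im z > 0" for z n
    using that
  proof (induction n)
    case (Suc n)
    have "G (z + of_real (real (Suc n) * M)) = G ((z + of_real (real n * M)) + of_real M)"
      by (simp add: algebra_simps)
    also have "\<dots> = G z" using per[of "z + of_real (real n * M)"] Suc by simp
    finally show ?case .
  qed simp
  have per_int: "G (z + of_real (of_int n * M)) = G z" if "Im z > 0" for z n
  proof (cases "n \<ge> 0")
    case True
    then show ?thesis using per_nat[OF that, of "nat n"] by simp
  next
    case False
    have "G (z + of_real (of_int n * M) + of_real (real (nat (- n)) * M)) = G (z + of_real (of_int n * M))"
      by (rule per_nat) (use that in simp)
    moreover have "z + of_real (of_int n * M) + of_real (real (nat (- n)) * M) = z"
      using False by simp
    ultimately show ?thesis by metis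
  qed
  \<comment> \<open>Recovers \<open>z\<close> from a logarithm of
    \<open>exp (2 * pi * \<i> * z / M)\<close>. Changing the logarithm by
    \<open>2 * pi * \<i> * n\<close> moves \<open>\<tau>\<close> by \<open>n * M\<close>, which the
    periodicity absorbs.\<close>
  define \<tau> where "\<tau> u = of_real M * u / (2 * of_real pi * \<i>)" for u
  have Im\<tau>: "Im (\<tau> u) = - (M / (2 * pi)) * Re u" for u
    by (simp add: \<tau>_def Im_divide power2_eq_square)
  define P where "P w = G (\<tau> (Ln w))" for w
  have P_eq: "P w = G (\<tau> u)" if "exp u = w" "norm w < 1" for u w
  proof -
    have w0: "w \<noteq> 0" using that by auto
    have "exp (Ln w) = exp u" using w0 that by simp
    then obtain n :: int where "Ln w = u + (of_int (2 * n) * pi) * \<i>"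
      unfolding exp_eq by auto
    then have "\<tau> (Ln w) = \<tau> u + of_real (of_int n * M)"
      by (simp add: \<tau>_def field_simps)
    moreover have "Re u < 0" using that by auto
    then have "Im (\<tau> u) > 0" unfolding Im\<tau> using M by (simp add: mult_pos_neg divide_simps)
    ultimately show ?thesis unfolding P_def by (simp only: per_int)
  qed
  have \<tau>hol: "\<tau> holomorphic_on A" for A unfolding \<tau>_def by (intro holomorphic_intros) auto
  have P_hol: "P holomorphic_on ball 0 1 - {0}"
  proof -
    \<comment> \<open>\<open>Ln\<close> is holomorphic off the nonpositive reals only. The disc slit
      along the positive axis supplies the missing points, with the branch
      \<open>Ln (- w) + \<i> * pi\<close>; both slit discs together cover the punctured
      disc.\<close>
    define A1 where "A1 = ball (0::complex) 1 - \<real>\<^sub>\<le>\<^sub>0"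
    define A2 where "A2 = ball (0::complex) 1 - uminus ` \<real>\<^sub>\<le>\<^sub>0"
    have closed2: "closed (uminus ` (\<real>\<^sub>\<le>\<^sub>0 :: complex set))"
      by (intro closed_negations closed_nonpos_Reals_complex)
    have pos: "Im (\<tau> u) > 0" if "norm (exp u) < 1" for u
      using that M unfolding Im\<tau> by (simp add: mult_pos_neg divide_simps)
    have "(\<lambda>w. G (\<tau> (Ln w))) holomorphic_on A1"
    proof (rule holomorphic_on_compose_gen[where g = G and f = "\<lambda>w. \<tau> (Ln w)" and t = "{z. Im z > 0}", unfolded comp_def, OF _ hol])
      show "(\<lambda>w. \<tau> (Ln w)) holomorphic_on A1"
        using holomorphic_on_compose[OF holomorphic_on_Ln[of A1] \<tau>hol] by (auto simp: A1_def comp_def)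
      show "(\<lambda>w. \<tau> (Ln w)) ` A1 \<subseteq> {z. Im z > 0}"
      proof (rule image_subsetI)
        fix w assume w: "w \<in> A1"
        then have "w \<noteq> 0" by (auto simp: A1_def)
        then have "exp (Ln w) = w" by simp
        then have "norm (exp (Ln w)) < 1" using w by (simp only:) (simp add: A1_def)
        then show "\<tau> (Ln w) \<in> {z. Im z > 0}" using pos by blast
      qed
    qed
    then have h1: "P holomorphic_on A1" unfolding P_def .
    have n0: "w \<noteq> 0" "- w \<notin> \<real>\<^sub>\<le>\<^sub>0" "norm w < 1" if "w \<in> A2" for w
    proof -
      have nm: "- w \<notin> \<real>\<^sub>\<le>\<^sub>0"
        using that unfolding A2_def by (metis DiffD2 imageI minus_minus)
      then show "w \<noteq> 0" "- w \<notin> \<real>\<^sub>\<le>\<^sub>0" "norm w < 1" using that by (auto simp: A2_def)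
    qed
    have h2': "(\<lambda>w. G (\<tau> (Ln (- w) + \<i> * of_real pi))) holomorphic_on A2"
    proof (rule holomorphic_on_compose_gen[where g = G and f = "\<lambda>w. \<tau> (Ln (- w) + \<i> * of_real pi)" and t = "{z. Im z > 0}", unfolded comp_def, OF _ hol])
      have "(\<lambda>w. Ln (- w) + \<i> * of_real pi) holomorphic_on A2"
        using n0 by (intro holomorphic_intros) auto
      from holomorphic_on_compose[OF this \<tau>hol]
      show "(\<lambda>w. \<tau> (Ln (- w) + \<i> * of_real pi)) holomorphic_on A2" by (simp add: comp_def)
      show "(\<lambda>w. \<tau> (Ln (- w) + \<i> * of_real pi)) ` A2 \<subseteq> {z. Im z > 0}"
      proof (rule image_subsetI)
        fix w assume w: "w \<in> A2"
        have "exp (Ln (- w) + \<i> * of_real pi) = w" using n0[OF w] by (simp add: exp_add)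
        then have "norm (exp (Ln (- w) + \<i> * of_real pi)) < 1" using n0[OF w] by (simp only:)
        then show "\<tau> (Ln (- w) + \<i> * of_real pi) \<in> {z. Im z > 0}" using pos by blast
      qed
    qed
    have Peq: "P w = G (\<tau> (Ln (- w) + \<i> * of_real pi))" if "w \<in> A2" for w
      using n0[OF that] by (intro P_eq) (auto simp: exp_add)
    have h2: "P holomorphic_on A2"
      by (rule holomorphic_transform[OF h2' Peq[symmetric]])
    have "P holomorphic_on (A1 \<union> A2)"
    proof (rule holomorphic_on_Un[OF h1 h2])
      show "open A1" unfolding A1_def by (intro open_Diff closed_nonpos_Reals_complex) auto
      show "open A2" unfolding A2_def by (intro open_Diff closed2) auto
    qed
    moreover have "ball 0 1 - {0} \<subseteq> A1 \<union> A2"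
    proof
      fix w :: complex assume w: "w \<in> ball 0 1 - {0}"
      have False if "w \<in> \<real>\<^sub>\<le>\<^sub>0" "x \<in> \<real>\<^sub>\<le>\<^sub>0" "w = - x" for x
      proof -
        have "Re w \<le> 0" "Im w = 0" "Re w \<ge> 0"
          using that by (auto simp: complex_nonpos_Reals_iff)
        then have "w = 0" by (simp add: complex_eq_iff)
        then show False using w by simp
      qed
      then show "w \<in> A1 \<union> A2" using w unfolding A1_def A2_def by blast
    qed
    ultimately show ?thesis by (rule holomorphic_on_subset)
  qed
  define Q where "Q w = (if w = 0 then 0 else P w)" for w
  have Q_lim: "(Q \<longlongrightarrow> 0) (at 0)"
  proof (rule tendstoI)
    fix e :: real assume "e > 0"
    then have "eventually (\<lambda>z. dist (G z) 0 < e) (filtercomap Im at_top)"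
      by (rule tendstoD[OF lim])
    then obtain y0 where y0: "\<And>z. Im z \<ge> y0 \<Longrightarrow> norm (G z) < e"
      unfolding eventually_filtercomap eventually_at_top_linorder by auto
    define r where "r = min 1 (exp (- (2 * pi / M) * y0))"
    have r: "r > 0" by (simp add: r_def)
    have "norm (Q w) < e" if w: "w \<noteq> 0" "norm w < r" for w
    proof -
      have "ln (norm w) \<le> ln (exp (- (2 * pi / M) * y0))"
        using w by (subst ln_le_cancel_iff) (auto simp: r_def)
      then have "Re (Ln w) \<le> - (2 * pi / M) * y0" using w by simp
      then have "Im (\<tau> (Ln w)) \<ge> y0" unfolding Im\<tau> using M by (simp add: field_simps)
      then show ?thesis using y0 w by (simp add: Q_def P_def)
    qed
    then show "\<forall>\<^sub>F w in at 0. dist (Q w) 0 < e"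
      unfolding eventually_at using r by (intro exI[of _ r]) auto
  qed
  have Q_hol': "Q holomorphic_on ball 0 1 - {0}"
    using P_hol by (rule holomorphic_transform) (auto simp: Q_def)
  have "continuous_on (ball 0 1) Q"
  proof (intro continuous_at_imp_continuous_on ballI)
    fix w :: complex assume w: "w \<in> ball 0 1"
    show "isCont Q w"
    proof (cases "w = 0")
      case True
      then show ?thesis using Q_lim by (simp add: isCont_def Q_def)
    next
      case False
      then show ?thesis using w holomorphic_on_imp_continuous_on[OF Q_hol']
        by (subst (asm) continuous_on_eq_continuous_at) auto
    qed
  qed
  then have Q_hol: "Q holomorphic_on ball 0 1"
    by (rule no_isolated_singularity[OF _ Q_hol']) auto
  \<comment> \<open>Since \<open>Q\<close> vanishes at 0, the quotient \<open>Q w / w\<close>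
    extends holomorphically. Its boundedness on a closed disc is the required decay, because
    \<open>norm (exp u)\<close> is the exponential in the claim.\<close>
  define R where "R w = (if w = 0 then deriv Q 0 else (Q w - Q 0) / (w - 0))" for w
  have R_hol: "R holomorphic_on ball 0 1"
    unfolding R_def by (rule pole_lemma[OF Q_hol]) auto
  define r where "r = exp (- (2 * pi / M) * Y)"
  have r: "0 < r" "r < 1" using M Y by (auto simp: r_def)
  have "compact (R ` cball 0 r)"
    using r by (intro compact_continuous_image holomorphic_on_imp_continuous_on holomorphic_on_subset[OF R_hol]) auto
  then obtain B where B: "B > 0" "\<And>w. norm w \<le> r \<Longrightarrow> norm (R w) \<le> B"
    using compact_imp_bounded bounded_pos by (metis (no_types, lifting) imageI mem_cball_0)
  show ?thesis
  proof (intro exI[of _ B] conjI B allI impI)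
    fix z assume z: "Im z \<ge> Y"
    define u where "u = 2 * of_real pi * \<i> * z / of_real M"
    have Reu: "Re u = - (2 * pi / M) * Im z" by (simp add: u_def)
    have nu: "norm (exp u) = exp (- (2 * pi / M) * Im z)" by (simp add: Reu)
    have le: "norm (exp u) \<le> r" unfolding nu r_def using z M by (simp add: field_simps)
    have "\<tau> u = z" using M by (simp add: \<tau>_def u_def)
    moreover have "norm (exp u) < 1" using le r by linarith
    ultimately have "G z = P (exp u)" using P_eq[OF refl, of u] by metis
    also have "\<dots> = R (exp u) * exp u" by (simp add: R_def Q_def)
    finally have "norm (G z) = norm (R (exp u)) * norm (exp u)" by (simp only: norm_mult)
    also have "\<dots> \<le> B * norm (exp u)" by (intro mult_right_mono B le) auto
    finally show "norm (G z) \<le> B * exp (- (2 * pi / M) * Im z)" unfolding nu .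
  qed
qed

lemma powr_exp_bounded:
  fixes \<beta> r Y :: real
  assumes "\<beta> > 0" "Y > 0"
  shows "\<exists>B>0. \<forall>y\<ge>Y. y powr r * exp (- \<beta> * y) \<le> B"
proof -
  have "((\<lambda>y::real. y powr r * exp (- \<beta> * y)) \<longlongrightarrow> 0) at_top"
    using assms(1) by real_asymp
  then have "\<forall>\<^sub>F y in at_top. y powr r * exp (- \<beta> * y) < 1"
    by (rule order_tendstoD) simp
  then obtain Y1 where Y1: "\<And>y. y \<ge> Y1 \<Longrightarrow> y powr r * exp (- \<beta> * y) < 1"
    by (auto simp: eventually_at_top_linorder)
  have "continuous_on {Y..max Y Y1} (\<lambda>y. y powr r * exp (- \<beta> * y))"
    using assms by (intro continuous_intros) auto
  then have "bounded ((\<lambda>y. y powr r * exp (- \<beta> * y)) ` {Y..max Y Y1})"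
    by (intro compact_imp_bounded compact_continuous_image) auto
  then obtain B where B: "B > 0" "\<And>y. y \<in> {Y..max Y Y1} \<Longrightarrow> norm (y powr r * exp (- \<beta> * y)) \<le> B"
    unfolding bounded_pos by auto
  show ?thesis
  proof (intro exI[of _ "max 1 B"] conjI allI impI)
    fix y assume "y \<ge> Y"
    then show "y powr r * exp (- \<beta> * y) \<le> max 1 B"
      using Y1[of y] B(2)[of y] by (cases "y \<ge> Y1") auto
  qed auto
qed

text \<open>Dirichlet's approximation theorem takes the place of the reduction to the fundamental domain.\<close>

lemma exists_moebius_Im_large:
  assumes "Im z > 0"
  shows "\<exists>a b c d. (a, b, c, d) \<in> SL2Z \<and> Im (moebius (a, b, c, d) z) \<ge> 1 / 5"
proof (cases "Im z \<ge> 1")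
  case True
  have "(1, 0, 0, 1) \<in> SL2Z" by (simp add: SL2Z_def)
  moreover have "moebius (1, 0, 0, 1) z = z" by (simp add: moebius_def)
  ultimately show ?thesis using True by (metis divide_le_eq_1 order.trans one_le_numeral zero_less_numeral)
next
  case False
  define y where "y = Im z"
  have y: "0 < y" "y < 1" using False assms by (auto simp: y_def)
  \<comment> \<open>The order \<open>1 / sqrt y\<close> balances the two parts of the squared
    automorphy factor: \<open>(k * Re z - h)\<^sup>2 \<le> y\<close> and
    \<open>(k * y)\<^sup>2 \<le> 4 * y\<close>, which add up to \<open>5 * y\<close> and give the
    bound \<open>1 / 5\<close>.\<close>
  define n where "n = nat \<lceil>1 / sqrt y\<rceil>"
  have sy: "0 < sqrt y" "sqrt y < 1" using y by auto
  have n1: "1 / sqrt y \<le> real n" unfolding n_def by (rule real_nat_ceiling_ge)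
  have n2: "real n \<le> 2 / sqrt y"
  proof -
    have "real n \<le> 1 / sqrt y + 1" unfolding n_def using sy by (simp add: of_nat_ceiling)
    moreover have "1 \<le> 1 / sqrt y" using sy by (simp only: le_divide_eq_1_pos less_imp_le)
    ultimately show ?thesis by simp
  qed
  have n0: "n > 0" using n1 sy by (metis divide_pos_pos gr_zeroI not_le of_nat_0 zero_less_one)
  obtain h k where hk: "coprime h k" "0 < k" "k \<le> int n" "\<bar>of_int k * Re z - of_int h\<bar> < 1 / real n"
    using Dirichlet_approx_coprime[OF n0, of "Re z"] by blast
  \<comment> \<open>Bezout's identity completes the bottom row \<open>(k, - h)\<close> to a matrix
    of determinant one.\<close>
  obtain u v where uv: "u * h + v * k = 1"
    using hk(1) by (metis coprime_iff_gcd_eq_1 bezout_int)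
  have mem: "(- u, - v, k, - h) \<in> SL2Z"
    using uv by (simp add: SL2Z_def algebra_simps)
  have ny: "(1 / real n)\<^sup>2 \<le> y" "(real n)\<^sup>2 * y \<le> 4"
  proof -
    have "1 / real n \<le> sqrt y" using n1 sy n0 by (simp add: field_simps)
    then have "(1 / real n)\<^sup>2 \<le> (sqrt y)\<^sup>2" by (intro power_mono) auto
    then show "(1 / real n)\<^sup>2 \<le> y" using y by simp
    have "real n * sqrt y \<le> 2" using n2 sy by (simp add: field_simps)
    then have "(real n * sqrt y)\<^sup>2 \<le> 2\<^sup>2" using sy by (intro power_mono) auto
    then show "(real n)\<^sup>2 * y \<le> 4" using y by (simp add: power_mult_distrib)
  qed
  have "(norm (autom (- u, - v, k, - h) z))\<^sup>2 = (of_int k * Re z - of_int h)\<^sup>2 + (of_int k)\<^sup>2 * y\<^sup>2"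
    by (simp add: autom_def cmod_power2 y_def power_mult_distrib)
  also have "(of_int k * Re z - of_int h)\<^sup>2 \<le> (1 / real n)\<^sup>2"
    using hk(4) by (metis abs_le_square_iff abs_of_nonneg less_imp_le of_nat_0_le_iff zero_le_divide_1_iff)
  also have "(real_of_int k)\<^sup>2 * y\<^sup>2 \<le> (real n)\<^sup>2 * y\<^sup>2"
    using hk by (intro mult_right_mono power_mono) auto
  also have "(real n)\<^sup>2 * y\<^sup>2 = ((real n)\<^sup>2 * y) * y" by (simp add: power2_eq_square)
  also have "\<dots> \<le> 4 * y" using ny y by (intro mult_right_mono) auto
  finally have "(norm (autom (- u, - v, k, - h) z))\<^sup>2 \<le> 5 * y" using ny(1) by simp
  moreover have "norm (autom (- u, - v, k, - h) z) > 0" using autom_nonzero[OF mem assms] by simp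
  ultimately have "1 / 5 \<le> Im (moebius (- u, - v, k, - h) z)"
    unfolding moebius_Im[OF mem assms] y_def[symmetric] by (simp add: field_simps)
  then show ?thesis using mem by blast
qed

section \<open>Growth of cusp forms of half-integral weight\<close>

lemma Gamma0_SL2Z: "\<gamma> \<in> Gamma0 M \<Longrightarrow> \<gamma> \<in> SL2Z"
  by (auto simp: Gamma0_def)

locale cusp_form =
  fixes k N :: nat and f :: "complex \<Rightarrow> complex"
  assumes N: "N > 0" and f: "f \<in> half_weight_cusp_forms k N"
begin

section \<open>Transformation of \<open>f\<close> and of its square\<close>

definition wt :: real where "wt = real k + 1 / 2"

text \<open>The usual \<open>Gamma0 (4 * N)\<close>-invariant size of a form of weight
  \<open>wt\<close>; its boundedness is the Hecke bound for \<open>f\<close>.\<close>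

definition height :: "complex \<Rightarrow> real" where
  "height z = norm (f z) * Im z powr (wt / 2)"

lemma f_hol: "f holomorphic_on {z. Im z > 0}"
  using f by (simp add: half_weight_cusp_forms_def upper_half_plane_def)

lemma f_transform:
  assumes "(a, b, c, d) \<in> Gamma0 (4 * N)" "Im z > 0"
  shows "f (moebius (a, b, c, d) z) = of_int (Shimura_symbol c d) ^ (2 * k + 1) *
          eps_factor d powi (- 2 * int k - 1) * half_power (autom (a, b, c, d) z) k * f z"
  using assms f by (auto simp: half_weight_cusp_forms_def upper_half_plane_def moebius_def autom_def)

lemma f_transform_norm:
  assumes "(a, b, c, d) \<in> Gamma0 (4 * N)" "Im z > 0"
  shows "norm (f (moebius (a, b, c, d) z)) = norm (autom (a, b, c, d) z) powr wt * norm (f z)"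
proof -
  have "\<bar>Shimura_symbol c d\<bar> = 1"
    using assms(1) by (intro Shimura_symbol_unit[of a d b c]) (auto simp: Gamma0_def SL2Z_def)
  then have "norm (of_int (Shimura_symbol c d) :: complex) = 1"
    by (simp flip: of_int_abs)
  then show ?thesis
    unfolding f_transform[OF assms] norm_mult norm_half_power
    by (simp add: norm_mult norm_power norm_power_int wt_def)
qed

text \<open>Squaring removes the sign of the symbol and the choice of the root, and \<open>d\<close>
  congruent to 1 makes \<open>eps_factor d = 1\<close>; what remains is the law of integral weight
  \<open>2 * k + 1\<close>.\<close>

lemma f_transform_square:
  assumes "(a, b, c, d) \<in> Gamma0 (4 * N)" "Im z > 0" "[d = 1] (mod 4)"
  shows "(f (moebius (a, b, c, d) z))\<^sup>2 = autom (a, b, c, d) z ^ (2 * k + 1) * (f z)\<^sup>2"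
proof -
  have "\<bar>Shimura_symbol c d\<bar> = 1"
    using assms(1) by (intro Shimura_symbol_unit[of a d b c]) (auto simp: Gamma0_def SL2Z_def)
  then have "Shimura_symbol c d = 1 \<or> Shimura_symbol c d = - 1" by linarith
  then have "(of_int (Shimura_symbol c d) ^ (2 * k + 1))\<^sup>2 = (1 :: complex)" by auto
  moreover have "eps_factor d = 1" using assms(3) by (simp add: eps_factor_def)
  ultimately show ?thesis
    unfolding f_transform[OF assms(1,2)] power_mult_distrib half_power_square by simp
qed

lemma height_invariant:
  assumes "(a, b, c, d) \<in> Gamma0 (4 * N)" "Im z > 0"
  shows "height (moebius (a, b, c, d) z) = height z"
proof -
  have S: "(a, b, c, d) \<in> SL2Z" using assms Gamma0_SL2Z by blast
  define j where "j = norm (autom (a, b, c, d) z)"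
  have j: "j > 0" unfolding j_def using autom_nonzero[OF S assms(2)] by simp
  have "j\<^sup>2 = j powr 2" using j by simp
  then have "(j\<^sup>2) powr (wt / 2) = j powr wt"
    by (simp only: powr_powr) simp
  then show ?thesis
    unfolding height_def f_transform_norm[OF assms] moebius_Im[OF S assms(2)] j_def[symmetric]
    using j assms(2) by (simp add: powr_divide)
qed

text \<open>The square of \<open>f\<close> under the slash action of weight
  \<open>2 * k + 1\<close>, which describes \<open>f\<close> at the cusp to which
  \<open>\<gamma>\<close> sends infinity.\<close>

definition pulled :: "int \<times> int \<times> int \<times> int \<Rightarrow> complex \<Rightarrow> complex" where
  "pulled \<gamma> z = (f (moebius \<gamma> z))\<^sup>2 / autom \<gamma> z ^ (2 * k + 1)"

lemma pulled_hol:
  assumes "(a, b, c, d) \<in> SL2Z"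
  shows "pulled (a, b, c, d) holomorphic_on {z. Im z > 0}"
proof -
  have nz: "of_int c * z + of_int d \<noteq> 0" if "Im z > 0" for z :: complex
    using autom_nonzero[OF assms that] by (simp add: autom_def)
  have "moebius (a, b, c, d) holomorphic_on {z. Im z > 0}"
    unfolding moebius_def prod.case using nz by (intro holomorphic_intros) auto
  then have "(f \<circ> moebius (a, b, c, d)) holomorphic_on {z. Im z > 0}"
    using moebius_Im_pos[OF assms] by (intro holomorphic_on_compose_gen[OF _ f_hol]) auto
  then have "(\<lambda>z. f (moebius (a, b, c, d) z)) holomorphic_on {z. Im z > 0}" by (simp add: comp_def)
  then show ?thesis
    unfolding pulled_def using autom_nonzero[OF assms]
    by (intro holomorphic_intros) (auto simp: autom_def intro!: holomorphic_intros)
qed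

text \<open>The conjugate of translation by \<open>4N\<close> lies in the principal congruence subgroup of level
  \<open>4N\<close>, where the squared multiplier is trivial; squaring removes all choices of roots.\<close>

lemma pulled_periodic:
  assumes S: "(a, b, c, d) \<in> SL2Z" and z: "Im z > 0"
  shows "pulled (a, b, c, d) (z + of_real (real (4 * N))) = pulled (a, b, c, d) z"
proof -
  define M where "M = int (4 * N)"
  \<comment> \<open>The conjugate of \<open>(1, M, 0, 1)\<close> by \<open>(a, b, c, d)\<close>; the
    identity \<open>t\<close> checks that multiplying by it on the left equals translating by
    \<open>M\<close> on the right.\<close>
  define \<delta> where "\<delta> = (1 - a * c * M, a * a * M, - (c * c * M), 1 + a * c * M)"
  have det: "a * d - b * c = 1" using S by (simp add: SL2Z_def)
  define w where "w = moebius (a, b, c, d) z"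
  have w: "Im w > 0" unfolding w_def by (rule moebius_Im_pos[OF S z])
  have \<delta>: "\<delta> \<in> Gamma0 (4 * N)"
    unfolding \<delta>_def Gamma0_def SL2Z_def by (simp add: M_def algebra_simps)
  have t: "((1 - a * c * M) * a + (a * a * M) * c, (1 - a * c * M) * b + (a * a * M) * d,
            (- (c * c * M)) * a + (1 + a * c * M) * c, (- (c * c * M)) * b + (1 + a * c * M) * d) =
           (a, b + a * M, c, d + c * M)"
  proof -
    have "(1 - a * c * M) * b + (a * a * M) * d = b + a * M * (a * d - b * c)"
         "(- (c * c * M)) * b + (1 + a * c * M) * d = d + c * M * (a * d - b * c)"
      by (simp_all add: algebra_simps)
    then show ?thesis unfolding det by (simp add: algebra_simps)
  qed
  have sh: "moebius (a, b + a * M, c, d + c * M) z = moebius (a, b, c, d) (z + of_real (real (4 * N)))"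
    "autom (a, b + a * M, c, d + c * M) z = autom (a, b, c, d) (z + of_real (real (4 * N)))"
    by (simp_all add: moebius_def autom_def M_def algebra_simps)
  have m: "moebius \<delta> w = moebius (a, b, c, d) (z + of_real (real (4 * N)))"
    "autom \<delta> w * autom (a, b, c, d) z = autom (a, b, c, d) (z + of_real (real (4 * N)))"
    unfolding w_def \<delta>_def moebius_compose[OF S z] t sh by simp_all
  have "[1 + a * c * M = 1] (mod 4)" by (simp add: M_def cong_iff_dvd_diff)
  then have sq: "(f (moebius \<delta> w))\<^sup>2 = autom \<delta> w ^ (2 * k + 1) * (f w)\<^sup>2"
    using \<delta> w unfolding \<delta>_def by (intro f_transform_square) auto
  have nz: "autom (a, b, c, d) z \<noteq> 0" by (rule autom_nonzero[OF S z])
  have "\<delta> \<in> SL2Z" using \<delta> Gamma0_SL2Z by blast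
  then have nz': "autom \<delta> w \<noteq> 0" unfolding \<delta>_def by (rule autom_nonzero[OF _ w])
  show ?thesis
    unfolding pulled_def m(1)[symmetric] m(2)[symmetric] sq w_def[symmetric]
    using nz nz' by (simp add: power_mult_distrib)
qed

lemma pulled_limit:
  assumes S: "(a, b, c, d) \<in> SL2Z"
  shows "(pulled (a, b, c, d) \<longlongrightarrow> 0) (filtercomap Im at_top)"
proof -
  have "((\<lambda>z. f ((of_int a * z + of_int b) / (of_int c * z + of_int d)) /
               half_power (of_int c * z + of_int d) k) \<longlongrightarrow> 0) (filtercomap Im at_top)"
    using f S unfolding half_weight_cusp_forms_def vanishes_at_cusps_def by auto
  then have "((\<lambda>z. (f ((of_int a * z + of_int b) / (of_int c * z + of_int d)) /
               half_power (of_int c * z + of_int d) k)\<^sup>2) \<longlongrightarrow> 0\<^sup>2) (filtercomap Im at_top)"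
    by (rule tendsto_power)
  then show ?thesis
    by (simp add: pulled_def[abs_def] moebius_def autom_def power_divide half_power_square)
qed

lemma height_square:
  assumes S: "(a, b, c, d) \<in> SL2Z" and z: "Im z > 0"
  shows "(height (moebius (a, b, c, d) z))\<^sup>2 = norm (pulled (a, b, c, d) z) * Im z powr wt"
proof -
  define j where "j = norm (autom (a, b, c, d) z)"
  have j: "j > 0" unfolding j_def using autom_nonzero[OF S z] by simp
  have e: "real (2 * k + 1) = 2 * wt" by (simp add: wt_def)
  have "j\<^sup>2 = j powr 2" using j by simp
  then have "(j\<^sup>2) powr wt = j powr (2 * wt)"
    by (simp only: powr_powr)
  also have "\<dots> = j ^ (2 * k + 1)"
    using powr_realpow[OF j, of "2 * k + 1"] unfolding e .
  finally have jp: "(j\<^sup>2) powr wt = j ^ (2 * k + 1)" .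
  have "((Im z / j\<^sup>2) powr (wt / 2))\<^sup>2 = (Im z / j\<^sup>2) powr wt"
    using z j by (simp add: power2_eq_square flip: powr_add)
  also have "\<dots> = Im z powr wt / j ^ (2 * k + 1)"
    using z j by (simp add: powr_divide jp)
  finally show ?thesis
    unfolding height_def pulled_def moebius_Im[OF S z] power_mult_distrib norm_divide norm_power j_def[symmetric]
    by simp
qed

text \<open>The exponential decay of \<open>pulled\<close> outweighs the power
  \<open>Im z powr wt\<close> on \<open>Im z \<ge> 1 / 5\<close>, the region reached by
  \<open>exists_moebius_Im_large\<close>.\<close>

lemma height_bounded_near_cusp:
  assumes S: "(a, b, c, d) \<in> SL2Z"
  shows "\<exists>B. \<forall>z. Im z \<ge> 1 / 5 \<longrightarrow> height (moebius (a, b, c, d) z) \<le> B"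
proof -
  have M: "real (4 * N) > 0" using N by simp
  obtain B1 where B1: "B1 > 0" "\<And>z. Im z \<ge> 1 / 5 \<Longrightarrow>
      norm (pulled (a, b, c, d) z) \<le> B1 * exp (- (2 * pi / real (4 * N)) * Im z)"
    using periodic_exponential_decay[OF pulled_hol[OF S] M pulled_periodic[OF S] pulled_limit[OF S], of "1 / 5"] by auto
  have "2 * pi / real (4 * N) > 0" using N by simp
  then obtain B2 where B2: "B2 > 0" "\<And>y. y \<ge> 1 / 5 \<Longrightarrow> y powr wt * exp (- (2 * pi / real (4 * N)) * y) \<le> B2"
    using powr_exp_bounded[of "2 * pi / real (4 * N)" "1 / 5" wt] by auto
  show ?thesis
  proof (intro exI[of _ "sqrt (B1 * B2)"] allI impI real_le_rsqrt)
    fix z assume z: "Im z \<ge> 1 / 5"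
    then have "(height (moebius (a, b, c, d) z))\<^sup>2 = norm (pulled (a, b, c, d) z) * Im z powr wt"
      by (intro height_square S) auto
    also have "\<dots> \<le> B1 * exp (- (2 * pi / real (4 * N)) * Im z) * Im z powr wt"
      by (intro mult_right_mono B1 z) auto
    also have "\<dots> = B1 * (Im z powr wt * exp (- (2 * pi / real (4 * N)) * Im z))" by simp
    also have "\<dots> \<le> B1 * B2" using B1 B2 z by (intro mult_left_mono) auto
    finally show "(height (moebius (a, b, c, d) z))\<^sup>2 \<le> B1 * B2" .
  qed
qed

text \<open>If the bottom rows agree modulo \<open>4 * N\<close>, the first matrix times the inverse
  of the second, here \<open>\<delta>\<close>, lies in \<open>Gamma0 (4 * N)\<close>. So the bound
  near a cusp depends only on the bottom row modulo \<open>4 * N\<close>, that is, on finitely many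
  classes.\<close>

lemma height_same_class:
  assumes S: "(a, b, c, d) \<in> SL2Z" "(a', b', c', d') \<in> SL2Z" and w: "Im w > 0"
    and cong: "[c = c'] (mod int (4 * N))" "[d = d'] (mod int (4 * N))"
  shows "height (moebius (a, b, c, d) w) = height (moebius (a', b', c', d') w)"
proof -
  define \<delta> where "\<delta> = (a * d' - b * c', b * a' - a * b', c * d' - d * c', d * a' - c * b')"
  have det: "a * d - b * c = 1" "a' * d' - b' * c' = 1" using S by (auto simp: SL2Z_def)
  have "[c * d' - d * c' = c' * d' - d' * c'] (mod int (4 * N))"
    by (intro cong_diff cong_mult cong cong_refl)
  then have "int (4 * N) dvd c * d' - d * c'" by (simp add: cong_0_iff mult.commute)
  moreover have "(a * d' - b * c') * (d * a' - c * b') - (b * a' - a * b') * (c * d' - d * c') =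
      (a * d - b * c) * (a' * d' - b' * c')" by (simp add: algebra_simps)
  ultimately have \<delta>: "\<delta> \<in> Gamma0 (4 * N)"
    using det by (simp add: \<delta>_def Gamma0_def SL2Z_def)
  have t: "((a * d' - b * c') * a' + (b * a' - a * b') * c', (a * d' - b * c') * b' + (b * a' - a * b') * d',
     (c * d' - d * c') * a' + (d * a' - c * b') * c', (c * d' - d * c') * b' + (d * a' - c * b') * d') = (a, b, c, d)"
  proof -
    have "(a * d' - b * c') * a' + (b * a' - a * b') * c' = a * (a' * d' - b' * c')"
      "(a * d' - b * c') * b' + (b * a' - a * b') * d' = b * (a' * d' - b' * c')"
      "(c * d' - d * c') * a' + (d * a' - c * b') * c' = c * (a' * d' - b' * c')"
      "(c * d' - d * c') * b' + (d * a' - c * b') * d' = d * (a' * d' - b' * c')"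
      by (simp_all add: algebra_simps)
    then show ?thesis unfolding det by simp
  qed
  have "moebius \<delta> (moebius (a', b', c', d') w) = moebius (a, b, c, d) w"
    unfolding \<delta>_def moebius_compose(1)[OF S(2) w] t ..
  moreover have "height (moebius \<delta> (moebius (a', b', c', d') w)) = height (moebius (a', b', c', d') w)"
    using \<delta> moebius_Im_pos[OF S(2) w] unfolding \<delta>_def by (rule height_invariant)
  ultimately show ?thesis by simp
qed

text \<open>Every point is carried to \<open>Im z \<ge> 1 / 5\<close> by some matrix, so its height
  is bounded by the constant of the residue class of the inverse matrix. The finitely many constants
  are summed; classes without a matrix satisfy the bound vacuously.\<close>

lemma height_bounded: "\<exists>B>0. \<forall>z. Im z > 0 \<longrightarrow> height z \<le> B"
proof -
  define M where "M = int (4 * N)"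
  have M: "M > 0" using N by (simp add: M_def)
  have "\<exists>B. \<forall>a b c d z. (a, b, c, d) \<in> SL2Z \<longrightarrow> (c mod M, d mod M) = p \<longrightarrow> Im z \<ge> 1 / 5 \<longrightarrow>
          height (moebius (a, b, c, d) z) \<le> B" for p
  proof (cases "\<exists>a b c d. (a, b, c, d) \<in> SL2Z \<and> (c mod M, d mod M) = p")
    case True
    then obtain a' b' c' d' where S': "(a', b', c', d') \<in> SL2Z" "(c' mod M, d' mod M) = p" by blast
    obtain B where B: "\<And>z. Im z \<ge> 1 / 5 \<Longrightarrow> height (moebius (a', b', c', d') z) \<le> B"
      using height_bounded_near_cusp[OF S'(1)] by blast
    show ?thesis
    proof (intro exI[of _ B] allI impI)
      fix a b c d z
      assume S: "(a, b, c, d) \<in> SL2Z" "(c mod M, d mod M) = p" "Im z \<ge> 1 / 5"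
      have "height (moebius (a, b, c, d) z) = height (moebius (a', b', c', d') z)"
        using S S' by (intro height_same_class) (auto simp: cong_def M_def)
      then show "height (moebius (a, b, c, d) z) \<le> B" using B[OF S(3)] by simp
    qed
  qed blast
  then obtain B where B: "\<And>p a b c d z. (a, b, c, d) \<in> SL2Z \<Longrightarrow> (c mod M, d mod M) = p \<Longrightarrow> Im z \<ge> 1 / 5 \<Longrightarrow>
      height (moebius (a, b, c, d) z) \<le> B p"
    by metis
  define R where "R = {0..<M} \<times> {0..<M}"
  have R: "finite R" by (simp add: R_def)
  define B' where "B' = 1 + (\<Sum>p\<in>R. \<bar>B p\<bar>)"
  show ?thesis
  proof (intro exI[of _ B'] conjI allI impI)
    show "B' > 0" unfolding B'_def by (intro add_pos_nonneg sum_nonneg) auto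
    fix z :: complex assume z: "Im z > 0"
    obtain a b c d where S: "(a, b, c, d) \<in> SL2Z" and w: "Im (moebius (a, b, c, d) z) \<ge> 1 / 5"
      using exists_moebius_Im_large[OF z] by blast
    have det: "a * d - b * c = 1" using S by (simp add: SL2Z_def)
    have S': "(d, - b, - c, a) \<in> SL2Z" using S by (simp add: SL2Z_def algebra_simps)
    have t: "(d * a + - b * c, d * b + - b * d, - c * a + a * c, - c * b + a * d) = (1, 0, 0, 1)"
      using det by (simp add: algebra_simps)
    have "moebius (d, - b, - c, a) (moebius (a, b, c, d) z) = z"
      unfolding moebius_compose(1)[OF S z] t by (simp add: moebius_def)
    then have "height z \<le> B (- c mod M, a mod M)"
      using B[OF S' refl w] by simp
    also have "\<dots> \<le> \<bar>B (- c mod M, a mod M)\<bar>" by simp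
    also have "\<dots> \<le> (\<Sum>p\<in>R. \<bar>B p\<bar>)"
      using R M by (intro member_le_sum) (auto simp: R_def)
    finally show "height z \<le> B'" by (simp add: B'_def)
  qed
qed

section \<open>Periodicity and growth of \<open>f\<close>\<close>

lemma f_periodic: "Im z > 0 \<Longrightarrow> f (z + 1) = f z"
proof -
  assume z: "Im z > 0"
  have "(1, 1, 0, 1) \<in> Gamma0 (4 * N)" by (simp add: Gamma0_def SL2Z_def)
  from f_transform[OF this z] show ?thesis
    by (simp add: moebius_def autom_def Shimura_symbol_def eps_factor_def half_power_def)
qed

lemma f_periodic_int:
  assumes "Im z > 0"
  shows "f (z + of_int n) = f z"
proof (induction n rule: int_induct[of _ 0])
  case (step1 i)
  then show ?case using f_periodic[of "z + of_int i"] assms by (simp add: add.assoc)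
next
  case (step2 i)
  have "z + of_int (i - 1) + 1 = z + of_int i" by simp
  then show ?case using f_periodic[of "z + of_int (i - 1)"] assms step2 by (simp only:) simp
qed simp

text \<open>Below \<open>Im z = 1\<close> a larger exponent only weakens the height bound; above it
  the exponential decay at infinity beats every power.\<close>

lemma f_growth:
  assumes A: "A \<ge> wt / 2"
  shows "\<exists>K>0. \<forall>z. Im z > 0 \<longrightarrow> norm (f z) \<le> K * Im z powr (- A)"
proof -
  obtain B where B: "B > 0" "\<And>z. Im z > 0 \<Longrightarrow> height z \<le> B"
    using height_bounded by blast
  have lim: "(f \<longlongrightarrow> 0) (filtercomap Im at_top)"
  proof -
    have I: "(1, 0, 0, 1) \<in> SL2Z" by (simp add: SL2Z_def)
    have "((\<lambda>z. f ((of_int 1 * z + of_int 0) / (of_int 0 * z + of_int 1)) /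
               half_power (of_int 0 * z + of_int 1) k) \<longlongrightarrow> 0) (filtercomap Im at_top)"
      using f I unfolding half_weight_cusp_forms_def vanishes_at_cusps_def by fast
    then show ?thesis by (simp add: half_power_def)
  qed
  have per: "f (z + of_real 1) = f z" if "Im z > 0" for z using f_periodic[OF that] by simp
  obtain B1 where B1: "B1 > 0" "\<And>z. Im z \<ge> 1 \<Longrightarrow> norm (f z) \<le> B1 * exp (- (2 * pi / 1) * Im z)"
    using periodic_exponential_decay[OF f_hol zero_less_one per lim zero_less_one] by auto
  obtain B2 where B2: "B2 > 0" "\<And>y. y \<ge> 1 \<Longrightarrow> y powr A * exp (- (2 * pi / 1) * y) \<le> B2"
    using powr_exp_bounded[of "2 * pi / 1" 1 A] by auto
  show ?thesis
  proof (intro exI[of _ "max B (B1 * B2)"] conjI allI impI)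
    show "max B (B1 * B2) > 0" using B by simp
    fix z assume z: "Im z > 0"
    show "norm (f z) \<le> max B (B1 * B2) * Im z powr (- A)"
    proof (cases "Im z \<ge> 1")
      case True
      have "norm (f z) \<le> B1 * exp (- (2 * pi / 1) * Im z)" by (rule B1(2)[OF True])
      also have "\<dots> = B1 * (Im z powr A * exp (- (2 * pi / 1) * Im z)) * Im z powr (- A)"
        using z by (simp add: powr_minus field_simps)
      also have "\<dots> \<le> B1 * B2 * Im z powr (- A)"
        using B1 B2(2)[OF True] by (intro mult_right_mono mult_left_mono) auto
      also have "\<dots> \<le> max B (B1 * B2) * Im z powr (- A)"
        by (intro mult_right_mono) auto
      finally show ?thesis .
    next
      case False
      have "norm (f z) = height z * Im z powr (- (wt / 2))"
        using z by (simp add: height_def powr_minus)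
      also have "\<dots> \<le> B * Im z powr (- (wt / 2))"
        by (intro mult_right_mono B z) auto
      also have "\<dots> \<le> B * Im z powr (- A)"
        using False z A B by (intro mult_left_mono powr_mono') auto
      also have "\<dots> \<le> max B (B1 * B2) * Im z powr (- A)"
        by (intro mult_right_mono) auto
      finally show ?thesis .
    qed
  qed
qed

end

section \<open>The main theorem\<close>

lemma csqrt_i_times_real:
  assumes "x > 0"
  shows "csqrt (\<i> * of_real x) = of_real (sqrt x) * csqrt \<i>"
  using assms by (simp add: complex_eq_iff real_sqrt_divide real_sqrt_mult norm_mult)

text \<open>Conjugating the expansion sends \<open>z\<close> to \<open>- cnj z\<close> and
  conjugates the coefficients, which costs the sign \<open>\<eta> = 1\<close> for real and
  \<open>\<eta> = - 1\<close> for imaginary coefficients.\<close>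

lemma cnj_fourier_expansion:
  assumes f: "is_fourier_expansion f a"
    and a: "(\<forall>n\<ge>1. Im (a n) = 0) \<or> (\<forall>n\<ge>1. Re (a n) = 0)"
  shows "\<exists>\<eta>. norm \<eta> = 1 \<and> (\<forall>z. Im z > 0 \<longrightarrow> f (- cnj z) = \<eta> * cnj (f z))"
proof -
  obtain \<eta> :: complex where \<eta>: "norm \<eta> = 1" "\<And>n. n \<ge> 1 \<Longrightarrow> a n = \<eta> * cnj (a n)"
    using a
  proof
    assume "\<forall>n\<ge>1. Im (a n) = 0"
    then show ?thesis by (intro that[of 1]) (auto simp: complex_eq_iff)
  next
    assume "\<forall>n\<ge>1. Re (a n) = 0"
    then show ?thesis by (intro that[of "- 1"]) (auto simp: complex_eq_iff)
  qed
  show ?thesis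
  proof (intro exI[of _ \<eta>] conjI \<eta> allI impI)
    fix z :: complex assume z: "Im z > 0"
    have "((\<lambda>n. a n * exp (2 * of_real pi * \<i> * of_nat n * z)) has_sum f z) {1..}"
      using f z by (simp add: is_fourier_expansion_def upper_half_plane_def)
    then have "((\<lambda>n. \<eta> * cnj (a n * exp (2 * of_real pi * \<i> * of_nat n * z))) has_sum \<eta> * cnj (f z)) {1..}"
      by (intro has_sum_cmult_right) (simp only: has_sum_cnj_iff)
    moreover have "\<eta> * cnj (a n * exp (2 * of_real pi * \<i> * of_nat n * z)) =
        a n * exp (2 * of_real pi * \<i> * of_nat n * (- cnj z))" if "n \<in> {1..}" for n
    proof -
      have "cnj (exp (2 * of_real pi * \<i> * of_nat n * z)) = exp (2 * of_real pi * \<i> * of_nat n * (- cnj z))"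
        by (simp add: exp_cnj)
      then show ?thesis using \<eta>(2)[of n] that by (simp add: mult.assoc[symmetric])
    qed
    ultimately have "((\<lambda>n. a n * exp (2 * of_real pi * \<i> * of_nat n * (- cnj z))) has_sum \<eta> * cnj (f z)) {1..}"
      by (subst (asm) has_sum_cong) auto
    moreover have "((\<lambda>n. a n * exp (2 * of_real pi * \<i> * of_nat n * (- cnj z))) has_sum f (- cnj z)) {1..}"
      using f[unfolded is_fourier_expansion_def upper_half_plane_def, rule_format, of "- cnj z"] z by simp
    ultimately show "f (- cnj z) = \<eta> * cnj (f z)" using has_sum_unique by blast
  qed
qed

text \<open>Both fractions are in lowest terms, so \<open>c\<close> is \<open>q\<close> or
  \<open>- q\<close>; in the second case the negated matrix is taken.\<close>

lemma Gamma0_equiv_infinity_matrix: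
  assumes "q > 0" "coprime p q" "Gamma0_equiv_infinity M (of_int p / of_int q)"
  shows "\<exists>b d. (p, b, q, d) \<in> Gamma0 M"
proof -
  obtain a b c d where m: "(a, b, c, d) \<in> Gamma0 M" and c: "c \<noteq> 0"
    and eq: "of_int p / of_int q = (of_int a / of_int c :: rat)"
    using assms(3) unfolding Gamma0_equiv_infinity_def by auto
  have det: "a * d - b * c = 1" and dv: "int M dvd c"
    using m by (auto simp: Gamma0_def SL2Z_def)
  have "of_int (p * c) = (of_int (a * q) :: rat)"
    using eq c assms(1) by (simp add: field_simps)
  then have pc: "p * c = a * q" by (simp only: of_int_eq_iff)
  have "coprime a c"
  proof (rule coprimeI)
    fix e assume "e dvd a" "e dvd c"
    then have "e dvd a * d - b * c" by (intro dvd_diff dvd_mult2 dvd_mult)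
    then show "is_unit e" using det by simp
  qed
  then have "q dvd c" "c dvd q"
    using pc assms(2) by (metis coprime_commute coprime_dvd_mult_right_iff dvd_triv_right mult.commute dvd_triv_left)+
  then have "\<bar>c\<bar> = q" using assms(1) by (metis abs_of_pos zdvd_antisym_abs)
  then consider "c = q" | "c = - q" by linarith
  then show ?thesis
  proof cases
    case 1
    then have "a = p" using pc assms(1) by simp
    then show ?thesis using m 1 by blast
  next
    case 2
    then have "a * q = (- p) * q" using pc by simp
    then have "a = - p" using assms(1) by (metis less_irrefl mult_cancel_right)
    then have "(p, - b, q, - d) \<in> Gamma0 M"
      using det dv 2 by (simp add: Gamma0_def SL2Z_def)
    then show ?thesis by blast
  qed
qed

theorem theorem1p3:
  fixes k N :: nat and p q :: int
    and f :: "complex \<Rightarrow> complex" and a :: "nat \<Rightarrow> complex"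
  assumes "k \<ge> 1" and "N > 0"
    and "q > 0" and "coprime p q"
    and "Gamma0_equiv_infinity (4 * N) (of_int p / of_int q)"
    and "[p\<^sup>2 = 1] (mod q)"
    and "f \<in> half_weight_cusp_forms k N"
    and "is_fourier_expansion f a"
    and "\<exists>z \<in> upper_half_plane. f z \<noteq> 0"
    and "(\<forall>n\<ge>1. Im (a n) = 0) \<or> (\<forall>n\<ge>1. Re (a n) = 0)"
  shows "\<exists>d::real. d > 0 \<and>
           ereal d < Liminf at_top (\<lambda>T::real. ereal (real (critical_zero_count k a p q T) / T))"
proof -
  interpret cusp_form k N f by unfold_locales (use assms in auto)
  obtain \<eta> where \<eta>: "norm \<eta> = 1" "\<And>z. Im z > 0 \<Longrightarrow> f (- cnj z) = \<eta> * cnj (f z)"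
    using cnj_fourier_expansion[OF assms(8,10)] by blast
  obtain b d where m: "(p, b, q, d) \<in> Gamma0 (4 * N)"
    using Gamma0_equiv_infinity_matrix[OF assms(3-5)] by blast
  have S: "(p, b, q, d) \<in> SL2Z" using m Gamma0_SL2Z by blast
  have q: "q > 0" by fact
  \<comment> \<open>\<open>p * d\<close> and \<open>p\<^sup>2\<close> are both 1 modulo
    \<open>q\<close>. Thus \<open>- d / q\<close> and \<open>- p / q\<close> differ by an integer,
    so that conjugation and translation lead back to the twist by \<open>p / q\<close>.\<close>
  have "q dvd d - p"
  proof -
    have "q dvd p\<^sup>2 - 1" using assms(6) by (simp add: cong_iff_dvd_diff)
    moreover have "p * d - 1 = q * b" using S by (simp add: SL2Z_def mult.commute)
    then have "q dvd p * d - 1" by simp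
    ultimately have "q dvd (p * d - 1) - (p\<^sup>2 - 1)" by (rule dvd_diff[rotated])
    then have "q dvd p * (d - p)" by (simp add: power2_eq_square algebra_simps)
    then show ?thesis using assms(4) by (simp add: coprime_commute coprime_dvd_mult_right_iff)
  qed
  then obtain n where n: "d = p + q * n" by (metis add_diff_cancel_left' diff_add_cancel dvdE add.commute)
  define \<mu> where "\<mu> = of_int (Shimura_symbol q d) ^ (2 * k + 1) * eps_factor d powi (- 2 * int k - 1)"
  have \<mu>: "norm \<mu> = 1"
  proof -
    have "\<bar>Shimura_symbol q d\<bar> = 1"
      using S by (intro Shimura_symbol_unit[of p d b q]) (auto simp: SL2Z_def)
    then have "norm (of_int (Shimura_symbol q d) :: complex) = 1" by (simp flip: of_int_abs)
    then show ?thesis by (simp add: \<mu>_def norm_mult norm_power norm_power_int)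
  qed
  define \<alpha> where "\<alpha> = 2 * pi / real_of_int q"
  define F where "F w = f (of_int p / of_int q + \<i> * w / of_int q)" for w
  define B where "B n = a n * exp (2 * of_real pi * \<i> * of_int p * of_nat n / of_int q)" for n
  \<comment> \<open>For real \<open>x > 0\<close> the root of \<open>\<i> * x\<close> is
    \<open>sqrt x * csqrt \<i>\<close>, so the multiplier, the root of \<open>\<i>\<close> and the
    sign from conjugation form a constant phase.\<close>
  define C where "C = \<mu> * csqrt \<i> ^ (2 * k + 1) * \<eta>"
  have Im_arg: "Im (x + \<i> * w / of_int q) = Re w / of_int q" if "Im x = 0" for x w
    using that by (simp add: Im_divide power2_eq_square)
  have Impq: "Im (of_int p / of_int q) = 0" by (simp add: Im_divide)
  have inv: "F (1 / w) = \<mu> * half_power (\<i> * w) k * (\<eta> * cnj (F (cnj w)))" if w: "Re w > 0" for w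
  proof -
    have w0: "w \<noteq> 0" using w by auto
    have q0: "(of_int q :: complex) \<noteq> 0" using q by simp
    \<comment> \<open>Chosen so that the automorphy factor is \<open>\<i> * w\<close> and the matrix
      maps \<open>z\<close> to the argument of \<open>f\<close> in \<open>F (1 / w)\<close>.\<close>
    define z where "z = - of_int d / of_int q + \<i> * w / of_int q"
    have z: "Im z > 0"
      unfolding z_def by (subst Im_arg) (use w q in \<open>auto simp: Im_divide\<close>)
    have az: "autom (p, b, q, d) z = \<i> * w"
      using q0 by (simp add: autom_def z_def field_simps)
    have det: "of_int p * of_int d - of_int b * of_int q = (1 :: complex)"
      using S by (simp add: SL2Z_def flip: of_int_mult of_int_diff)
    have "moebius (p, b, q, d) z = of_int p / of_int q + \<i> * (1 / w) / of_int q"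
    proof -
      have "moebius (p, b, q, d) z = (of_int p * z + of_int b) / (\<i> * w)"
        using az by (simp add: moebius_def autom_def)
      also have "of_int p * z + of_int b = (of_int p * (\<i> * w) - (of_int p * of_int d - of_int b * of_int q)) / of_int q"
        using q0 by (simp add: z_def field_simps)
      also have "\<dots> / (\<i> * w) = of_int p / of_int q + \<i> * (1 / w) / of_int q"
        unfolding det using q0 w0 by (simp add: field_simps)
      finally show ?thesis .
    qed
    then have "F (1 / w) = \<mu> * half_power (\<i> * w) k * f z"
      using f_transform[OF m z] unfolding F_def az \<mu>_def by simp
    also have "f z = \<eta> * cnj (F (cnj w))"
    proof -
      define y where "y = of_int p / of_int q + \<i> * cnj w / of_int q"
      have y: "Im y > 0" unfolding y_def by (subst Im_arg) (use w q Impq in auto)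
      \<comment> \<open>Here \<open>d = p + q * n\<close> is used: the reflected point differs from
        \<open>z\<close> by an integer.\<close>
      have "- cnj y = z + of_int n"
        using q0 by (simp add: y_def z_def n field_simps)
      then have "f z = f (- cnj y)" using f_periodic_int[OF z] by simp
      then show ?thesis using \<eta>(2)[OF y] by (simp add: F_def y_def)
    qed
    finally show ?thesis .
  qed
  have half_real: "half_power (\<i> * of_real x) k = csqrt \<i> ^ (2 * k + 1) * of_real (x powr wt)" if x: "x > 0" for x
  proof -
    have "sqrt x ^ (2 * k + 1) = x powr wt"
    proof -
      have "sqrt x ^ (2 * k + 1) = norm (half_power (of_real x) k)"
        using x by (simp add: half_power_def norm_mult norm_power)
      also have "\<dots> = x powr wt" using x by (simp add: norm_half_power wt_def)
      finally show ?thesis .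
    qed
    then have "of_real (sqrt x) ^ (2 * k + 1) = complex_of_real (x powr wt)"
      by (metis of_real_power)
    then show ?thesis
      unfolding half_power_def csqrt_i_times_real[OF x] power_mult_distrib by (simp only: mult.commute)
  qed
  interpret tw: twisted_form F B wt \<alpha> C
  proof
    show "wt \<ge> 1" using assms(1) by (simp add: wt_def)
    show "\<alpha> > 0" using q by (simp add: \<alpha>_def)
    have up: "of_int p / of_int q + \<i> * w / of_int q \<in> {z. Im z > 0}" if "Re w > 0" for w
      using that q Impq by (simp only: mem_Collect_eq Im_arg) simp
    show "continuous_on {w. 0 < Re w} F"
      unfolding F_def
      by (rule continuous_on_compose2[OF holomorphic_on_imp_continuous_on[OF f_hol]])
         (use up q in \<open>auto intro!: continuous_intros\<close>)
    show "((\<lambda>n. B n * exp (- (of_real \<alpha> * of_nat n * w))) has_sum F w) {1..}" if w: "Re w > 0" for w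
    proof -
      have "((\<lambda>n. a n * exp (2 * of_real pi * \<i> * of_nat n * (of_int p / of_int q + \<i> * w / of_int q))) has_sum F w) {1..}"
        using assms(8) up[OF w] unfolding is_fourier_expansion_def upper_half_plane_def F_def by blast
      moreover have "2 * of_real pi * \<i> * of_nat n * (of_int p / of_int q + \<i> * w / of_int q) =
         2 * of_real pi * \<i> * of_int p * of_nat n / of_int q + - (of_real \<alpha> * of_nat n * w)" for n
        using q by (simp add: \<alpha>_def field_simps)
      ultimately show ?thesis by (simp only: B_def exp_add mult.assoc)
    qed
    show "\<exists>M>0. \<forall>w. 0 < Re w \<longrightarrow> norm (F w) \<le> M * Re w powr - A" if A: "wt / 2 \<le> A" for A
    proof -
      obtain K where K: "K > 0" "\<And>z. Im z > 0 \<Longrightarrow> norm (f z) \<le> K * Im z powr (- A)"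
        using f_growth[OF A] by blast
      show ?thesis
      proof (intro exI[of _ "K * real_of_int q powr A"] conjI allI impI)
        show "K * real_of_int q powr A > 0" using K q by simp
        fix w assume w: "Re w > 0"
        have "norm (F w) \<le> K * (Re w / of_int q) powr (- A)"
          using K(2)[of "of_int p / of_int q + \<i> * w / of_int q"] up[OF w] unfolding F_def Im_arg[OF Impq] by simp
        also have "\<dots> = K * real_of_int q powr A * Re w powr - A"
          using w q by (simp add: powr_divide powr_minus field_simps)
        finally show "norm (F w) \<le> K * real_of_int q powr A * Re w powr - A" .
      qed
    qed
    show "norm (F (1 / w)) = norm w powr wt * norm (F (cnj w))" if "Re w > 0" for w
      unfolding inv[OF that] norm_mult norm_half_power using \<mu> \<eta> by (simp add: wt_def norm_mult)
    show "F (of_real (1 / x)) = C * of_real (x powr wt) * cnj (F (of_real x))" if x: "x > 0" for x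
      using inv[of "of_real x"] x unfolding half_real[OF x] C_def by (simp add: mult_ac)
    have "norm (csqrt \<i>) = 1" by (simp only: norm_csqrt norm_ii real_sqrt_one)
    then show "norm C = 1" unfolding C_def norm_mult norm_power using \<mu> \<eta> by simp
    show "\<exists>n\<ge>1. B n \<noteq> 0"
    proof (rule ccontr)
      assume "\<not> ?thesis"
      then have a0: "a n = 0" if "n \<ge> 1" for n using that by (auto simp: B_def)
      obtain z where z: "Im z > 0" "f z \<noteq> 0" using assms(9) by (auto simp: upper_half_plane_def)
      have "((\<lambda>n. a n * exp (2 * of_real pi * \<i> * of_nat n * z)) has_sum f z) {1..}"
        using assms(8) z by (simp add: is_fourier_expansion_def upper_half_plane_def)
      moreover have "((\<lambda>n. a n * exp (2 * of_real pi * \<i> * of_nat n * z)) has_sum 0) {1..}"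
        by (rule has_sum_0) (use a0 in auto)
      ultimately show False using z has_sum_unique by blast
    qed
  qed
  have L_eq: "twisted_L a p q = tw.L"
    unfolding twisted_L_def
  \<comment> \<open>Any other candidate agrees with \<open>tw.L\<close> on a common right half
    plane, hence everywhere by the identity theorem.\<close>
  proof (rule the_equality)
    show "tw.L holomorphic_on UNIV \<and> (\<exists>\<sigma>::real. \<forall>s. Re s > \<sigma> \<longrightarrow>
        ((\<lambda>n. a n * exp (2 * of_real pi * \<i> * of_int p * of_nat n / of_int q) * of_nat n powr (- s)) has_sum tw.L s) {1..})"
      using tw.L_holomorphic tw.L_has_sum unfolding B_def by blast
    fix L' assume L': "L' holomorphic_on UNIV \<and> (\<exists>\<sigma>::real. \<forall>s. Re s > \<sigma> \<longrightarrow>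
        ((\<lambda>n. a n * exp (2 * of_real pi * \<i> * of_int p * of_nat n / of_int q) * of_nat n powr (- s)) has_sum L' s) {1..})"
    then obtain \<sigma> where \<sigma>: "\<And>s. Re s > \<sigma> \<Longrightarrow> ((\<lambda>n. B n * of_nat n powr (- s)) has_sum L' s) {1..}"
      unfolding B_def by blast
    define \<sigma>' where "\<sigma>' = max \<sigma> (wt / 2 + 1)"
    have "L' s - tw.L s = 0" for s
    proof (rule analytic_continuation[where f = "\<lambda>s. L' s - tw.L s" and S = UNIV and U = "{s. Re s > \<sigma>'}" and \<xi> = "of_real (\<sigma>' + 1)"])
      show "(\<lambda>s. L' s - tw.L s) holomorphic_on UNIV"
        using L' tw.L_holomorphic by (intro holomorphic_intros) auto
      show "of_real (\<sigma>' + 1) islimpt {s. Re s > \<sigma>'}"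
        by (rule open_imp_islimpt) (auto simp: open_halfspace_Re_gt)
      fix s assume "s \<in> {s. Re s > \<sigma>'}"
      then have "L' s = tw.L s"
        using \<sigma>[of s] tw.L_has_sum[of s] has_sum_unique by (auto simp: \<sigma>'_def)
      then show "L' s - tw.L s = 0" by simp
    qed auto
    then show "L' = tw.L" by (intro ext) simp
  qed
  have count: "critical_zero_count k a p q T = card {t. 0 \<le> t \<and> t \<le> T \<and> tw.L (Complex (wt / 2) t) = 0}" for T
  proof -
    have s: "of_nat k / 2 + 1 / 4 + \<i> * of_real t = Complex (wt / 2) t" for t
      by (simp add: complex_eq_iff wt_def)
    have "{s. \<exists>t::real. 0 \<le> t \<and> t \<le> T \<and> s = of_nat k / 2 + 1 / 4 + \<i> * of_real t \<and> twisted_L a p q s = 0} =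
        Complex (wt / 2) ` {t. 0 \<le> t \<and> t \<le> T \<and> tw.L (Complex (wt / 2) t) = 0}"
      unfolding s L_eq by auto
    then show ?thesis
      unfolding critical_zero_count_def by (simp add: card_image inj_on_def)
  qed
  obtain \<epsilon> T0 where \<epsilon>: "\<epsilon> > 0" and T0: "\<And>T. T \<ge> T0 \<Longrightarrow>
      \<epsilon> * T \<le> real (card {t. 0 \<le> t \<and> t \<le> T \<and> tw.L (Complex (wt / 2) t) = 0})"
    using tw.critical_zeros_density by blast
  have "ereal \<epsilon> \<le> Liminf at_top (\<lambda>T::real. ereal (real (critical_zero_count k a p q T) / T))"
  proof (rule Liminf_bounded)
    show "\<forall>\<^sub>F T in at_top. ereal \<epsilon> \<le> ereal (real (critical_zero_count k a p q T) / T)"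
      using eventually_ge_at_top[of "max 1 T0"]
    proof eventually_elim
      case (elim T)
      then show ?case using T0[of T] unfolding count by (simp add: field_simps)
    qed
  qed
  \<comment> \<open>Halving the constant turns the bound on the limit inferior into the strict
    inequality.\<close>
  moreover have "ereal (\<epsilon> / 2) < ereal \<epsilon>" using \<epsilon> by simp
  ultimately have "ereal (\<epsilon> / 2) < Liminf at_top (\<lambda>T::real. ereal (real (critical_zero_count k a p q T) / T))"
    by (rule less_le_trans[rotated])
  then show ?thesis using \<epsilon> by (intro exI[of _ "\<epsilon> / 2"]) auto
qed

end
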